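(* Let $2<p<6$ and $\mu>0$, and set $$\gamma_p:=\left(\frac2p\right)^{\frac{2}{6-p}}\left(\frac{p-2}{4\int_0^1(1-s^2)^{\frac{4-p}{p-2}}\,ds}\right)^{\frac{p-2}{6-p}}.$$ Then, for $\alpha\in\mathbb{R}$: (i) if $p\leq4$, then ground states of $F$ at mass $\mu$ exist if and only if $\alpha<\gamma_p\,\mu^{\frac{p-2}{6-p}}$; (ii) if $p>4$, then there is a number $\widetilde{h}(\mu)$ (independent of $\alpha$) with $\widetilde{h}(\mu)>\gamma_p\,\mu^{\frac{p-2}{6-p}}$ such that ground states of $F$ at mass $\mu$ exist if and only if $\alpha\leq\widetilde{h}(\mu)$.
   Context: Let $\mathbb{R}^+=(0,+\infty)$. For $p\in(2,6]$ and $\alpha\in\mathbb{R}$, the energy (depending on $\alpha$) is $$F(u)=\frac12\int_0^{+\infty}|u'|^2\,dx-\frac1p\int_0^{+\infty}|u|^p\,dx+\frac{\alpha}{2}|u(0)|^2,\qquad u\in H^1(\mathbb{R}^+),$$ where $u(0)$ is the value at $0$ of the continuous representative of $u$. For $\mu>0$, $H^1_\mu(\mathbb{R}^+):=\{u\in H^1(\mathbb{R}^+):\int_0^{+\infty}|u|^2\,dx=\mu\}$ and $\mathcal{F}(\mu):=\inf_{u\in H^1_\mu(\mathbb{R}^+)}F(u)$. A ground state of $F$ at mass $\mu$ is a function $u\in H^1_\mu(\mathbb{R}^+)$ with $F(u)=\mathcal{F}(\mu)$. Functions are real-valued (this is not restrictive). *)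

theory Defs
  imports "HOL-Analysis.Analysis"
begin

abbreviation halfline :: "real measure" where
  "halfline \<equiv> lebesgue_on {0<..}"

text \<open>Elements of the spaces below are honest functions rather than almost-everywhere classes.
  Values outside the open half-line are irrelevant, and every quantity derived from such a function
  depends only on its class.\<close>

definition L2_halfline :: "(real \<Rightarrow> real) set" where
  "L2_halfline =
     {u. u \<in> borel_measurable halfline \<and> integrable halfline (\<lambda>x. (u x)\<^sup>2)}"

definition test_functions :: "(real \<Rightarrow> real) set" where
  "test_functions =
     {\<phi>. \<phi> C1_differentiable_on UNIV \<and>
         compact (closure {x. \<phi> x \<noteq> 0}) \<and> closure {x. \<phi> x \<noteq> 0} \<subseteq> {0<..}}"

text \<open>As in Brezis, \<^emph>\<open>Functional Analysis, Sobolev Spaces and PDEs\<close>, Section 8.2, weak derivatives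
  on an interval are tested against compactly supported functions of class $C^1$.\<close>

definition has_weak_derivative :: "(real \<Rightarrow> real) \<Rightarrow> (real \<Rightarrow> real) \<Rightarrow> bool" where
  "has_weak_derivative u v \<longleftrightarrow>
     (\<forall>\<phi>\<in>test_functions.
        (LINT x|halfline. u x * deriv \<phi> x) = - (LINT x|halfline. v x * \<phi> x))"

definition H1_halfline :: "(real \<Rightarrow> real) set" where
  "H1_halfline = {u \<in> L2_halfline. \<exists>v\<in>L2_halfline. has_weak_derivative u v}"

text \<open>The weak derivative is unique up to null sets only, hence the choice operator.\<close>

definition weak_deriv :: "(real \<Rightarrow> real) \<Rightarrow> real \<Rightarrow> real" where
  "weak_deriv u = (SOME v. v \<in> L2_halfline \<and> has_weak_derivative u v)"

text \<open>The value at 0 of the representative of \<open>u\<close> that is continuous on the closed half-line;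
  \<open>u 0\<close> itself carries no information.\<close>

definition value_at_0 :: "(real \<Rightarrow> real) \<Rightarrow> real" where
  "value_at_0 u =
     (THE c. \<exists>w. continuous_on {0..} w \<and> (AE x in halfline. w x = u x) \<and> w 0 = c)"

definition energy :: "real \<Rightarrow> real \<Rightarrow> (real \<Rightarrow> real) \<Rightarrow> real" where
  "energy p \<alpha> u =
     1 / 2 * (LINT x|halfline. \<bar>weak_deriv u x\<bar>\<^sup>2)
     - 1 / p * (LINT x|halfline. \<bar>u x\<bar> powr p)
     + \<alpha> / 2 * \<bar>value_at_0 u\<bar>\<^sup>2"

definition H1_mass :: "real \<Rightarrow> (real \<Rightarrow> real) set" where
  "H1_mass \<mu> = {u \<in> H1_halfline. (LINT x|halfline. \<bar>u x\<bar>\<^sup>2) = \<mu>}"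

text \<open>The infimum is taken in the extended reals, so that it is meaningful without a priori
  knowledge that the energy is bounded below.\<close>

definition min_energy :: "real \<Rightarrow> real \<Rightarrow> real \<Rightarrow> ereal" where
  "min_energy p \<alpha> \<mu> = (INF u\<in>H1_mass \<mu>. ereal (energy p \<alpha> u))"

definition ground_state :: "real \<Rightarrow> real \<Rightarrow> real \<Rightarrow> (real \<Rightarrow> real) \<Rightarrow> bool" where
  "ground_state p \<alpha> \<mu> u \<longleftrightarrow>
     u \<in> H1_mass \<mu> \<and> ereal (energy p \<alpha> u) = min_energy p \<alpha> \<mu>"

text \<open>For \<open>p > 4\<close> the integrand is unbounded near \<open>s = 1\<close>, but its exponent exceeds \<open>-1/2\<close>
  when \<open>p < 6\<close>, so the Lebesgue integral is finite.\<close>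

definition gamma_p :: "real \<Rightarrow> real" where
  "gamma_p p =
     (2 / p) powr (2 / (6 - p)) *
     ((p - 2) / (4 * (LINT s|lebesgue_on {0..1}. (1 - s\<^sup>2) powr ((4 - p) / (p - 2)))))
       powr ((p - 2) / (6 - p))"

end

theory Submission imports Defs begin

text \<open>Let \<open>g\<close> be the speed of the soliton of frequency \<open>L\<close>, that is
  \<open>g(t)\<^sup>2 = L\<^sup>2 t\<^sup>2 - 2 t\<^sup>p / p\<close>. If \<open>|u|\<close> stays below the height of that soliton, completing the square gives
  \<open>F\<^sub>0(u) + L\<^sup>2 \<mu> / 2 = \<integral> (|u'| - g(|u|))\<^sup>2 / 2 + \<integral> |u'| g(|u|)\<close>, where \<open>F\<^sub>0\<close> is the energy without
  boundary term, and the last integral is bounded below by the variation of \<open>\<Phi>(|u|)\<close>, \<open>\<Phi>' = g\<close>.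
  Choosing \<open>L\<close> from the maximum of \<open>|u|\<close> and using that the action of a full soliton is convex in \<open>L\<^sup>2\<close>
  (this is \<open>p < 6\<close>), the energy of \<open>u\<close> is at least that of an arc of soliton with mass \<open>\<mu>\<close>
  and the same value at \<open>0\<close>; no compactness or rearrangement argument is needed. These arcs form a
  one-parameter family, indexed by \<open>s \<in> (-1, 1)\<close>, whose end \<open>s = 1\<close> is the full soliton escaping to
  infinity. A ground state exists iff some arc does not have larger energy than that end. The derivative of the
  energy along the family has the sign of \<open>s L(s) - \<alpha>\<close>, so everything is decided by comparing \<open>s L(s)\<close> with
  \<open>L(1) = \<gamma>\<^sub>p \<mu>\<^bsup>(p-2)/(6-p)\<^esup>\<close>: it stays below when \<open>p \<le> 4\<close> and is above near \<open>s = 1\<close> when \<open>p > 4\<close>.\<close>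

section \<open>Weak derivatives and increments\<close>

text \<open>The calibration works only at a frequency \<open>L'\<close> whose soliton is at least as
  high as \<open>|u|\<close>, while the arc to be compared has its own frequency \<open>L\<close>.
  Passing from one to the other is harmless because the derivative of an action with respect to
  \<open>L^2\<close> is half the corresponding mass, which balances the term
  \<open>L^2 \<mu> / 2\<close>. An arc through the peak is two full branches minus one truncated
  branch; full branches have convex action in \<open>L^2\<close>, a branch truncated at a fixed
  height has concave action, so both tangent inequalities point the same way.

  The square dropped by the calibration is retained for competitors vanishing at \<open>0\<close>:
  it makes the comparison with the escaping soliton strict, and nonexistence rests on this.

  In the variable \<open>r = - \<phi>' / (L \<phi>)\<close> the soliton is a hyperbolic tangent, and
  mass and action are integrals against \<open>(1 - r^2)^b\<close> with
  \<open>b = (4 - p) / (p - 2)\<close>. Thus \<open>p < 6\<close> reads \<open>b > - 1 / 2\<close>,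
  and \<open>p = 4\<close> is \<open>b = 0\<close>, where the weight passes from bounded and
  decreasing in \<open>|r|\<close> to blowing up at \<open>|r| = 1\<close>.\<close>

lemma absolutely_integrable_mult_continuous:
  fixes f g :: "real \<Rightarrow> real"
  assumes "f absolutely_integrable_on {c..d}" "continuous_on {c..d} g"
  shows "(\<lambda>x. f x * g x) absolutely_integrable_on {c..d}"
proof -
  have "(\<lambda>x. g x * f x) absolutely_integrable_on {c..d}"
  proof (rule absolutely_integrable_bounded_measurable_product_real)
    show "g \<in> borel_measurable (lebesgue_on {c..d})"
      using assms(2) by (rule continuous_imp_measurable_on_sets_lebesgue) auto
    show "bounded (g ` {c..d})"
      using assms(2) compact_continuous_image compact_imp_bounded by blast
  qed (use assms in auto)
  then show ?thesis by (simp add: mult.commute)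
qed

text \<open>On bounded intervals the pointwise bound \<open>|u| \<le> 1 + u^2\<close> is enough;
  including the endpoint \<open>0\<close> changes only a null set.\<close>

lemma L2_halfline_absolutely_integrable:
  assumes "u \<in> L2_halfline" "0 \<le> a"
  shows "u absolutely_integrable_on {a..b}"
proof -
  let ?S = "{0<..} \<inter> {a..b}"
  have m: "u \<in> borel_measurable (lebesgue_on ?S)"
    by (rule measurable_restrict_mono[of u lebesgue "{0<..}"]) (use assms in \<open>simp_all add: L2_halfline_def\<close>)
  have "(\<lambda>x. (u x)\<^sup>2) absolutely_integrable_on {0<..}"
    using assms by (simp add: L2_halfline_def set_integrable_def integrable_restrict_space)
  then have sq: "(\<lambda>x. (u x)\<^sup>2) absolutely_integrable_on ?S"
    by (rule set_integrable_subset) auto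
  have c: "(\<lambda>x. 1::real) absolutely_integrable_on ?S"
    by (rule set_integrable_subset[of _ "{a..b}"]) (auto intro: absolutely_integrable_continuous_real)
  have i: "(\<lambda>x. 1 + (u x)\<^sup>2) integrable_on ?S"
    by (intro integrable_add set_lebesgue_integral_eq_integral(1) sq c)
  have "u absolutely_integrable_on ?S"
  proof (rule measurable_bounded_by_integrable_imp_absolutely_integrable[OF m _ i])
    fix x
    have "\<bar>u x\<bar> \<le> 1 + (u x)\<^sup>2"
      using zero_le_power2[of "\<bar>u x\<bar> - 1 / 2"] by (simp add: power2_diff power_divide)
    then show "norm (u x) \<le> 1 + (u x)\<^sup>2" by simp
  qed auto
  then show ?thesis
    by (rule absolutely_integrable_spike_set) (use assms in \<open>auto intro!: negligible_subset[OF negligible_sing[of 0]]\<close>)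
qed

lemma LINT_halfline_compact_support:
  fixes f :: "real \<Rightarrow> real"
  assumes "0 < c" "f absolutely_integrable_on {c..d}" "\<And>x. x \<notin> {c..d} \<Longrightarrow> f x = 0"
  shows "(LINT x|halfline. f x) = integral {c..d} f"
proof -
  have "(LINT x|halfline. f x) = (LINT x|halfline. (if x \<in> {c..d} then f x else 0))"
    by (intro Bochner_Integration.integral_cong) (use assms in auto)
  also have "\<dots> = (LINT x|lebesgue_on {c..d}. f x)"
    by (rule Lebesgue_Measure.integral_restrict) (use assms in auto)
  also have "\<dots> = integral {c..d} f"
    using assms by (intro lebesgue_integral_eq_integral absolutely_integrable_imp_integrable) auto
  finally show ?thesis .
qed

lemma derivative_eq_0_outside:
  fixes f :: "real \<Rightarrow> real"
  assumes out: "\<And>z. z \<notin> {c..d} \<Longrightarrow> f z = 0"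
    and der: "(f has_real_derivative D) (at z)" and z: "z \<notin> {c..d}"
  shows "D = 0"
proof -
  have "eventually (\<lambda>y. y \<in> - {c..d}) (nhds z)"
    using z by (intro eventually_nhds_in_open) auto
  then have "eventually (\<lambda>y. f y = 0) (nhds z)"
    by eventually_elim (use out in auto)
  then have "((\<lambda>_. 0::real) has_real_derivative D) (at z)"
    using der DERIV_cong_ev[of z z f "\<lambda>_. 0" D D] by auto
  then show ?thesis
    using DERIV_unique[of "\<lambda>_. 0" D z 0] by simp
qed

text \<open>Moves the defining identity from the half-line to a compact interval, where gauge
  integrals and dominated convergence are at hand.\<close>

lemma weak_derivative_test:
  assumes "has_weak_derivative u v" "u \<in> L2_halfline" "v \<in> L2_halfline" "0 < c"
    and \<psi>: "continuous_on UNIV \<psi>"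
    and der: "\<And>z. (\<phi> has_real_derivative \<psi> z) (at z)"
    and out: "\<And>z. z \<notin> {c..d} \<Longrightarrow> \<phi> z = 0"
  shows "integral {c..d} (\<lambda>z. u z * \<psi> z) = - integral {c..d} (\<lambda>z. v z * \<phi> z)"
proof -
  have out': "\<psi> z = 0" if "z \<notin> {c..d}" for z
    by (rule derivative_eq_0_outside[OF out der that])
  have cl: "closure {x. \<phi> x \<noteq> 0} \<subseteq> {c..d}"
    by (rule closure_minimal) (use out in blast)+
  have "\<phi> \<in> test_functions"
    unfolding test_functions_def
  proof (intro CollectI conjI)
    show "\<phi> C1_differentiable_on UNIV"
      unfolding C1_differentiable_on_def
      by (rule exI[of _ \<psi>]) (use der \<psi> in \<open>auto simp: has_real_derivative_iff_has_vector_derivative\<close>)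
    show "compact (closure {x. \<phi> x \<noteq> 0})"
      using cl by (metis closed_closure compact_Icc compact_Int_closed inf.absorb_iff2)
  qed (use cl \<open>0 < c\<close> in auto)
  then have "(LINT x|halfline. u x * \<psi> x) = - (LINT x|halfline. v x * \<phi> x)"
    using assms(1) DERIV_imp_deriv[OF der] by (auto simp: has_weak_derivative_def)
  moreover have "(LINT x|halfline. u x * \<psi> x) = integral {c..d} (\<lambda>z. u z * \<psi> z)"
    using assms out' by (intro LINT_halfline_compact_support absolutely_integrable_mult_continuous
        L2_halfline_absolutely_integrable) (auto intro: continuous_on_subset)
  moreover have "continuous_on UNIV \<phi>"
    using der DERIV_continuous_on by blast
  then have "(LINT x|halfline. v x * \<phi> x) = integral {c..d} (\<lambda>z. v z * \<phi> z)"
    using assms out by (intro LINT_halfline_compact_support absolutely_integrable_mult_continuous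
        L2_halfline_absolutely_integrable) (auto intro: continuous_on_subset)
  ultimately show ?thesis by simp
qed

text \<open>A ramp of slope 1 on \<open>[0, h]\<close>. The difference of two shifted ramps is a
  trapezoid whose derivative is a difference of two indicators.\<close>

definition clamp_to :: "real \<Rightarrow> real \<Rightarrow> real" where
  "clamp_to h z = max 0 (min h z)"

text \<open>The corners of the ramp are removed by taking antiderivatives of continuous functions
  that tend to the indicator of \<open>(0, h)\<close>. The uniform bounds serve as dominating
  functions.\<close>

lemma smooth_clamp_approximation:
  assumes "0 < h"
  obtains A \<tau> :: "nat \<Rightarrow> real \<Rightarrow> real" where
    "\<And>k. continuous_on UNIV (\<tau> k)" "\<And>k z. (A k has_real_derivative \<tau> k z) (at z)"
    "\<And>k z. 0 \<le> \<tau> k z \<and> \<tau> k z \<le> 1" "\<And>z. (\<lambda>k. \<tau> k z) \<longlonglongrightarrow> indicator {0<..<h} z"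
    "\<And>k z. z \<le> 0 \<Longrightarrow> A k z = 0" "\<And>k z. h \<le> z \<Longrightarrow> A k z = A k h"
    "\<And>k z. 0 \<le> A k z \<and> A k z \<le> h" "\<And>z. (\<lambda>k. A k z) \<longlonglongrightarrow> clamp_to h z"
proof -
  \<comment> \<open>Slope \<open>k\<close> inwards from both ends of \<open>[0, h]\<close>, capped
    at 1. Vanishing exactly outside keeps \<open>A k\<close> constant there, so the supports do not
    spread.\<close>
  define \<tau> where "\<tau> = (\<lambda>k z. max 0 (min 1 (real k * min z (h - z))))"
  have cont: "continuous_on S (\<tau> k)" for k S
    unfolding \<tau>_def by (intro continuous_intros)
  have "\<exists>F. \<forall>z. (F has_real_derivative \<tau> k z) (at z)" for k
    using einterval_antiderivative[of "-\<infinity>" "\<infinity>" "\<tau> k"] cont[of UNIV k]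
    by (auto simp: has_real_derivative_iff_has_vector_derivative continuous_on_eq_continuous_at)
  then obtain F where F: "\<And>k z. (F k has_real_derivative \<tau> k z) (at z)"
    by metis
  define A where "A = (\<lambda>k z. F k z - F k 0)"
  have A: "(A k has_real_derivative \<tau> k z) (at z)" for k z
    unfolding A_def by (auto intro!: derivative_eq_intros F)
  have bd: "0 \<le> \<tau> k z \<and> \<tau> k z \<le> 1" for k z
    by (auto simp: \<tau>_def)
  have off: "\<tau> k z = 0" if "min z (h - z) \<le> 0" for k z
  proof -
    have "real k * min z (h - z) \<le> 0"
      using that by (intro mult_nonneg_nonpos) auto
    then show ?thesis unfolding \<tau>_def by linarith
  qed
  have lim: "(\<lambda>k. \<tau> k z) \<longlonglongrightarrow> indicator {0<..<h} z" for z
  proof (cases "z \<in> {0<..<h}")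
    case True
    define m where "m = min z (h - z)"
    have m: "m > 0" using True by (auto simp: m_def)
    obtain K :: nat where K: "1 / m < real K" using reals_Archimedean2 by blast
    have "eventually (\<lambda>k. \<tau> k z = 1) sequentially"
    proof (rule eventually_sequentiallyI[of K])
      fix k assume "K \<le> k"
      then have "1 / m \<le> real k" using K by linarith
      then have "1 \<le> real k * m" using m by (simp add: field_simps)
      then show "\<tau> k z = 1" by (simp add: \<tau>_def m_def)
    qed
    then show ?thesis using True by (simp add: tendsto_eventually)
  next
    case False
    then have "min z (h - z) \<le> 0" by auto
    then have "\<tau> k z = 0" for k
      using off by auto
    then show ?thesis using False by simp
  qed
  have FTC: "(\<tau> k has_integral (A k b - A k a)) {a..b}" if "a \<le> b" for a b k
    using that A by (intro fundamental_theorem_of_calculus)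
      (auto simp: has_real_derivative_iff_has_vector_derivative[symmetric] intro: has_field_derivative_at_within)
  have A0: "A k 0 = 0" for k by (simp add: A_def)
  have neg: "A k z = 0" if "z \<le> 0" for k z
  proof -
    have "(\<tau> k has_integral 0) {z..0}"
      by (rule has_integral_is_0) (use \<open>0 < h\<close> in \<open>auto intro!: off\<close>)
    then show ?thesis using has_integral_unique[OF FTC[OF that, of k]] A0[of k] by force
  qed
  have big: "A k z = A k h" if "h \<le> z" for k z
  proof -
    have "(\<tau> k has_integral 0) {h..z}"
      by (rule has_integral_is_0) (use \<open>0 < h\<close> in \<open>auto intro!: off\<close>)
    then show ?thesis using has_integral_unique[OF FTC[OF that, of k]] by force
  qed
  have mid: "0 \<le> A k z \<and> A k z \<le> z" if "0 \<le> z" for k z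
  proof -
    have "(\<tau> k has_integral A k z) {0..z}" using FTC[OF that, of k] A0 by simp
    moreover have "((\<lambda>_. 1::real) has_integral z) {0..z}"
      using has_integral_const_real[of "1::real" 0 z] that by simp
    ultimately show ?thesis
      using has_integral_nonneg[of "\<tau> k"] has_integral_le[of "\<tau> k" _ "{0..z}" "\<lambda>_. 1"] bd by blast
  qed
  have rng: "0 \<le> A k z \<and> A k z \<le> h" for k z
    using neg[of z k] big[of z k] mid[of z k] mid[of h k] \<open>0 < h\<close>
    by (cases "z \<le> 0"; cases "h \<le> z") auto
  have limmid: "(\<lambda>k. A k z) \<longlonglongrightarrow> z" if "0 \<le> z" "z \<le> h" for z
  proof -
    have "(\<lambda>k. integral {0..z} (\<tau> k)) \<longlonglongrightarrow> integral {0..z} (indicator {0<..<h})"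
      by (rule dominated_convergence(2)[where h="\<lambda>_. 1"])
        (use bd lim in \<open>auto intro!: integrable_continuous_real cont\<close>)
    moreover have "integral {0..z} (\<tau> k) = A k z" for k
      using FTC[of 0 z k] that A0[of k] by (simp add: integral_unique)
    moreover have "integral {0..z} (indicator {0<..<h}) = z"
    proof -
      have "((\<lambda>_. 1::real) has_integral z) {0..z}"
        using has_integral_const_real[of "1::real" 0 z] that by simp
      then have "(indicator {0<..<h} has_integral z) {0..z}"
        by (rule has_integral_spike[of "{0,h}", rotated -1]) (use that in \<open>auto simp: indicator_def\<close>)
      then show ?thesis by (rule integral_unique)
    qed
    ultimately show ?thesis by simp
  qed
  have limA: "(\<lambda>k. A k z) \<longlonglongrightarrow> clamp_to h z" for z
  proof -
    consider "z \<le> 0" | "0 \<le> z" "z \<le> h" | "h \<le> z" by linarith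
    then show ?thesis
    proof cases
      case 1 then show ?thesis using neg by (simp add: clamp_to_def)
    next
      case 2 then show ?thesis using limmid by (simp add: clamp_to_def)
    next
      case 3 then show ?thesis using big[OF 3] limmid[of h] \<open>0 < h\<close> by (simp add: clamp_to_def)
    qed
  qed
  show thesis
    by (rule that[OF cont A bd lim neg big rng limA])
qed

lemma absolutely_integrable_imp_abs_integrable:
  fixes f :: "real \<Rightarrow> real"
  shows "f absolutely_integrable_on S \<Longrightarrow> (\<lambda>x. \<bar>f x\<bar>) integrable_on S"
  by (simp add: absolutely_integrable_on_def)

lemma clamp_to_bounds: "0 < h \<Longrightarrow> 0 \<le> clamp_to h z \<and> clamp_to h z \<le> h"
  by (auto simp: clamp_to_def)

lemma continuous_on_clamp_to: "continuous_on S (\<lambda>z. clamp_to h (z - x))"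
  unfolding clamp_to_def by (intro continuous_intros)

lemma integral_indicator_box_mult:
  fixes u :: "real \<Rightarrow> real"
  assumes "u absolutely_integrable_on {c..d}" "c \<le> x" "y \<le> d"
  shows "integral {c..d} (\<lambda>z. u z * indicator {x<..<y} z) = integral {x..y} u"
    "(\<lambda>z. u z * indicator {x<..<y} z) absolutely_integrable_on {c..d}"
proof -
  have eq: "(\<lambda>z. u z * indicator {x<..<y} z) = (\<lambda>z. if z \<in> {x<..<y} then u z else 0)"
    by (auto simp: indicator_def fun_eq_iff)
  have "integral {c..d} (\<lambda>z. if z \<in> {x<..<y} then u z else 0) = integral ({x<..<y} \<inter> {c..d}) u"
    by (rule Henstock_Kurzweil_Integration.integral_restrict_Int)
  also have "{x<..<y} \<inter> {c..d} = {x<..<y}" using assms by auto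
  finally show "integral {c..d} (\<lambda>z. u z * indicator {x<..<y} z) = integral {x..y} u"
    unfolding eq using integral_open_interval_real by metis
  have "u absolutely_integrable_on {x<..<y}"
    by (rule set_integrable_subset[OF assms(1)]) (use assms in auto)
  then have "(\<lambda>z. if z \<in> {x<..<y} then u z else 0) absolutely_integrable_on UNIV"
    using absolutely_integrable_restrict_UNIV by blast
  then show "(\<lambda>z. u z * indicator {x<..<y} z) absolutely_integrable_on {c..d}"
    unfolding eq by (rule set_integrable_subset) auto
qed

text \<open>Trapezoids are not of class $C^1$; they are reached from admissible test functions by dominated
  convergence.\<close>

lemma weak_derivative_trapezoid:
  assumes w: "has_weak_derivative u v" and L2: "u \<in> L2_halfline" "v \<in> L2_halfline"
    and "0 < x" "x \<le> y" "0 < h" "y + h \<le> d"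
  shows "integral {x..x + h} u - integral {y..y + h} u
    = - integral {x..d} (\<lambda>z. v z * (clamp_to h (z - x) - clamp_to h (z - y)))"
proof -
  obtain A \<tau> :: "nat \<Rightarrow> real \<Rightarrow> real" where
    cont: "\<And>k. continuous_on UNIV (\<tau> k)" and A: "\<And>k z. (A k has_real_derivative \<tau> k z) (at z)"
    and bd: "\<And>k z. 0 \<le> \<tau> k z \<and> \<tau> k z \<le> 1"
    and lim: "\<And>z. (\<lambda>k. \<tau> k z) \<longlonglongrightarrow> indicator {0<..<h} z"
    and neg: "\<And>k z. z \<le> 0 \<Longrightarrow> A k z = 0" and big: "\<And>k z. h \<le> z \<Longrightarrow> A k z = A k h"
    and rng: "\<And>k z. 0 \<le> A k z \<and> A k z \<le> h" and limA: "\<And>z. (\<lambda>k. A k z) \<longlonglongrightarrow> clamp_to h z"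
    by (rule smooth_clamp_approximation[OF \<open>0 < h\<close>]) (rule that)
  have ui: "u absolutely_integrable_on {x..d}" and vi: "v absolutely_integrable_on {x..d}"
    using L2 \<open>0 < x\<close> by (auto intro!: L2_halfline_absolutely_integrable)
  have id: "integral {x..d} (\<lambda>z. u z * (\<tau> k (z - x) - \<tau> k (z - y)))
      = - integral {x..d} (\<lambda>z. v z * (A k (z - x) - A k (z - y)))" for k
  proof (rule weak_derivative_test[OF w L2 \<open>0 < x\<close>])
    show "continuous_on UNIV (\<lambda>z. \<tau> k (z - x) - \<tau> k (z - y))"
      by (intro continuous_intros continuous_on_compose2[OF cont[of k]]) auto
    show "((\<lambda>z. A k (z - x) - A k (z - y)) has_real_derivative \<tau> k (z - x) - \<tau> k (z - y)) (at z)" for z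
      by (auto intro!: derivative_eq_intros DERIV_chain2[OF A])
    show "A k (z - x) - A k (z - y) = 0" if "z \<notin> {x..d}" for z
    proof (cases "z < x")
      case True
      then show ?thesis using neg[of "z - x" k] neg[of "z - y" k] \<open>x \<le> y\<close> by simp
    next
      case False
      then show ?thesis using big[of "z - x" k] big[of "z - y" k] that assms by simp
    qed
  qed
  have ctau: "continuous_on S (\<lambda>z. \<tau> k (z - x) - \<tau> k (z - y))" for S k
    by (intro continuous_intros continuous_on_compose2[OF cont[of k]]) auto
  have cA: "continuous_on S (\<lambda>z. A k (z - x) - A k (z - y))" for S k
  proof -
    have "continuous_on UNIV (A k)" using A DERIV_continuous_on by blast
    then have "continuous_on S (\<lambda>z. A k (z - t))" for t
      by (rule continuous_on_compose2) (auto intro!: continuous_intros)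
    then show ?thesis by (intro continuous_on_diff)
  qed
  have L: "(\<lambda>k. integral {x..d} (\<lambda>z. u z * (\<tau> k (z - x) - \<tau> k (z - y)))) \<longlonglongrightarrow>
      integral {x..d} (\<lambda>z. u z * (indicator {0<..<h} (z - x) - indicator {0<..<h} (z - y)))"
  proof (rule dominated_convergence(2)[where h="\<lambda>z. \<bar>u z\<bar>"])
    show "(\<lambda>z. u z * (\<tau> k (z - x) - \<tau> k (z - y))) integrable_on {x..d}" for k
      using absolutely_integrable_mult_continuous[OF ui ctau] set_lebesgue_integral_eq_integral(1) by blast
    show "(\<lambda>z. \<bar>u z\<bar>) integrable_on {x..d}"
      by (rule absolutely_integrable_imp_abs_integrable[OF ui])
    fix k z
    have "\<bar>\<tau> k (z - x) - \<tau> k (z - y)\<bar> \<le> 1"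
      using bd[of k "z - x"] bd[of k "z - y"] by linarith
    then show "norm (u z * (\<tau> k (z - x) - \<tau> k (z - y))) \<le> \<bar>u z\<bar>"
      by (simp add: abs_mult mult_left_le)
  next
    fix z
    show "(\<lambda>k. u z * (\<tau> k (z - x) - \<tau> k (z - y))) \<longlonglongrightarrow>
        u z * (indicator {0<..<h} (z - x) - indicator {0<..<h} (z - y))"
      by (intro tendsto_intros lim)
  qed
  have ind: "indicator {0<..<h} (z - t) = (indicator {t<..<t + h} z :: real)" for z t
    by (auto simp: indicator_def)
  have Lval: "integral {x..d} (\<lambda>z. u z * (indicator {0<..<h} (z - x) - indicator {0<..<h} (z - y)))
      = integral {x..x + h} u - integral {y..y + h} u"
  proof -
    have *: "x \<le> x" "x + h \<le> d" "x \<le> y" "y + h \<le> d" using assms by auto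
    show ?thesis
      unfolding ind right_diff_distrib integral_indicator_box_mult(1)[OF ui *(1,2), symmetric]
        integral_indicator_box_mult(1)[OF ui *(3,4), symmetric]
      by (intro Henstock_Kurzweil_Integration.integral_diff set_lebesgue_integral_eq_integral(1)
          integral_indicator_box_mult(2)[OF ui] *)
  qed
  have R: "(\<lambda>k. integral {x..d} (\<lambda>z. v z * (A k (z - x) - A k (z - y)))) \<longlonglongrightarrow>
      integral {x..d} (\<lambda>z. v z * (clamp_to h (z - x) - clamp_to h (z - y)))"
  proof (rule dominated_convergence(2)[where h="\<lambda>z. h * \<bar>v z\<bar>"])
    show "(\<lambda>z. v z * (A k (z - x) - A k (z - y))) integrable_on {x..d}" for k
      using absolutely_integrable_mult_continuous[OF vi cA] set_lebesgue_integral_eq_integral(1) by blast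
    show "(\<lambda>z. h * \<bar>v z\<bar>) integrable_on {x..d}"
      by (rule integrable_on_mult_right[OF absolutely_integrable_imp_abs_integrable[OF vi]])
    fix k z
    have "\<bar>A k (z - x) - A k (z - y)\<bar> \<le> h"
      using rng[of k "z - x"] rng[of k "z - y"] by linarith
    then show "norm (v z * (A k (z - x) - A k (z - y))) \<le> h * \<bar>v z\<bar>"
      unfolding real_norm_def abs_mult mult.commute[of "\<bar>v z\<bar>"] by (rule mult_right_mono) auto
  next
    fix z
    show "(\<lambda>k. v z * (A k (z - x) - A k (z - y))) \<longlonglongrightarrow>
        v z * (clamp_to h (z - x) - clamp_to h (z - y))"
      by (intro tendsto_intros limA)
  qed
  show ?thesis
    using LIMSEQ_unique[OF L[unfolded id Lval] tendsto_minus[OF R]] by simp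
qed

section \<open>From averages to pointwise increments\<close>

lemma AE_halfline_iff:
  "(AE x in halfline. P x) \<longleftrightarrow> (\<exists>N. negligible N \<and> (\<forall>x>0. x \<notin> N \<longrightarrow> P x))"
proof -
  have "(AE x in halfline. P x) \<longleftrightarrow> (AE x in lebesgue. x \<in> {0<..} \<longrightarrow> P x)"
    by (subst AE_restrict_space_iff) auto
  also have "\<dots> \<longleftrightarrow> (\<exists>N. negligible N \<and> (\<forall>x>0. x \<notin> N \<longrightarrow> P x))"
    unfolding eventually_ae_filter negligible_iff_null_sets by auto
  finally show ?thesis .
qed

lemma average_tendsto_ae:
  fixes f :: "real \<Rightarrow> real"
  assumes "\<And>a b. 0 \<le> a \<Longrightarrow> f integrable_on {a..b}"
  shows "AE x in halfline. (\<lambda>k. real (Suc k) * integral {x..x + 1 / real (Suc k)} f) \<longlonglongrightarrow> f x"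
proof -
  \<comment> \<open>The differentiation theorem wants integrability on every box, whereas
    \<open>f\<close> is controlled only to the right of \<open>0\<close>.\<close>
  define g where "g = (\<lambda>x. if x \<in> {0..} then f x else 0)"
  have gi: "g integrable_on cbox a b" for a b
  proof -
    have "f integrable_on ({0..} \<inter> {a..b})"
    proof (rule integrable_eq)
      have "{0..} \<inter> {a..b} = {max 0 a..b}" by auto
      then show "f integrable_on ({0..} \<inter> {a..b})" using assms by simp
    qed auto
    then show ?thesis
      unfolding g_def box_real using integrable_restrict_Int by blast
  qed
  obtain N where N: "negligible N" "\<And>x e. x \<notin> N \<Longrightarrow> 0 < e \<Longrightarrow> \<exists>d>0. \<forall>h. 0 < h \<and> h < d \<longrightarrow>
      norm (integral (cbox x (x + h *\<^sub>R One)) g /\<^sub>R h ^ DIM(real) - g x) < e"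
    by (rule integrable_ccontinuous_explicit[OF gi, rule_format]) (rule that)
  have main: "(\<lambda>k. real (Suc k) * integral {x..x + 1 / real (Suc k)} f) \<longlonglongrightarrow> f x" if x: "0 < x" "x \<notin> N" for x
  proof (rule LIMSEQ_I)
    fix r :: real assume "0 < r"
    then obtain d where d: "d > 0" "\<And>h. 0 < h \<Longrightarrow> h < d \<Longrightarrow>
        norm (integral (cbox x (x + h *\<^sub>R One)) g /\<^sub>R h ^ DIM(real) - g x) < r"
      using N(2)[OF x(2)] by blast
    obtain K where K: "inverse (real (Suc K)) < d" using reals_Archimedean[OF d(1)] by blast
    show "\<exists>no. \<forall>k\<ge>no. norm (real (Suc k) * integral {x..x + 1 / real (Suc k)} f - f x) < r"
    proof (intro exI allI impI)
      fix k assume "K \<le> k"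
      define h where "h = 1 / real (Suc k)"
      have "h \<le> inverse (real (Suc K))"
        unfolding h_def using \<open>K \<le> k\<close> by (simp add: field_simps)
      then have h: "0 < h" "h < d" using K by (auto simp: h_def)
      have "integral {x..x + h} g = integral {x..x + h} f"
        by (rule Henstock_Kurzweil_Integration.integral_cong) (use x in \<open>auto simp: g_def\<close>)
      moreover have "g x = f x" using x by (simp add: g_def)
      moreover have "inverse h = real (Suc k)" by (simp add: h_def)
      ultimately show "norm (real (Suc k) * integral {x..x + 1 / real (Suc k)} f - f x) < r"
        using d(2)[OF h] unfolding h_def[symmetric] by simp
    qed
  qed
  then show ?thesis
    unfolding AE_halfline_iff using N(1) by blast
qed

text \<open>Divided by the ramp width, the trapezoid has height at most 1 and tends to the indicator
  of \<open>(x, y]\<close>. The extra unit beyond \<open>y\<close> leaves room for the descending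
  ramp.\<close>

lemma trapezoid_integral_tendsto:
  fixes v :: "real \<Rightarrow> real"
  assumes v: "v absolutely_integrable_on {x..y + 1}" and "x \<le> y"
  shows "(\<lambda>k. real (Suc k) * integral {x..y + 1} (\<lambda>z. v z *
            (clamp_to (1 / real (Suc k)) (z - x) - clamp_to (1 / real (Suc k)) (z - y))))
          \<longlonglongrightarrow> integral {x..y} v"
proof -
  define T where "T = (\<lambda>k z. real (Suc k) * (clamp_to (1 / real (Suc k)) (z - x) - clamp_to (1 / real (Suc k)) (z - y)))"
  have cT: "continuous_on S (T k)" for S k
    unfolding T_def by (intro continuous_intros continuous_on_clamp_to)
  have lim1: "(\<lambda>k. real (Suc k) * clamp_to (1 / real (Suc k)) z) \<longlonglongrightarrow> indicator {0<..} z" for z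
  proof (cases "z > 0")
    case True
    then obtain K where K: "inverse (real (Suc K)) < z" using reals_Archimedean by blast
    have "eventually (\<lambda>k. real (Suc k) * clamp_to (1 / real (Suc k)) z = 1) sequentially"
    proof (rule eventually_sequentiallyI[of K])
      fix k assume "K \<le> k"
      then have "1 / real (Suc k) \<le> inverse (real (Suc K))" by (simp add: field_simps)
      then have "1 / real (Suc k) \<le> z" using K by linarith
      then show "real (Suc k) * clamp_to (1 / real (Suc k)) z = 1"
        by (simp add: clamp_to_def)
    qed
    then show ?thesis using True by (simp add: tendsto_eventually)
  next
    case False then show ?thesis by (simp add: clamp_to_def)
  qed
  have limT: "(\<lambda>k. T k z) \<longlonglongrightarrow> indicator {0<..} (z - x) - indicator {0<..} (z - y)" for z
    unfolding T_def right_diff_distrib by (intro tendsto_intros lim1)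
  have L: "(\<lambda>k. integral {x..y + 1} (\<lambda>z. v z * T k z)) \<longlonglongrightarrow>
      integral {x..y + 1} (\<lambda>z. v z * (indicator {0<..} (z - x) - indicator {0<..} (z - y)))"
  proof (rule dominated_convergence(2)[where h="\<lambda>z. \<bar>v z\<bar>"])
    show "(\<lambda>z. v z * T k z) integrable_on {x..y + 1}" for k
      using absolutely_integrable_mult_continuous[OF v cT] set_lebesgue_integral_eq_integral(1) by blast
    show "(\<lambda>z. \<bar>v z\<bar>) integrable_on {x..y + 1}"
      by (rule absolutely_integrable_imp_abs_integrable[OF v])
    fix k z
    have "\<bar>clamp_to (1 / real (Suc k)) (z - x) - clamp_to (1 / real (Suc k)) (z - y)\<bar> \<le> 1 / real (Suc k)"
      using clamp_to_bounds[of "1 / real (Suc k)" "z - x"] clamp_to_bounds[of "1 / real (Suc k)" "z - y"]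
      by auto
    then have "\<bar>T k z\<bar> \<le> real (Suc k) * (1 / real (Suc k))"
      unfolding T_def abs_mult by (intro mult_mono) auto
    then have "\<bar>T k z\<bar> \<le> 1" by simp
    then show "norm (v z * T k z) \<le> \<bar>v z\<bar>"
      by (simp add: abs_mult mult_left_le)
  qed (intro tendsto_intros limT)
  have "integral {x..y + 1} (\<lambda>z. v z * (indicator {0<..} (z - x) - indicator {0<..} (z - y)))
      = integral {x..y + 1} (\<lambda>z. v z * indicator {x<..<y} z)"
    by (rule integral_spike[of "{y}"]) (use \<open>x \<le> y\<close> in \<open>auto simp: indicator_def\<close>)
  also have "\<dots> = integral {x..y} v"
    by (rule integral_indicator_box_mult[OF v]) auto
  finally have "(\<lambda>k. integral {x..y + 1} (\<lambda>z. v z * T k z)) \<longlonglongrightarrow> integral {x..y} v"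
    using L by simp
  moreover have "integral {x..y + 1} (\<lambda>z. v z * T k z) = real (Suc k) * integral {x..y + 1} (\<lambda>z. v z *
            (clamp_to (1 / real (Suc k)) (z - x) - clamp_to (1 / real (Suc k)) (z - y)))" for k
    unfolding T_def by (subst integral_mult_right[symmetric]) (simp add: mult_ac)
  ultimately show ?thesis by simp
qed

text \<open>A trapezoid with ramps of width \<open>h\<close> compares the averages of
  \<open>u\<close> over \<open>[x, x + h]\<close> and \<open>[y, y + h]\<close>. As \<open>h\<close>
  tends to 0 these become values, except on the null set where averages of \<open>u\<close> fail to
  converge.\<close>

lemma weak_derivative_increment_ae:
  assumes w: "has_weak_derivative u v" and L2: "u \<in> L2_halfline" "v \<in> L2_halfline"
  obtains N where "negligible N"
    "\<And>x y. 0 < x \<Longrightarrow> x \<le> y \<Longrightarrow> x \<notin> N \<Longrightarrow> y \<notin> N \<Longrightarrow> u y - u x = integral {x..y} v"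
proof -
  have ui: "u integrable_on {a..b}" if "0 \<le> a" for a b
    using L2_halfline_absolutely_integrable[OF L2(1) that] set_lebesgue_integral_eq_integral(1) by blast
  obtain N where N: "negligible N"
    "\<forall>x>0. x \<notin> N \<longrightarrow> (\<lambda>k. real (Suc k) * integral {x..x + 1 / real (Suc k)} u) \<longlonglongrightarrow> u x"
    using average_tendsto_ae[OF ui] unfolding AE_halfline_iff by blast
  have main: "u y - u x = integral {x..y} v" if "0 < x" "x \<le> y" "x \<notin> N" "y \<notin> N" for x y
  proof -
    let ?h = "\<lambda>k. 1 / real (Suc k)"
    have eq: "real (Suc k) * integral {x..x + ?h k} u - real (Suc k) * integral {y..y + ?h k} u =
       - (real (Suc k) * integral {x..y + 1} (\<lambda>z. v z * (clamp_to (?h k) (z - x) - clamp_to (?h k) (z - y))))" for k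
    proof -
      have "0 < ?h k" "y + ?h k \<le> y + 1" by auto
      from weak_derivative_trapezoid[OF w L2 \<open>0 < x\<close> \<open>x \<le> y\<close> this] show ?thesis
        by (simp only: right_diff_distrib[symmetric] mult_minus_right)
    qed
    have "(\<lambda>k. real (Suc k) * integral {x..x + ?h k} u - real (Suc k) * integral {y..y + ?h k} u) \<longlonglongrightarrow> u x - u y"
      using that by (intro tendsto_diff N(2)[rule_format]) auto
    moreover have "(\<lambda>k. - (real (Suc k) * integral {x..y + 1} (\<lambda>z. v z * (clamp_to (?h k) (z - x) - clamp_to (?h k) (z - y)))))
        \<longlonglongrightarrow> - integral {x..y} v"
      using that L2 by (intro tendsto_minus trapezoid_integral_tendsto L2_halfline_absolutely_integrable) auto
    ultimately have "u x - u y = - integral {x..y} v"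
      unfolding eq by (rule LIMSEQ_unique)
    then show ?thesis by simp
  qed
  show thesis
  proof (rule that[OF N(1)])
    fix x y assume "0 < x" "x \<le> y" "x \<notin> N" "y \<notin> N"
    then show "u y - u x = integral {x..y} v"
      by (rule main)
  qed
qed

text \<open>One side of the trapezoid identity contains \<open>u\<close> alone, so it gives the same
  number for every weak derivative.\<close>

lemma weak_derivative_integral_unique:
  assumes "has_weak_derivative u v" "has_weak_derivative u v'"
    and "u \<in> L2_halfline" "v \<in> L2_halfline" "v' \<in> L2_halfline" "0 < x" "x \<le> y"
  shows "integral {x..y} v = integral {x..y} v'"
proof -
  let ?h = "\<lambda>k. 1 / real (Suc k)"
  let ?I = "\<lambda>v k. real (Suc k) * integral {x..y + 1} (\<lambda>z. v z * (clamp_to (?h k) (z - x) - clamp_to (?h k) (z - y)))"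
  have eq: "?I v = ?I v'"
  proof
    fix k
    show "?I v k = ?I v' k"
    proof -
      have "0 < ?h k" "y + ?h k \<le> y + 1" by auto
      then show ?thesis
        using weak_derivative_trapezoid[OF assms(1,3,4,6,7)] weak_derivative_trapezoid[OF assms(2,3,5,6,7)]
        by (simp only: neg_equal_iff_equal)
    qed
  qed
  have "?I v \<longlonglongrightarrow> integral {x..y} v" "?I v' \<longlonglongrightarrow> integral {x..y} v'"
    using assms by (intro trapezoid_integral_tendsto L2_halfline_absolutely_integrable; simp)+
  then show ?thesis unfolding eq by (rule LIMSEQ_unique)
qed

text \<open>Needed since \<open>weak_deriv\<close> is an arbitrary choice: it lets the kinetic
  energy of an explicit function be computed from its classical derivative.\<close>

lemma weak_derivative_unique_ae:
  assumes "has_weak_derivative u v" "has_weak_derivative u v'"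
    and "u \<in> L2_halfline" "v \<in> L2_halfline" "v' \<in> L2_halfline"
  shows "AE x in halfline. v x = v' x"
proof -
  have i: "v integrable_on {a..b}" "v' integrable_on {a..b}" if "0 \<le> a" for a b
    using assms that L2_halfline_absolutely_integrable set_lebesgue_integral_eq_integral(1) by blast+
  have "AE x in halfline. x \<in> {0<..}"
    using AE_space[of halfline] by simp
  moreover have "AE x in halfline. (\<lambda>k. real (Suc k) * integral {x..x + 1 / real (Suc k)} v) \<longlonglongrightarrow> v x"
    by (rule average_tendsto_ae, rule i(1))
  moreover have "AE x in halfline. (\<lambda>k. real (Suc k) * integral {x..x + 1 / real (Suc k)} v') \<longlonglongrightarrow> v' x"
    by (rule average_tendsto_ae, rule i(2))
  ultimately show ?thesis
  proof eventually_elim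
    case (elim x)
    have eq: "integral {x..x + 1 / real (Suc k)} v = integral {x..x + 1 / real (Suc k)} v'" for k
      using assms elim by (intro weak_derivative_integral_unique) auto
    from elim(2) elim(3)[folded eq] show ?case
      by (rule LIMSEQ_unique)
  qed
qed

section \<open>The continuous representative\<close>

lemma weak_deriv_H1:
  assumes "u \<in> H1_halfline"
  shows "u \<in> L2_halfline" "weak_deriv u \<in> L2_halfline" "has_weak_derivative u (weak_deriv u)"
proof -
  show "u \<in> L2_halfline" using assms by (simp add: H1_halfline_def)
  have "\<exists>v. v \<in> L2_halfline \<and> has_weak_derivative u v"
    using assms by (auto simp: H1_halfline_def)
  then have "weak_deriv u \<in> L2_halfline \<and> has_weak_derivative u (weak_deriv u)"
    unfolding weak_deriv_def by (rule someI_ex)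
  then show "weak_deriv u \<in> L2_halfline" "has_weak_derivative u (weak_deriv u)" by auto
qed

text \<open>Otherwise the two functions would differ on some interval \<open>(0, d)\<close>, which
  is not negligible. This makes \<open>value_at_0\<close> well defined.\<close>

lemma AE_halfline_eq_at_0:
  assumes "continuous_on {0..} w" "continuous_on {0..} w'" "AE x in halfline. w x = w' x"
  shows "w (0::real) = (w' 0 :: real)"
proof (rule ccontr)
  assume neq: "w 0 \<noteq> w' 0"
  have "continuous_on {0..} (\<lambda>x. w x - w' x)"
    using assms by (intro continuous_intros)
  then obtain d where d: "d > 0" "\<And>x. x \<in> {0..} \<Longrightarrow> dist x 0 < d \<Longrightarrow> dist (w x - w' x) (w 0 - w' 0) < \<bar>w 0 - w' 0\<bar>"
    using neq unfolding continuous_on_iff by (metis atLeast_iff order_refl zero_less_abs_iff right_minus_eq)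
  obtain N where N: "negligible N" "\<forall>x>0. x \<notin> N \<longrightarrow> w x = w' x"
    using assms(3) unfolding AE_halfline_iff by blast
  have "{0<..<d} \<subseteq> N"
  proof
    fix x assume "x \<in> {0<..<d}"
    then have "w x \<noteq> w' x" "x > 0" using d(2)[of x] by (auto simp: dist_real_def)
    then show "x \<in> N" using N(2) by blast
  qed
  then have "negligible {0<..<d}" using N(1) negligible_subset by blast
  then show False using open_not_negligible[of "{0<..<d}"] d(1) by auto
qed

lemma value_at_0_eqI:
  assumes "continuous_on {0..} w" "AE x in halfline. w x = u x"
  shows "value_at_0 u = w 0"
  unfolding value_at_0_def
proof (rule the_equality)
  show "\<exists>w'. continuous_on {0..} w' \<and> (AE x in halfline. w' x = u x) \<and> w' 0 = w 0"
    using assms by auto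
  fix c assume "\<exists>w'. continuous_on {0..} w' \<and> (AE x in halfline. w' x = u x) \<and> w' 0 = c"
  then obtain w' where w': "continuous_on {0..} w'" "AE x in halfline. w' x = u x" "w' 0 = c"
    by auto
  have "AE x in halfline. w' x = w x"
    using w'(2) assms(2) by eventually_elim simp
  then show "c = w 0" using AE_halfline_eq_at_0 assms(1) w' by blast
qed

lemma continuous_on_atLeastI:
  fixes f :: "real \<Rightarrow> real"
  assumes "\<And>b. continuous_on {a..b} f"
  shows "continuous_on {a..} f"
  unfolding continuous_on_eq_continuous_within
proof
  fix x assume x: "x \<in> {a..}"
  have "at x within {a..} = at x within {a..x + 1}"
    by (rule at_within_nhd[of _ "{..<x + 1}"]) auto
  then show "continuous (at x within {a..}) f"
    using assms[of "x + 1"] x unfolding continuous_on_eq_continuous_within by auto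
qed

lemma H1_halfline_representative:
  assumes u: "u \<in> H1_halfline"
  shows "\<exists>w. continuous_on {0..} w \<and> (AE x in halfline. w x = u x) \<and>
    (\<forall>x y. 0 \<le> x \<longrightarrow> x \<le> y \<longrightarrow> w y - w x = integral {x..y} (weak_deriv u)) \<and> w 0 = value_at_0 u"
proof -
  let ?v = "weak_deriv u"
  note H = weak_deriv_H1[OF u]
  have vi: "?v integrable_on {a..b}" if "0 \<le> a" for a b
    using L2_halfline_absolutely_integrable[OF H(2) that] set_lebesgue_integral_eq_integral(1) by blast
  obtain N where N: "negligible N" and
    inc: "\<And>x y. 0 < x \<Longrightarrow> x \<le> y \<Longrightarrow> x \<notin> N \<Longrightarrow> y \<notin> N \<Longrightarrow> u y - u x = integral {x..y} ?v"
    by (rule weak_derivative_increment_ae[OF H(3) H(1) H(2)]) (rule that)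
  have "\<not> {0<..} \<subseteq> N"
    using open_not_negligible[of "{0<..}::real set"] N negligible_subset by (metis gt_ex greaterThan_iff empty_iff open_greaterThan)
  then obtain x0 where x0: "x0 > 0" "x0 \<notin> N" by auto
  \<comment> \<open>The indefinite integral of the weak derivative, anchored at a point
    \<open>x0\<close> outside the exceptional set.\<close>
  define w where "w = (\<lambda>y. u x0 + (integral {0..y} ?v - integral {0..x0} ?v))"
  have comb: "integral {0..y} ?v - integral {0..x} ?v = integral {x..y} ?v" if "0 \<le> x" "x \<le> y" for x y
    using Henstock_Kurzweil_Integration.integral_combine[OF that vi[of 0 y]] by simp
  have c: "continuous_on {0..} w"
    unfolding w_def
    by (intro continuous_on_atLeastI continuous_intros indefinite_integral_continuous_1 vi) auto
  have "w y = u y" if "0 < y" "y \<notin> N" for y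
  proof (cases "x0 \<le> y")
    case True
    then show ?thesis using inc[of x0 y] comb[of x0 y] x0 that by (simp add: w_def)
  next
    case False
    then show ?thesis using inc[of y x0] comb[of y x0] x0 that by (simp add: w_def)
  qed
  then have ae: "AE x in halfline. w x = u x"
    unfolding AE_halfline_iff using N by blast
  have "w y - w x = integral {x..y} ?v" if "0 \<le> x" "x \<le> y" for x y
    using comb[OF that] by (simp add: w_def)
  then show ?thesis
    using c ae value_at_0_eqI[OF c ae] by auto
qed

lemma integrable_halfline_iff:
  fixes f :: "real \<Rightarrow> real"
  shows "integrable halfline f \<longleftrightarrow> f absolutely_integrable_on {0<..}"
  by (simp add: set_integrable_def integrable_restrict_space)

text \<open>Mean value theorem. The derivative is requested only in the open interval because the
  profile functions below are differentiated only strictly between \<open>0\<close> and the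
  peak.\<close>

lemma abs_diff_le_of_derivative_bound:
  fixes \<Phi> :: "real \<Rightarrow> real"
  assumes c: "continuous_on {0..M} \<Phi>" and d: "\<And>t. 0 < t \<Longrightarrow> t < M \<Longrightarrow> (\<Phi> has_real_derivative g t) (at t)"
    and st: "s \<in> {0..M}" "t \<in> {0..M}"
    and C: "\<And>r. min s t < r \<Longrightarrow> r < max s t \<Longrightarrow> \<bar>g r\<bar> \<le> C"
  shows "\<bar>\<Phi> t - \<Phi> s\<bar> \<le> C * \<bar>t - s\<bar>"
proof (cases "s = t")
  case False
  have *: "\<bar>\<Phi> b - \<Phi> a\<bar> \<le> C * (b - a)" if ab: "a < b" "0 \<le> a" "b \<le> M" and C: "\<And>r. a < r \<Longrightarrow> r < b \<Longrightarrow> \<bar>g r\<bar> \<le> C" for a b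
  proof -
    have "continuous_on {a..b} \<Phi>" using c by (rule continuous_on_subset) (use ab in auto)
    moreover have "\<Phi> differentiable (at x)" if "a < x" "x < b" for x
      using d[of x] that ab by (auto simp: real_differentiable_def)
    ultimately obtain l z where lz: "a < z" "z < b" "(\<Phi> has_real_derivative l) (at z)" "\<Phi> b - \<Phi> a = (b - a) * l"
      using MVT[OF ab(1)] by blast
    have "l = g z" using DERIV_unique[OF lz(3) d[of z]] lz ab by auto
    then show ?thesis using lz C[of z] ab by (simp add: abs_mult mult.commute mult_right_mono)
  qed
  show ?thesis
    using *[of s t] *[of t s] False st C by (cases "s < t") (auto simp: abs_minus_commute)
qed simp

text \<open>A chain rule for \<open>\<Phi> \<circ> f\<close> when \<open>f\<close> is only absolutely continuous: the inequality with an error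
  \<open>\<epsilon>\<close> is additive over adjacent intervals and holds locally by the mean value theorem.\<close>

lemma chain_inequality:
  fixes \<Phi> g f V :: "real \<Rightarrow> real"
  assumes xy: "x \<le> y"
    and \<Phi>: "continuous_on {0..M} \<Phi>" "\<And>t. 0 < t \<Longrightarrow> t < M \<Longrightarrow> (\<Phi> has_real_derivative g t) (at t)"
    and g: "continuous_on {0..M} g" "\<And>t. t \<in> {0..M} \<Longrightarrow> 0 \<le> g t"
    and f: "continuous_on {x..y} f" "\<And>z. z \<in> {x..y} \<Longrightarrow> f z \<in> {0..M}"
    and V: "V absolutely_integrable_on {x..y}" "\<And>z. 0 \<le> V z"
    and inc: "\<And>a b. x \<le> a \<Longrightarrow> a \<le> b \<Longrightarrow> b \<le> y \<Longrightarrow> \<bar>f b - f a\<bar> \<le> integral {a..b} V"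
  shows "\<bar>\<Phi> (f y) - \<Phi> (f x)\<bar> \<le> integral {x..y} (\<lambda>z. V z * g (f z))"
proof (rule field_le_epsilon)
  fix \<epsilon> :: real assume "\<epsilon> > 0"
  define I where "I = integral {x..y} V"
  have Vi: "V integrable_on {a..b}" if "x \<le> a" "b \<le> y" for a b
    using absolutely_integrable_on_subinterval[OF V(1), of a b] that set_lebesgue_integral_eq_integral(1) by auto
  have I0: "I \<ge> 0" unfolding I_def using V Vi by (intro integral_nonneg) auto
  \<comment> \<open>The total error will be \<open>e * I\<close>, at most \<open>\<epsilon>\<close>;
    the \<open>+ 1\<close> covers \<open>I = 0\<close>.\<close>
  define e where "e = \<epsilon> / (I + 1)"
  have e: "e > 0" unfolding e_def using \<open>\<epsilon> > 0\<close> I0 by auto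
  have gf: "continuous_on {x..y} (\<lambda>z. g (f z))"
    by (rule continuous_on_compose2[OF g(1) f(1)]) (use f(2) in auto)
  have abs: "(\<lambda>z. V z * (g (f z) + e)) absolutely_integrable_on {x..y}"
    by (intro absolutely_integrable_mult_continuous V continuous_intros gf)
  have int: "(\<lambda>z. V z * (g (f z) + e)) integrable_on {a..b}" if "x \<le> a" "b \<le> y" for a b
    using absolutely_integrable_on_subinterval[OF abs, of a b] that set_lebesgue_integral_eq_integral(1) by auto
  define P where "P = (\<lambda>a b. x \<le> a \<longrightarrow> a \<le> b \<longrightarrow> b \<le> y \<longrightarrow>
      \<bar>\<Phi> (f b) - \<Phi> (f a)\<bar> \<le> integral {a..b} (\<lambda>z. V z * (g (f z) + e)))"
  have "P x y"
  proof (rule Bolzano[OF xy])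
    fix a b c assume P: "P a b" "P b c" and abc: "a \<le> b" "b \<le> c"
    show "P a c"
      unfolding P_def
    proof (intro impI)
      assume "x \<le> a" "a \<le> c" "c \<le> y"
      then show "\<bar>\<Phi> (f c) - \<Phi> (f a)\<bar> \<le> integral {a..c} (\<lambda>z. V z * (g (f z) + e))"
        using P abc Henstock_Kurzweil_Integration.integral_combine[OF abc int[of a c]]
        unfolding P_def by auto
    qed
  next
    fix z assume z: "x \<le> z" "z \<le> y"
    \<comment> \<open>Half of \<open>e\<close> pays for replacing \<open>g\<close> between
      \<open>f a\<close> and \<open>f b\<close> by \<open>g (f z)\<close>, the other half for
      returning from \<open>g (f z)\<close> to \<open>g (f z')\<close>.\<close>
    obtain \<delta> where \<delta>: "\<delta> > 0" "\<And>t. t \<in> {0..M} \<Longrightarrow> dist t (f z) < \<delta> \<Longrightarrow> dist (g t) (g (f z)) < e / 2"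
      using g(1) f(2)[of z] z e unfolding continuous_on_iff by (metis atLeastAtMost_iff half_gt_zero)
    obtain d where d: "d > 0" "\<And>z'. z' \<in> {x..y} \<Longrightarrow> dist z' z < d \<Longrightarrow> dist (f z') (f z) < \<delta>"
      using f(1) z \<delta>(1) unfolding continuous_on_iff by (metis atLeastAtMost_iff)
    show "\<exists>d>0. \<forall>a b. a \<le> z \<and> z \<le> b \<and> b - a < d \<longrightarrow> P a b"
    proof (intro exI[of _ d] conjI allI impI)
      fix a b assume ab: "a \<le> z \<and> z \<le> b \<and> b - a < d"
      show "P a b"
        unfolding P_def
      proof (intro impI)
        assume xa: "x \<le> a" "a \<le> b" "b \<le> y"
        have near: "\<bar>f z' - f z\<bar> < \<delta>" if "z' \<in> {a..b}" for z'
          using d(2)[of z'] that ab xa by (auto simp: dist_real_def)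
        have gnear: "\<bar>g t - g (f z)\<bar> < e / 2" if "t \<in> {0..M}" "\<bar>t - f z\<bar> < \<delta>" for t
          using \<delta>(2)[of t] that by (auto simp: dist_real_def)
        have fa: "f a \<in> {0..M}" "f b \<in> {0..M}" "f z \<in> {0..M}" using f(2) xa ab z by auto
        have "\<bar>\<Phi> (f b) - \<Phi> (f a)\<bar> \<le> (g (f z) + e / 2) * \<bar>f b - f a\<bar>"
        proof (rule abs_diff_le_of_derivative_bound[OF \<Phi>])
          fix r assume r: "min (f a) (f b) < r" "r < max (f a) (f b)"
          then have "r \<in> {0..M}" using fa by auto
          moreover have "\<bar>r - f z\<bar> < \<delta>" using near[of a] near[of b] r xa by auto
          ultimately have "\<bar>g r - g (f z)\<bar> < e / 2" "0 \<le> g r" using gnear g(2) by auto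
          then show "\<bar>g r\<bar> \<le> g (f z) + e / 2" by linarith
        qed (use fa in auto)
        also have "\<dots> \<le> (g (f z) + e / 2) * integral {a..b} V"
          using inc[OF xa] g(2)[of "f z"] fa e by (intro mult_left_mono) auto
        also have "\<dots> = integral {a..b} (\<lambda>z'. (g (f z) + e / 2) * V z')"
          by simp
        also have "\<dots> \<le> integral {a..b} (\<lambda>z'. V z' * (g (f z') + e))"
        proof (rule integral_le)
          show "(\<lambda>z'. (g (f z) + e / 2) * V z') integrable_on {a..b}"
            using Vi xa by (intro integrable_on_mult_right) auto
          show "(\<lambda>z'. V z' * (g (f z') + e)) integrable_on {a..b}" using int xa by auto
          fix z' assume z': "z' \<in> {a..b}"
          have "\<bar>g (f z') - g (f z)\<bar> < e / 2"
            using z' xa by (intro gnear near f(2)) auto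
          then have "g (f z) + e / 2 \<le> g (f z') + e" by linarith
          then show "(g (f z) + e / 2) * V z' \<le> V z' * (g (f z') + e)"
            using V(2)[of z'] by (simp add: mult.commute mult_left_mono)
        qed
        finally show "\<bar>\<Phi> (f b) - \<Phi> (f a)\<bar> \<le> integral {a..b} (\<lambda>z. V z * (g (f z) + e))" .
      qed
    qed (use d in auto)
  qed
  then have "\<bar>\<Phi> (f y) - \<Phi> (f x)\<bar> \<le> integral {x..y} (\<lambda>z. V z * (g (f z) + e))"
    using xy by (simp add: P_def)
  also have "\<dots> = integral {x..y} (\<lambda>z. V z * g (f z)) + e * I"
  proof -
    have "(\<lambda>z. V z * g (f z)) integrable_on {x..y}"
      using absolutely_integrable_mult_continuous[OF V(1) gf] set_lebesgue_integral_eq_integral(1) by blast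
    then show ?thesis
      unfolding I_def distrib_left using Vi[of x y]
      by (subst Henstock_Kurzweil_Integration.integral_add) (auto simp: mult.commute[of _ e] intro: integrable_on_mult_right)
  qed
  also have "e * I \<le> \<epsilon>"
    unfolding e_def using I0 \<open>\<epsilon> > 0\<close> by (simp add: field_simps)
  finally show "\<bar>\<Phi> (f y) - \<Phi> (f x)\<bar> \<le> integral {x..y} (\<lambda>z. V z * g (f z)) + \<epsilon>"
    by simp
qed

lemma halfline_integrable_imp_interval:
  fixes f :: "real \<Rightarrow> real"
  assumes "integrable halfline f" "0 \<le> x"
  shows "f absolutely_integrable_on {x..y}"
proof -
  have "f absolutely_integrable_on {0..}"
    using assms(1) unfolding integrable_halfline_iff
    by (rule absolutely_integrable_spike_set) (auto intro!: negligible_subset[OF negligible_sing[of 0]])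
  then show ?thesis
    by (rule absolutely_integrable_on_subinterval) (use assms in auto)
qed

lemma integral_interval_le_LINT_halfline:
  fixes f :: "real \<Rightarrow> real"
  assumes f: "integrable halfline f" "\<And>x. 0 \<le> f x" and "0 \<le> x"
  shows "integral {x..y} f \<le> (LINT x|halfline. f x)"
proof -
  have i: "f absolutely_integrable_on {0..}"
    using assms(1) unfolding integrable_halfline_iff
    by (rule absolutely_integrable_spike_set) (auto intro!: negligible_subset[OF negligible_sing[of 0]])
  have "integral {x..y} f \<le> integral {0..} f"
    using assms i halfline_integrable_imp_interval[OF f(1) \<open>0 \<le> x\<close>]
    by (intro integral_subset_le set_lebesgue_integral_eq_integral(1)) auto
  also have "\<dots> = integral {0<..} f"
    by (rule integral_spike_set) (auto intro!: negligible_subset[OF negligible_sing[of 0]])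
  also have "\<dots> = (LINT x|halfline. f x)"
    by (rule lebesgue_integral_eq_integral[symmetric]) (use f in auto)
  finally show ?thesis .
qed

section \<open>Decay, maximum and calibration for the continuous representative\<close>

locale H1_representative =
  fixes u w :: "real \<Rightarrow> real"
  assumes u: "u \<in> H1_halfline"
    and w_cont: "continuous_on {0..} w"
    and w_ae: "AE x in halfline. w x = u x"
    and w_inc: "0 \<le> x \<Longrightarrow> x \<le> y \<Longrightarrow> w y - w x = integral {x..y} (weak_deriv u)"
    and w_0: "w 0 = value_at_0 u"

lemma H1_representative_ex: "u \<in> H1_halfline \<Longrightarrow> \<exists>w. H1_representative u w"
  using H1_halfline_representative unfolding H1_representative_def by blast

context H1_representative
begin

abbreviation "v \<equiv> weak_deriv u"

lemma v_measurable [measurable]: "v \<in> borel_measurable halfline"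
  using weak_deriv_H1(2)[OF u] by (simp add: L2_halfline_def)

lemma u_measurable [measurable]: "u \<in> borel_measurable halfline"
  using weak_deriv_H1(1)[OF u] by (simp add: L2_halfline_def)

lemma w_measurable [measurable]: "w \<in> borel_measurable halfline"
  by (rule continuous_imp_measurable_on_sets_lebesgue) (auto intro: continuous_on_subset[OF w_cont])

lemma v2_integrable: "integrable halfline (\<lambda>x. (v x)\<^sup>2)"
  using weak_deriv_H1(2)[OF u] by (simp add: L2_halfline_def)

lemma w2_integrable: "integrable halfline (\<lambda>x. (w x)\<^sup>2)"
proof -
  have "integrable halfline (\<lambda>x. (u x)\<^sup>2)"
    using weak_deriv_H1(1)[OF u] by (simp add: L2_halfline_def)
  moreover have "AE x in halfline. (w x)\<^sup>2 = (u x)\<^sup>2"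
    using w_ae by eventually_elim simp
  ultimately show ?thesis
    by (subst integrable_cong_AE[where g="\<lambda>x. (u x)\<^sup>2"]) auto
qed

lemma abs_w_increment:
  assumes "0 \<le> a" "a \<le> b"
  shows "\<bar>\<bar>w b\<bar> - \<bar>w a\<bar>\<bar> \<le> integral {a..b} (\<lambda>x. \<bar>v x\<bar>)"
proof -
  have i: "v absolutely_integrable_on {a..b}"
    using L2_halfline_absolutely_integrable[OF weak_deriv_H1(2)[OF u] assms(1)] .
  have "\<bar>\<bar>w b\<bar> - \<bar>w a\<bar>\<bar> \<le> \<bar>w b - w a\<bar>" by (rule abs_triangle_ineq3)
  also have "\<dots> = \<bar>integral {a..b} v\<bar>" using w_inc[OF assms] by simp
  also have "\<dots> \<le> integral {a..b} (\<lambda>x. \<bar>v x\<bar>)"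
    using integral_norm_bound_integral[of v "{a..b}" "\<lambda>x. \<bar>v x\<bar>"] i
      set_lebesgue_integral_eq_integral(1)[OF i] absolutely_integrable_imp_abs_integrable[OF i] by simp
  finally show ?thesis .
qed

lemma chain_abs_w:
  assumes xy: "0 \<le> x" "x \<le> y"
    and \<Phi>: "continuous_on {0..M} \<Phi>" "\<And>t. 0 < t \<Longrightarrow> t < M \<Longrightarrow> (\<Phi> has_real_derivative g t) (at t)"
    and g: "continuous_on {0..M} g" "\<And>t. t \<in> {0..M} \<Longrightarrow> 0 \<le> g t"
    and M: "\<And>z. z \<in> {x..y} \<Longrightarrow> \<bar>w z\<bar> \<le> M"
  shows "\<bar>\<Phi> \<bar>w y\<bar> - \<Phi> \<bar>w x\<bar>\<bar> \<le> integral {x..y} (\<lambda>z. \<bar>v z\<bar> * g \<bar>w z\<bar>)"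
proof (rule chain_inequality[OF xy(2) \<Phi> g])
  show "continuous_on {x..y} (\<lambda>z. \<bar>w z\<bar>)"
    by (intro continuous_on_rabs continuous_on_subset[OF w_cont]) (use xy in auto)
  show "(\<lambda>z. \<bar>v z\<bar>) absolutely_integrable_on {x..y}"
    using L2_halfline_absolutely_integrable[OF weak_deriv_H1(2)[OF u] xy(1)] by (rule set_integrable_abs)
  show "\<bar>\<bar>w b\<bar> - \<bar>w a\<bar>\<bar> \<le> integral {a..b} (\<lambda>z. \<bar>v z\<bar>)" if "x \<le> a" "a \<le> b" for a b
    using that xy by (intro abs_w_increment) auto
qed (use M in auto)

text \<open>The variation of \<open>w^2\<close> is controlled by the integrable function
  \<open>v^2 + w^2\<close>. Hence \<open>w x\<close> is small once the tail of that integral is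
  small and \<open>w\<close> is small at a single later point, which integrability provides.\<close>

lemma w_tendsto_0: "(w \<longlongrightarrow> 0) at_top"
proof -
  define h where "h = (\<lambda>x. (v x)\<^sup>2 + (w x)\<^sup>2)"
  have hi: "integrable halfline h" unfolding h_def by (intro Bochner_Integration.integrable_add v2_integrable w2_integrable)
  have h0: "0 \<le> h x" for x by (simp add: h_def)
  have hint: "h integrable_on {x..y}" if "0 \<le> x" for x y
    using halfline_integrable_imp_interval[OF hi that] set_lebesgue_integral_eq_integral(1) by blast
  define I where "I = (\<lambda>y. integral {0..y} h)"
  have I: "I y - I x = integral {x..y} h" if "0 \<le> x" "x \<le> y" for x y
    unfolding I_def using Henstock_Kurzweil_Integration.integral_combine[OF that hint[of 0 y]] by simp
  have bdd: "bdd_above (I ` {0..})"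
    unfolding I_def using integral_interval_le_LINT_halfline[OF hi h0] by (intro bdd_aboveI2) auto
  have sq: "(w x)\<^sup>2 \<le> (w y)\<^sup>2 + integral {x..y} h" if "0 \<le> x" "x \<le> y" for x y
  proof -
    have "continuous_on {x..y} (\<lambda>z. \<bar>w z\<bar>)"
      by (intro continuous_on_rabs continuous_on_subset[OF w_cont]) (use that in auto)
    then have "compact ((\<lambda>z. \<bar>w z\<bar>) ` {x..y})"
      by (rule compact_continuous_image) simp
    then have "bounded ((\<lambda>z. \<bar>w z\<bar>) ` {x..y})" by (rule compact_imp_bounded)
    then obtain M where "\<forall>z\<in>{x..y}. \<bar>w z\<bar> \<le> M" unfolding bounded_iff by auto
    then have M: "\<bar>w z\<bar> \<le> M" if "z \<in> {x..y}" for z using that by blast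
    have "\<bar>\<bar>w y\<bar>\<^sup>2 / 2 - \<bar>w x\<bar>\<^sup>2 / 2\<bar> \<le> integral {x..y} (\<lambda>z. \<bar>v z\<bar> * \<bar>w z\<bar>)"
      by (rule chain_abs_w[OF that, where M=M and \<Phi>="\<lambda>t. t\<^sup>2 / 2" and g="\<lambda>t. t"])
         (use M in \<open>auto intro!: continuous_intros derivative_eq_intros\<close>)
    also have "\<dots> \<le> integral {x..y} (\<lambda>z. 1 / 2 * h z)"
    proof (rule integral_le)
      have "(\<lambda>z. \<bar>v z\<bar> * \<bar>w z\<bar>) absolutely_integrable_on {x..y}"
        by (intro absolutely_integrable_mult_continuous set_integrable_abs continuous_on_rabs
            L2_halfline_absolutely_integrable[OF weak_deriv_H1(2)[OF u] that(1)] continuous_on_subset[OF w_cont])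
           (use that in auto)
      then show "(\<lambda>z. \<bar>v z\<bar> * \<bar>w z\<bar>) integrable_on {x..y}"
        using set_lebesgue_integral_eq_integral(1) by blast
      show "(\<lambda>z. 1 / 2 * h z) integrable_on {x..y}"
        by (intro integrable_on_mult_right hint that)
      show "\<bar>v z\<bar> * \<bar>w z\<bar> \<le> 1 / 2 * h z" for z
        using sum_squares_bound[of "\<bar>v z\<bar>" "\<bar>w z\<bar>"] by (simp add: h_def)
    qed
    also have "\<dots> = 1 / 2 * integral {x..y} h"
      by (rule integral_mult_right)
    finally show ?thesis unfolding power2_abs by linarith
  qed
  show ?thesis
  proof (rule tendstoI)
    fix e :: real assume "e > 0"
    \<comment> \<open>One half of \<open>e^2\<close> for the value at the later point, one half for
      the tail integral.\<close>
    define c where "c = e\<^sup>2 / 2"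
    have c: "c > 0" using \<open>e > 0\<close> by (simp add: c_def)
    obtain X where X: "X \<ge> 0" "I X > (SUP y\<in>{0..}. I y) - c"
      using less_cSUP_iff[OF _ bdd, of "(SUP y\<in>{0..}. I y) - c"] c by auto
    have tail: "integral {x..y} h < c" if "X \<le> x" "x \<le> y" for x y
    proof -
      have "I y \<le> (SUP y\<in>{0..}. I y)" using that X by (intro cSUP_upper bdd) auto
      moreover have "I X \<le> I x" using I[of X x] integral_nonneg[OF hint[of X x]] h0 that X by simp
      ultimately show ?thesis using I[of x y] that X by linarith
    qed
    have "\<bar>w x\<bar> < e" if x: "x \<ge> X" for x
    proof -
      have "\<exists>y\<ge>x. (w y)\<^sup>2 < c"
      proof (rule ccontr)
        assume "\<not> (\<exists>y\<ge>x. (w y)\<^sup>2 < c)"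
        then have ge: "c \<le> h y" if "y \<ge> x" for y
        proof -
          have "c \<le> (w y)\<^sup>2" using that \<open>\<not> (\<exists>y\<ge>x. (w y)\<^sup>2 < c)\<close> by (meson not_less)
          then show ?thesis by (simp add: h_def add_increasing)
        qed
        have "integral {x..x + 1} (\<lambda>_. c) \<le> integral {x..x + 1} h"
          using ge x X by (intro integral_le hint) auto
        then show False using tail[of x "x + 1"] x by simp
      qed
      then obtain y where y: "y \<ge> x" "(w y)\<^sup>2 < c" by auto
      then have "(w x)\<^sup>2 < e\<^sup>2"
        using sq[of x y] tail[of x y] x X c_def by auto
      then show ?thesis using \<open>e > 0\<close> power2_less_imp_less[of "\<bar>w x\<bar>" e] by simp
    qed
    then show "eventually (\<lambda>x. dist (w x) 0 < e) at_top"
      unfolding eventually_at_top_linorder by (intro exI[of _ X]) auto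
  qed
qed

lemma abs_w_attains_max: "\<exists>x1\<ge>0. \<forall>x\<ge>0. \<bar>w x\<bar> \<le> \<bar>w x1\<bar>"
proof (cases "\<exists>x0\<ge>0. w x0 \<noteq> 0")
  case True
  then obtain x0 where x0: "x0 \<ge> 0" "w x0 \<noteq> 0" by auto
  then have "eventually (\<lambda>x. dist (w x) 0 < \<bar>w x0\<bar>) at_top"
    using w_tendsto_0 by (intro tendstoD) auto
  then obtain X where X: "\<forall>x\<ge>X. \<bar>w x\<bar> < \<bar>w x0\<bar>"
    unfolding eventually_at_top_linorder by (auto simp: dist_real_def)
  have "continuous_on {0..max X x0} (\<lambda>z. \<bar>w z\<bar>)"
    by (intro continuous_on_rabs continuous_on_subset[OF w_cont]) auto
  moreover have "{0..max X x0} \<noteq> {}" using x0 by auto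
  ultimately have "\<exists>x1\<in>{0..max X x0}. \<forall>x\<in>{0..max X x0}. \<bar>w x\<bar> \<le> \<bar>w x1\<bar>"
    by (intro continuous_attains_sup) auto
  then obtain x1 where x1: "x1 \<in> {0..max X x0}" "\<forall>x\<in>{0..max X x0}. \<bar>w x\<bar> \<le> \<bar>w x1\<bar>"
    by blast
  have "\<bar>w x\<bar> \<le> \<bar>w x1\<bar>" if "0 \<le> x" for x
  proof (cases "x \<le> max X x0")
    case False
    then have "X \<le> x" by simp
    with X have "\<bar>w x\<bar> < \<bar>w x0\<bar>" by blast
    also have "x0 \<in> {0..max X x0}" using x0 by auto
    with x1(2) have "\<bar>w x0\<bar> \<le> \<bar>w x1\<bar>" by blast
    finally show ?thesis by simp
  next
    case True
    with that have "x \<in> {0..max X x0}" by simp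
    with x1(2) show ?thesis by blast
  qed
  then show ?thesis using x1(1) by (intro exI[of _ x1]) simp
next
  case False
  then have "w x = 0" if "0 \<le> x" for x using that by blast
  then show ?thesis by (intro exI[of _ 0]) simp
qed

text \<open>The variation over \<open>[0, x]\<close> yields
  \<open>\<Phi> |w x| - \<Phi> |w 0|\<close>, and by decay the variation beyond \<open>x\<close>
  yields \<open>\<Phi> |w x|\<close> once more. It will be used with \<open>x\<close> a maximum
  point and with \<open>x = 0\<close>.\<close>

lemma calibration:
  assumes M: "\<And>z. 0 \<le> z \<Longrightarrow> \<bar>w z\<bar> \<le> M"
    and \<Phi>: "continuous_on {0..M} \<Phi>" "\<And>t. 0 < t \<Longrightarrow> t < M \<Longrightarrow> (\<Phi> has_real_derivative g t) (at t)"
    and g: "continuous_on {0..M} g" "\<And>t. t \<in> {0..M} \<Longrightarrow> 0 \<le> g t"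
    and \<Phi>0: "\<Phi> 0 = 0"
    and int: "integrable halfline (\<lambda>z. \<bar>v z\<bar> * g \<bar>w z\<bar>)"
    and x: "0 \<le> x"
  shows "2 * \<Phi> \<bar>w x\<bar> - \<Phi> \<bar>w 0\<bar> \<le> (LINT z|halfline. \<bar>v z\<bar> * g \<bar>w z\<bar>)"
proof -
  have M0: "0 \<le> M" using M[of 0] by simp
  have lim: "((\<lambda>y. \<Phi> \<bar>w y\<bar>) \<longlongrightarrow> 0) at_top"
  proof -
    have "((\<lambda>y. \<bar>w y\<bar>) \<longlongrightarrow> 0) at_top"
      using tendsto_rabs_zero[OF w_tendsto_0] .
    moreover have "eventually (\<lambda>y. \<bar>w y\<bar> \<in> {0..M}) at_top"
      unfolding eventually_at_top_linorder using M by (intro exI[of _ 0]) auto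
    ultimately have "((\<lambda>y. \<Phi> \<bar>w y\<bar>) \<longlongrightarrow> \<Phi> 0) at_top"
      using M0 by (intro continuous_on_tendsto_compose[OF \<Phi>(1)]) auto
    then show ?thesis by (simp add: \<Phi>0)
  qed
  \<comment> \<open>Monotonicity in the interval is stated for integrands nonnegative on the whole
    line, but \<open>g |w z|\<close> has a known sign only where the bound \<open>M\<close> is
    available.\<close>
  let ?V = "\<lambda>z. if z > 0 then \<bar>v z\<bar> * g \<bar>w z\<bar> else 0"
  have Vi: "integrable halfline ?V"
    using int by (subst Bochner_Integration.integrable_cong[where g="\<lambda>z. \<bar>v z\<bar> * g \<bar>w z\<bar>"]) auto
  have VL: "(LINT z|halfline. ?V z) = (LINT z|halfline. \<bar>v z\<bar> * g \<bar>w z\<bar>)"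
    by (rule Bochner_Integration.integral_cong) auto
  have bound: "2 * \<Phi> \<bar>w x\<bar> - \<Phi> \<bar>w 0\<bar> - \<Phi> \<bar>w y\<bar> \<le> (LINT z|halfline. \<bar>v z\<bar> * g \<bar>w z\<bar>)" if "x \<le> y" for y
  proof -
    have ch: "\<bar>\<Phi> \<bar>w b\<bar> - \<Phi> \<bar>w a\<bar>\<bar> \<le> integral {a..b} ?V" if "0 \<le> a" "a \<le> b" for a b
    proof -
      have "\<bar>\<Phi> \<bar>w b\<bar> - \<Phi> \<bar>w a\<bar>\<bar> \<le> integral {a..b} (\<lambda>z. \<bar>v z\<bar> * g \<bar>w z\<bar>)"
        using that M by (intro chain_abs_w[OF that \<Phi> g]) auto
      also have "\<dots> = integral {a..b} ?V"
        by (rule integral_spike[of "{0}"]) (use that in auto)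
      finally show ?thesis .
    qed
    have "integral {0..x} ?V + integral {x..y} ?V = integral {0..y} ?V"
      using x that halfline_integrable_imp_interval[OF Vi, of 0 y]
      by (intro Henstock_Kurzweil_Integration.integral_combine set_lebesgue_integral_eq_integral(1)) auto
    also have "\<dots> \<le> (LINT z|halfline. ?V z)"
    proof (rule integral_interval_le_LINT_halfline[OF Vi])
      show "0 \<le> ?V z" for z using g(2)[of "\<bar>w z\<bar>"] M[of z] by auto
    qed auto
    finally show ?thesis using ch[of 0 x] ch[of x y] x that VL by linarith
  qed
  have "((\<lambda>y. 2 * \<Phi> \<bar>w x\<bar> - \<Phi> \<bar>w 0\<bar> - \<Phi> \<bar>w y\<bar>) \<longlongrightarrow> 2 * \<Phi> \<bar>w x\<bar> - \<Phi> \<bar>w 0\<bar> - 0) at_top"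
    by (intro tendsto_intros lim)
  then have "2 * \<Phi> \<bar>w x\<bar> - \<Phi> \<bar>w 0\<bar> - 0 \<le> (LINT z|halfline. \<bar>v z\<bar> * g \<bar>w z\<bar>)"
    by (rule tendsto_upperbound) (use bound in \<open>auto simp: eventually_at_top_linorder\<close>)
  then show ?thesis by simp
qed

end

section \<open>Truncated Beta integrals\<close>

definition wt :: "real \<Rightarrow> real \<Rightarrow> real" where
  "wt b r = (1 - r\<^sup>2) powr b"

definition tail :: "real \<Rightarrow> real \<Rightarrow> real" where
  "tail b r = integral {r..1} (wt b)"

text \<open>Integration by parts applied to the integral of \<open>s^2 (1 - s^2)^b\<close> over
  \<open>[r, 1]\<close>; it expresses the action through the same function \<open>tail\<close> as
  the mass.\<close>

definition tail2 :: "real \<Rightarrow> real \<Rightarrow> real" where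
  "tail2 b r = (tail b r + r * (1 - r\<^sup>2) powr (b + 1)) / (2 * b + 3)"

lemma wt_nonneg: "0 \<le> wt b r"
  by (simp add: wt_def)

lemma wt_minus: "wt b (- r) = wt b r"
  by (simp add: wt_def)

lemma one_minus_square_pos: "\<bar>r\<bar> < 1 \<Longrightarrow> 0 < 1 - (r::real)\<^sup>2"
  by (simp add: abs_square_less_1)

lemma wt_pos: "\<bar>r\<bar> < 1 \<Longrightarrow> 0 < wt b r"
  using one_minus_square_pos[of r] by (simp add: wt_def)

lemma wt_continuous_on: "continuous_on {-1<..<1} (wt b)"
  unfolding wt_def using one_minus_square_pos by (intro continuous_intros) (auto simp: abs_square_eq_1)

text \<open>Dominated by \<open>1 + 1 / sqrt (1 - x^2)\<close>, whose second term is the derivative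
  of \<open>arcsin\<close>.\<close>

lemma wt_absolutely_integrable:
  assumes b: "b > - 1 / 2"
  shows "wt b absolutely_integrable_on {-1..1}"
proof (rule measurable_bounded_by_integrable_imp_absolutely_integrable)
  have "wt b \<in> borel_measurable borel"
    unfolding wt_def by measurable
  then show "wt b \<in> borel_measurable (lebesgue_on {-1..1})"
    by (simp add: measurable_completion measurable_restrict_space1)
  have "((\<lambda>x. inverse (sqrt (1 - x\<^sup>2))) has_integral (arcsin 1 - arcsin (-1))) {-1..1}"
    by (rule fundamental_theorem_of_calculus_interior)
       (auto intro!: continuous_on_arcsin' DERIV_arcsin simp: has_real_derivative_iff_has_vector_derivative[symmetric])
  then show "(\<lambda>x. 1 + inverse (sqrt (1 - x\<^sup>2))) integrable_on {-1..1}"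
    by (intro integrable_add) (auto simp: integrable_on_def)
  fix x :: real assume x: "x \<in> {-1..1}"
  show "norm (wt b x) \<le> 1 + inverse (sqrt (1 - x\<^sup>2))"
  proof (cases "\<bar>x\<bar> < 1")
    case True
    define y where "y = 1 - x\<^sup>2"
    have y: "0 < y" "y \<le> 1" using one_minus_square_pos[OF True] by (auto simp: y_def)
    have "y powr b \<le> y powr (- 1 / 2)"
      using y b powr_mono'[of "-1/2" b y] by simp
    also have "y powr (- 1 / 2) = inverse (sqrt y)"
      using y by (simp add: powr_minus powr_half_sqrt)
    finally show ?thesis using y by (simp add: wt_def y_def)
  next
    \<comment> \<open>At the endpoints the convention \<open>0 powr b = 0\<close> applies.\<close>
    case False
    then have "x\<^sup>2 = 1" using x by (auto simp: abs_if split: if_splits)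
    then show ?thesis by (simp add: wt_def)
  qed
qed auto

lemma wt_integrable:
  assumes "b > - 1 / 2" "-1 \<le> x" "y \<le> 1"
  shows "wt b integrable_on {x..y}"
  using absolutely_integrable_on_subinterval[OF wt_absolutely_integrable[OF assms(1)], of x y] assms
    set_lebesgue_integral_eq_integral(1) by auto

lemma tail_diff:
  assumes "b > - 1 / 2" "-1 \<le> x" "x \<le> y" "y \<le> 1"
  shows "tail b x - tail b y = integral {x..y} (wt b)"
  unfolding tail_def
  using Henstock_Kurzweil_Integration.integral_combine[OF assms(3,4) wt_integrable[OF assms(1,2)]] by simp

text \<open>Trades the moving lower limit for a moving upper one, to which the results on indefinite
  integrals apply.\<close>

lemma tail_eq:
  assumes "b > - 1 / 2" "-1 \<le> x" "x \<le> 1"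
  shows "tail b x = tail b (-1) - integral {-1..x} (wt b)"
  using tail_diff[of b "-1" x] assms by simp

lemma tail_continuous_on: "b > - 1 / 2 \<Longrightarrow> continuous_on {-1..1} (tail b)"
proof -
  assume b: "b > - 1 / 2"
  have "continuous_on {-1..1} (\<lambda>x. tail b (-1) - integral {-1..x} (wt b))"
    by (intro continuous_intros indefinite_integral_continuous_1 wt_integrable[OF b]) auto
  then show ?thesis
    by (rule continuous_on_eq) (rule tail_eq[OF b, symmetric], auto)
qed

lemma tail_has_real_derivative:
  assumes b: "b > - 1 / 2" and r: "\<bar>r\<bar> < 1"
  shows "(tail b has_real_derivative - wt b r) (at r)"
proof -
  have r': "r \<in> {-1<..<1}" using r by auto
  have "isCont (wt b) r"
    using wt_continuous_on[of b] r' by (simp add: continuous_on_eq_continuous_at)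
  then have "((\<lambda>u. integral {-1..u} (wt b)) has_vector_derivative wt b r) (at r within {-1..1} - {})"
    using r' wt_integrable[OF b]
    by (intro integral_has_vector_derivative_continuous_at) (auto intro: continuous_at_imp_continuous_at_within)
  moreover have "at r within {-1..1} - {} = at r"
    using r' at_within_Icc_at[of "-1" r 1] by simp
  ultimately have "((\<lambda>u. integral {-1..u} (wt b)) has_real_derivative wt b r) (at r)"
    by (simp add: has_real_derivative_iff_has_vector_derivative)
  then have "((\<lambda>u. tail b (-1) - integral {-1..u} (wt b)) has_real_derivative - wt b r) (at r)"
    by (auto intro!: derivative_eq_intros)
  moreover have "eventually (\<lambda>u. u \<in> {-1<..<1}) (nhds r)"
    using r' by (intro eventually_nhds_in_open) auto
  then have "eventually (\<lambda>u. tail b u = tail b (-1) - integral {-1..u} (wt b)) (nhds r)"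
    by eventually_elim (rule tail_eq[OF b], auto)
  ultimately show ?thesis
    using DERIV_cong_ev[of r r "tail b" "\<lambda>u. tail b (-1) - integral {-1..u} (wt b)"] by simp
qed

lemma tail_1 [simp]: "tail b 1 = 0"
  by (simp add: tail_def)

lemma tail_strict_antimono:
  assumes b: "b > - 1 / 2" and xy: "-1 \<le> x" "x < y" "y \<le> 1"
  shows "tail b y < tail b x"
proof (rule DERIV_neg_imp_decreasing_open[OF xy(2)])
  fix z assume "x < z" "z < y"
  then have "\<bar>z\<bar> < 1" using xy by auto
  then show "\<exists>d. (tail b has_real_derivative d) (at z) \<and> d < 0"
    using tail_has_real_derivative[OF b] wt_pos[of z b] by (intro exI[of _ "- wt b z"]) auto
qed (use continuous_on_subset[OF tail_continuous_on[OF b]] xy in auto)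

lemma tail_pos: "b > - 1 / 2 \<Longrightarrow> -1 \<le> x \<Longrightarrow> x < 1 \<Longrightarrow> 0 < tail b x"
  using tail_strict_antimono[of b x 1] by simp

lemma tail_minus:
  assumes b: "b > - 1 / 2" and r: "r \<in> {-1..1}"
  shows "tail b (- r) = 2 * tail b 0 - tail b r"
proof -
  have refl: "integral {-x..-y} (wt b) = integral {y..x} (wt b)" for x y
    using Henstock_Kurzweil_Integration.integral_reflect_real[of x y "wt b"] by (simp add: wt_minus)
  show ?thesis
  proof (cases "0 \<le> r")
    case True
    then show ?thesis
      using tail_diff[OF b, of "-r" 0] tail_diff[OF b, of 0 r] refl[of r 0] r by simp
  next
    case False
    then show ?thesis
      using tail_diff[OF b, of r 0] tail_diff[OF b, of 0 "-r"] refl[of 0 r] r by simp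
  qed
qed

lemma tail2_1 [simp]: "tail2 b 1 = 0"
  by (simp add: tail2_def)

lemma tail2_0: "tail2 b 0 = tail b 0 / (2 * b + 3)"
  by (simp add: tail2_def)

lemma tail2_minus:
  assumes b: "b > - 1 / 2" and r: "r \<in> {-1..1}"
  shows "tail2 b (- r) = 2 * tail2 b 0 - tail2 b r"
  using tail_minus[OF assms] by (simp add: tail2_def diff_divide_distrib add_divide_distrib)

lemma tail2_continuous_on: "b > - 1 / 2 \<Longrightarrow> continuous_on {-1..1} (tail2 b)"
  unfolding tail2_def
  by (intro continuous_intros tail_continuous_on continuous_on_powr') (auto simp: abs_square_le_1)

lemma tail2_has_real_derivative:
  assumes b: "b > - 1 / 2" and r: "\<bar>r\<bar> < 1"
  shows "(tail2 b has_real_derivative - (r\<^sup>2 * wt b r)) (at r)"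
proof -
  define y where "y = 1 - r\<^sup>2"
  have y: "y > 0" using one_minus_square_pos[OF r] by (simp add: y_def)
  have D: "((\<lambda>r. (1 - r\<^sup>2) powr (b + 1)) has_real_derivative (b + 1) * y powr b * (- (2 * r))) (at r)"
    using y unfolding y_def by (auto intro!: derivative_eq_intros)
  have yb: "y powr (b + 1) = y * y powr b" using y by (simp add: powr_add)
  have eq: "(- wt b r + (1 * y powr (b + 1) + (b + 1) * y powr b * (- (2 * r)) * r)) / (2 * b + 3) = - (r\<^sup>2 * wt b r)"
  proof -
    have "- wt b r + (1 * y powr (b + 1) + (b + 1) * y powr b * (- (2 * r)) * r) = - (r\<^sup>2 * wt b r) * (2 * b + 3)"
      unfolding yb wt_def y_def[symmetric] unfolding y_def by (simp add: algebra_simps power2_eq_square)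
    then show ?thesis using b by (simp add: field_simps)
  qed
  show ?thesis
    unfolding tail2_def[abs_def]
    by (rule DERIV_cong[OF DERIV_cdivide[OF DERIV_add[OF tail_has_real_derivative[OF b r] DERIV_mult[OF DERIV_ident D]]]])
       (use eq in \<open>simp add: y_def mult_ac\<close>)
qed

lemma tail2_antimono:
  assumes b: "b > - 1 / 2" and xy: "-1 \<le> x" "x \<le> y" "y \<le> 1"
  shows "tail2 b y \<le> tail2 b x"
proof (rule DERIV_nonpos_imp_decreasing_open[OF xy(2)])
  fix z assume "x < z" "z < y"
  then have "\<bar>z\<bar> < 1" using xy by auto
  then show "\<exists>d. (tail2 b has_real_derivative d) (at z) \<and> d \<le> 0"
    using tail2_has_real_derivative[OF b] wt_nonneg[of b z] by (intro exI[of _ "- (z\<^sup>2 * wt b z)"]) auto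
qed (use continuous_on_subset[OF tail2_continuous_on[OF b]] xy in auto)

text \<open>The right-hand side is the integral of \<open>s (1 - s^2)^b\<close> over
  \<open>[r, 1]\<close>, and \<open>r \<le> s\<close> there. It controls arcs that start beyond the
  peak.\<close>

lemma tail_lower_bound:
  assumes b: "b > - 1 / 2" and r: "0 \<le> r" "r < 1"
  shows "r * tail b r \<le> (1 - r\<^sup>2) powr (b + 1) / (2 * (b + 1))"
proof -
  define f where "f = (\<lambda>x. (1 - x\<^sup>2) powr (b + 1) / (2 * (b + 1)) - r * tail b x)"
  have "f 1 \<le> f r"
  proof (rule DERIV_nonpos_imp_decreasing_open[of r 1 f])
    fix z assume z: "r < z" "z < 1"
    then have z1: "\<bar>z\<bar> < 1" using r by auto
    have y: "0 < 1 - z\<^sup>2" using one_minus_square_pos[OF z1] .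
    have "((\<lambda>x. (1 - x\<^sup>2) powr (b + 1)) has_real_derivative (b + 1) * (1 - z\<^sup>2) powr b * (- (2 * z))) (at z)"
      using y by (auto intro!: derivative_eq_intros)
    from DERIV_diff[OF DERIV_cdivide[OF this, of "2 * (b + 1)"] DERIV_cmult[OF tail_has_real_derivative[OF b z1], of r]]
    have "(f has_real_derivative - (z * wt b z) - r * (- wt b z)) (at z)"
      unfolding f_def by (rule DERIV_cong, use b in \<open>simp add: wt_def divide_simps\<close>) (simp add: algebra_simps)
    moreover have "- (z * wt b z) - r * (- wt b z) \<le> 0"
      using z wt_nonneg[of b z] by (simp add: mult_right_mono)
    ultimately show "\<exists>d. (f has_real_derivative d) (at z) \<and> d \<le> 0" by blast
  next
    show "continuous_on {r..1} f"
      unfolding f_def using b r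
      by (intro continuous_intros continuous_on_powr' continuous_on_subset[OF tail_continuous_on[OF b]])
         (auto simp: abs_square_le_1)
  qed (use r in auto)
  moreover have "f 1 = 0" by (simp add: f_def)
  ultimately show ?thesis by (simp add: f_def)
qed

lemma tail_at_minus_1_eq_LINT:
  assumes b: "b > - 1 / 2"
  shows "tail b (-1) = 2 * (LINT s|lebesgue_on {0..1}. (1 - s\<^sup>2) powr b)"
proof -
  have "wt b absolutely_integrable_on {0..1}"
    by (rule absolutely_integrable_on_subinterval[OF wt_absolutely_integrable[OF b]]) auto
  then have "(LINT s|lebesgue_on {0..1}. wt b s) = integral {0..1} (wt b)"
    by (intro lebesgue_integral_eq_integral absolutely_integrable_imp_integrable) auto
  then show ?thesis
    using tail_minus[OF b, of 1] by (simp add: tail_def wt_def)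
qed

section \<open>The profile of a soliton\<close>

lemma powr_Bernoulli:
  fixes x \<theta> :: real
  assumes "0 < x" "1 \<le> \<theta>"
  shows "1 + \<theta> * (x - 1) \<le> x powr \<theta>"
proof -
  have "\<theta> * (x - 1) \<le> x powr \<theta> - 1 powr \<theta>"
  proof (rule convex_on_imp_above_tangent[OF powr_convex[OF assms(2)]])
    show "((\<lambda>x. x powr \<theta>) has_real_derivative \<theta>) (at 1 within {0<..})"
      by (auto intro!: derivative_eq_intros)
    show "1 \<in> interior ({0<..}::real set)" by (simp add: interior_open)
  qed (use assms in auto)
  then show ?thesis by simp
qed

locale subcritical_exponent =
  fixes p :: real
  assumes p: "2 < p" "p < 6"
begin

text \<open>With \<open>L\<^sup>2\<close> in the role of the Lagrange multiplier, the soliton \<open>\<phi>\<close> solving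
  \<open>\<phi>'\<^sup>2 = L\<^sup>2 \<phi>\<^sup>2 - 2 \<phi>\<^sup>p / p\<close> has peak \<open>height L\<close>; at a point where \<open>\<phi> = t\<close> one has \<open>|\<phi>'| = t slope L t\<close>;
  and \<open>mass L t\<close>, \<open>action L t\<close> are the integrals of \<open>\<phi>\<^sup>2\<close> and \<open>\<phi>'\<^sup>2\<close> over a monotone branch between \<open>t\<close>
  and \<open>0\<close>, evaluated by the substitution \<open>r = |\<phi>'| / (L \<phi>)\<close>.\<close>

definition b :: real where "b = (4 - p) / (p - 2)"
definition A :: real where "A = (b + 1) * (p / 2) powr (b + 1)"
definition height :: "real \<Rightarrow> real" where "height L = (p / 2 * L\<^sup>2) powr ((b + 1) / 2)"
definition slope :: "real \<Rightarrow> real \<Rightarrow> real" where "slope L t = sqrt (L\<^sup>2 - 2 / p * t powr (p - 2))"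
definition action :: "real \<Rightarrow> real \<Rightarrow> real" where
  "action L t = A * L powr (2 * b + 3) * tail2 b (slope L t / L)"
definition mass :: "real \<Rightarrow> real \<Rightarrow> real" where
  "mass L t = A * L powr (2 * b + 1) * tail b (slope L t / L)"

lemma b_plus_1: "b + 1 = 2 / (p - 2)"
  using p by (simp add: b_def field_simps)

lemma b_gt: "b > - 1 / 2"
  using p by (simp add: b_def field_simps)

lemma b_times: "(b + 1) * (p - 2) = 2"
proof -
  define q where "q = p - 2"
  have "q \<noteq> 0" using p by (simp add: q_def)
  then have "2 / q * q = 2" by simp
  then show ?thesis unfolding b_plus_1 q_def .
qed

lemma A_pos: "A > 0"
  using p b_gt by (simp add: A_def)

lemma height_pos: "L > 0 \<Longrightarrow> height L > 0"
  using p by (simp add: height_def)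

lemma height_powr: "L > 0 \<Longrightarrow> height L powr (p - 2) = p / 2 * L\<^sup>2"
  using p b_times by (simp add: height_def powr_powr)

text \<open>Origin of \<open>A\<close>: with \<open>\<kappa> = L / (b + 1)\<close> one has
  \<open>dx = dr / (\<kappa> (1 - r^2))\<close> along the soliton, so the mass carries the factor
  \<open>(height L)^2 / \<kappa>\<close>, which is \<open>A L^(2 b + 1)\<close>.\<close>

lemma height_sq: "L > 0 \<Longrightarrow> (b + 1) * (height L)\<^sup>2 = A * L powr (2 * b + 2)"
proof -
  assume L: "L > 0"
  have "(height L)\<^sup>2 = (p / 2 * L\<^sup>2) powr (b + 1)"
    by (simp add: height_def power2_eq_square flip: powr_add)
  also have "\<dots> = (p / 2) powr (b + 1) * (L powr 2) powr (b + 1)"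
    using p L powr_mult[of "p / 2" "L powr 2" "b + 1"] by simp
  also have "(L powr 2) powr (b + 1) = L powr (2 * b + 2)"
    unfolding powr_powr by (simp add: algebra_simps)
  finally show ?thesis by (simp add: A_def)
qed

lemma le_height_iff:
  assumes "L > 0" "t \<ge> 0"
  shows "t \<le> height L \<longleftrightarrow> 2 / p * t powr (p - 2) \<le> L\<^sup>2"
proof -
  have "t \<le> height L \<longleftrightarrow> t powr (p - 2) \<le> height L powr (p - 2)"
    using assms p height_pos[of L] powr_mono2[of "p - 2" t "height L"] powr_less_mono2[of "p - 2" "height L" t]
    by (meson diff_gt_0_iff_gt less_imp_le not_less)
  then show ?thesis using p assms by (simp add: height_powr field_simps)
qed

lemma less_height_iff:
  assumes "L > 0" "t \<ge> 0"
  shows "t < height L \<longleftrightarrow> 2 / p * t powr (p - 2) < L\<^sup>2"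
proof -
  have "t < height L \<longleftrightarrow> t powr (p - 2) < height L powr (p - 2)"
    using assms p height_pos[of L] powr_mono2[of "p - 2" "height L" t] powr_less_mono2[of "p - 2" t "height L"]
    by (meson diff_gt_0_iff_gt less_imp_le not_less)
  then show ?thesis using p assms by (simp add: height_powr field_simps)
qed

lemma height_mono:
  assumes "0 < L" "L \<le> L'"
  shows "height L \<le> height L'"
  unfolding height_def using assms p b_gt by (intro powr_mono2 mult_left_mono power_mono) auto

lemma slope_0 [simp]: "L > 0 \<Longrightarrow> slope L 0 = L"
  by (simp add: slope_def)

lemma slope_height [simp]: "L > 0 \<Longrightarrow> slope L (height L) = 0"
  using p by (simp add: slope_def height_powr)

lemma slope_sq: "L > 0 \<Longrightarrow> 0 \<le> t \<Longrightarrow> t \<le> height L \<Longrightarrow> (slope L t)\<^sup>2 = L\<^sup>2 - 2 / p * t powr (p - 2)"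
  using le_height_iff[of L t] by (simp add: slope_def)

lemma slope_nonneg: "L > 0 \<Longrightarrow> 0 \<le> t \<Longrightarrow> t \<le> height L \<Longrightarrow> 0 \<le> slope L t"
  using le_height_iff[of L t] by (simp add: slope_def)

lemma slope_le: "L > 0 \<Longrightarrow> slope L t \<le> L"
  using p by (auto simp: slope_def intro!: real_le_lsqrt)

lemma slope_less: "L > 0 \<Longrightarrow> t > 0 \<Longrightarrow> slope L t < L"
  using p by (auto simp: slope_def intro!: real_less_lsqrt)

lemma slope_pos: "L > 0 \<Longrightarrow> 0 \<le> t \<Longrightarrow> t < height L \<Longrightarrow> 0 < slope L t"
  using less_height_iff[of L t] by (simp add: slope_def)

lemma slope_ratio: "L > 0 \<Longrightarrow> 0 \<le> t \<Longrightarrow> t \<le> height L \<Longrightarrow> slope L t / L \<in> {0..1}"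
  using slope_nonneg[of L t] slope_le[of L t] by simp

lemma slope_continuous_on: "continuous_on {0..} (slope L)"
  unfolding slope_def using p by (intro continuous_intros continuous_on_powr') auto

text \<open>Here \<open>1 - (slope L t / L)^2\<close> equals \<open>(t / height L)^(p - 2)\<close>,
  and \<open>(p - 2) (b + 1) = 2\<close>. This translates between the value \<open>t\<close> on the
  soliton and the variable \<open>r\<close>.\<close>

lemma one_minus_slope_ratio_powr:
  assumes "L > 0" "0 \<le> t" "t \<le> height L"
  shows "A * L powr (2 * b + 2) * (1 - (slope L t / L)\<^sup>2) powr (b + 1) = (b + 1) * t\<^sup>2"
proof -
  have "1 - (slope L t / L)\<^sup>2 = 2 / p * t powr (p - 2) / L\<^sup>2"
    using assms by (simp add: power_divide slope_sq diff_divide_distrib)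
  also have "\<dots> = t powr (p - 2) / height L powr (p - 2)"
    using assms p by (simp add: height_powr)
  also have "\<dots> = (t / height L) powr (p - 2)"
    using assms height_pos[of L] by (simp add: powr_divide)
  finally have "(1 - (slope L t / L)\<^sup>2) powr (b + 1) = (t / height L) powr ((p - 2) * (b + 1))"
    by (simp add: powr_powr)
  also have "\<dots> = t\<^sup>2 / (height L)\<^sup>2"
    using assms height_pos[of L] b_times by (simp add: mult.commute power_divide)
  finally show ?thesis
    using height_sq[OF assms(1), symmetric] height_pos[OF assms(1)] by simp
qed

text \<open>On a monotone branch \<open>dx = dt / (t slope L t)\<close>, so
  \<open>\<phi>^2 dx\<close> becomes \<open>t / slope L t dt\<close> and \<open>\<phi>'^2 dx\<close>
  becomes \<open>t slope L t dt\<close>. The second formula makes \<open>action L\<close> the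
  primitive used in the calibration.\<close>

lemma profile_derivatives:
  assumes L: "L > 0" and t: "0 < t" "t < height L"
  shows "(mass L has_real_derivative t / slope L t) (at t)" (is ?M)
    and "(action L has_real_derivative t * slope L t) (at t)" (is ?S)
proof -
  define r where "r = slope L t / L"
  define y where "y = 1 - r\<^sup>2"
  have G: "0 < slope L t" using slope_pos L t by simp
  have r: "0 < r" "r < 1" using G slope_less[OF L t(1)] L by (auto simp: r_def)
  have y: "y > 0" using one_minus_square_pos[of r] r by (simp add: y_def)
  have Gsq: "(slope L t)\<^sup>2 = L\<^sup>2 - 2 / p * t powr (p - 2)" using slope_sq[OF L] t by simp
  have yL: "2 / p * t powr (p - 2) = y * L\<^sup>2"
  proof -
    have "y * L\<^sup>2 = L\<^sup>2 - (slope L t)\<^sup>2"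
      using L by (simp add: y_def r_def power_divide left_diff_distrib)
    then show ?thesis using Gsq by simp
  qed
  have pos: "0 < L\<^sup>2 - 2 / p * t powr (p - 2)" using less_height_iff[OF L, of t] t by simp
  have "((\<lambda>t. L\<^sup>2 - 2 / p * t powr (p - 2)) has_real_derivative - (2 / p * ((p - 2) * t powr (p - 3)))) (at t)"
    using t p by (auto intro!: derivative_eq_intros)
  note inner = this
  have "(slope L has_real_derivative inverse (sqrt (L\<^sup>2 - 2 / p * t powr (p - 2))) / 2 * - (2 / p * ((p - 2) * t powr (p - 3)))) (at t)"
    unfolding slope_def[abs_def]
    by (rule DERIV_chain2[where f=sqrt and g="\<lambda>t. L\<^sup>2 - 2 / p * t powr (p - 2)", OF DERIV_real_sqrt[OF pos] inner])
  then have slope': "(slope L has_real_derivative - ((p - 2) * (y * L\<^sup>2) / (2 * t * slope L t))) (at t)"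
  proof (rule DERIV_cong)
    have gen: "inverse g / 2 * - (k * x / t) = - (k * x / (2 * t * g))" for g k x :: real
      by (simp add: field_simps)
    have "t powr (p - 3) = t powr (p - 2) / t"
      using t powr_diff[of t "p - 2" 1] by (simp add: algebra_simps)
    then have e: "2 / p * ((p - 2) * t powr (p - 3)) = (p - 2) * (2 / p * t powr (p - 2)) / t" by simp
    show "inverse (sqrt (L\<^sup>2 - 2 / p * t powr (p - 2))) / 2 * - (2 / p * ((p - 2) * t powr (p - 3)))
      = - ((p - 2) * (y * L\<^sup>2) / (2 * t * slope L t))"
      unfolding yL[symmetric] slope_def[symmetric] e by (rule gen)
  qed
  have key: "A * L powr (2 * b + 2) * y powr (b + 1) = (b + 1) * t\<^sup>2"
    using one_minus_slope_ratio_powr[OF L, of t] t by (simp add: y_def r_def)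
  have wty: "wt b r * y = y powr (b + 1)" using y by (simp add: wt_def y_def powr_add)
  have val: "A * L powr (2 * b + 1) * (- wt b r * (- ((p - 2) * (y * L\<^sup>2) / (2 * t * slope L t)) / L)) = t / slope L t"
  proof -
    have "A * L powr (2 * b + 1) * (- wt b r * (- ((p - 2) * (y * L\<^sup>2) / (2 * t * slope L t)) / L))
      = (p - 2) * (A * (L powr (2 * b + 1) * L) * (wt b r * y)) / (2 * t * slope L t)"
      using L by (simp add: power2_eq_square mult_ac)
    also have "L powr (2 * b + 1) * L = L powr (2 * b + 2)"
      using L powr_add[of L "2 * b + 1" 1] by (simp add: algebra_simps)
    also have "(p - 2) * (A * L powr (2 * b + 2) * (wt b r * y)) = 2 * t\<^sup>2"
      unfolding wty key using b_times by (simp add: mult_ac)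
    finally show ?thesis using t G by (simp add: power2_eq_square)
  qed
  have r1: "\<bar>slope L t / L\<bar> < 1" using r by (simp add: r_def)
  note chain = DERIV_cdivide[OF slope', of L]
  show ?M
    unfolding mass_def[abs_def]
    by (rule DERIV_cong[OF DERIV_cmult[OF DERIV_chain2[OF tail_has_real_derivative[OF b_gt r1] chain]]])
       (use val in \<open>simp add: r_def\<close>)
  have "A * L powr (2 * b + 3) * (- (r\<^sup>2 * wt b r) * (- ((p - 2) * (y * L\<^sup>2) / (2 * t * slope L t)) / L))
      = (r * L)\<^sup>2 * (A * L powr (2 * b + 1) * (- wt b r * (- ((p - 2) * (y * L\<^sup>2) / (2 * t * slope L t)) / L)))"
  proof -
    have "L powr (2 * b + 3) = L powr (2 * b + 1) * L\<^sup>2"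
      using L powr_add[of L "2 * b + 1" 2] by (simp add: algebra_simps)
    then show ?thesis by (simp add: power_mult_distrib)
  qed
  also have "\<dots> = t * slope L t"
    unfolding val using L G by (simp add: r_def power2_eq_square)
  finally have val2: "A * L powr (2 * b + 3) * (- (r\<^sup>2 * wt b r) * (- ((p - 2) * (y * L\<^sup>2) / (2 * t * slope L t)) / L)) = t * slope L t" .
  show ?S
    unfolding action_def[abs_def]
    by (rule DERIV_cong[OF DERIV_cmult[OF DERIV_chain2[OF tail2_has_real_derivative[OF b_gt r1] chain]]])
       (use val2 in \<open>simp add: r_def\<close>)
qed

lemma profile_continuous_on:
  assumes L: "L > 0"
  shows "continuous_on {0..height L} (mass L)" and "continuous_on {0..height L} (action L)"
proof -
  have c: "continuous_on {0..height L} (\<lambda>t. slope L t / L)"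
    by (intro continuous_on_divide continuous_on_const continuous_on_subset[OF slope_continuous_on]) (use L in auto)
  have im: "(\<lambda>t. slope L t / L) ` {0..height L} \<subseteq> {-1..1}"
    using slope_ratio[OF L] by fastforce
  show "continuous_on {0..height L} (mass L)" "continuous_on {0..height L} (action L)"
    unfolding mass_def action_def
    by (intro continuous_on_mult continuous_on_const continuous_on_compose2[OF tail_continuous_on[OF b_gt] c im]
      continuous_on_compose2[OF tail2_continuous_on[OF b_gt] c im])+
qed

lemma profile_0 [simp]: "L > 0 \<Longrightarrow> mass L 0 = 0" "L > 0 \<Longrightarrow> action L 0 = 0"
  by (simp_all add: mass_def action_def)

lemma mass_height: "L > 0 \<Longrightarrow> mass L (height L) = A * L powr (2 * b + 1) * tail b 0"
  by (simp add: mass_def)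

lemma action_height: "L > 0 \<Longrightarrow> action L (height L) = A * L powr (2 * b + 3) * tail2 b 0"
  by (simp add: action_def)

text \<open>The action up to the peak is a constant times \<open>(L^2)^(b + 3 / 2)\<close>, with
  exponent above 1. Its derivative in \<open>L^2\<close> is half the mass because
  \<open>tail b 0 = (2 b + 3) tail2 b 0\<close>.\<close>

lemma action_height_tangent:
  assumes L: "L > 0" "L' > 0"
  shows "action L (height L) + (L'\<^sup>2 - L\<^sup>2) / 2 * mass L (height L) \<le> action L' (height L')"
proof -
  define x where "x = L'\<^sup>2 / L\<^sup>2"
  have x: "x > 0" using L by (simp add: x_def)
  have "1 + (2 * b + 3) / 2 * (x - 1) \<le> x powr ((2 * b + 3) / 2)"
    using b_gt by (intro powr_Bernoulli x) auto
  also have "x powr ((2 * b + 3) / 2) = L' powr (2 * b + 3) / L powr (2 * b + 3)"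
  proof -
    have "(z\<^sup>2) powr (c / 2) = z powr c" if "z > 0" for z c :: real
      using that by (simp add: powr_powr flip: powr_numeral)
    then show ?thesis unfolding x_def using L by (simp add: powr_divide)
  qed
  finally have "L powr (2 * b + 3) * (1 + (2 * b + 3) / 2 * (x - 1)) \<le> L' powr (2 * b + 3)"
    using L by (simp add: field_simps)
  moreover have "L powr (2 * b + 3) * (1 + (2 * b + 3) / 2 * (x - 1))
      = L powr (2 * b + 3) + (2 * b + 3) / 2 * L powr (2 * b + 1) * (L'\<^sup>2 - L\<^sup>2)"
  proof -
    have "L powr (2 * b + 3) = L powr (2 * b + 1) * L\<^sup>2"
      using L powr_add[of L "2 * b + 1" 2] by (simp add: algebra_simps)
    moreover have "L\<^sup>2 * (x - 1) = L'\<^sup>2 - L\<^sup>2" using L by (simp add: x_def field_simps)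
    ultimately show ?thesis by (simp add: distrib_left mult.assoc mult.left_commute)
  qed
  ultimately have le: "L powr (2 * b + 3) + (2 * b + 3) / 2 * L powr (2 * b + 1) * (L'\<^sup>2 - L\<^sup>2) \<le> L' powr (2 * b + 3)"
    by simp
  have pos: "0 \<le> A * tail2 b 0" using A_pos tail_pos[OF b_gt, of 0] b_gt by (simp add: tail2_0)
  have t0: "tail b 0 = tail2 b 0 * (2 * b + 3)" using b_gt by (simp add: tail2_0)
  have "action L (height L) + (L'\<^sup>2 - L\<^sup>2) / 2 * mass L (height L)
      = A * tail2 b 0 * (L powr (2 * b + 3) + (2 * b + 3) / 2 * L powr (2 * b + 1) * (L'\<^sup>2 - L\<^sup>2))"
  proof -
    define d c where "d = L'\<^sup>2 - L\<^sup>2" and "c = 2 * b + 3"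
    show ?thesis
      unfolding action_height[OF L(1)] mass_height[OF L(1)] t0 d_def[symmetric] c_def[symmetric]
      by (simp add: distrib_left mult_ac)
  qed
  also have "\<dots> \<le> A * tail2 b 0 * L' powr (2 * b + 3)"
    by (rule mult_left_mono[OF le pos])
  also have "\<dots> = action L' (height L')" using L by (simp add: action_height mult_ac)
  finally show ?thesis .
qed

text \<open>Concavity in \<open>L^2\<close>, inherited from the square root in \<open>slope\<close>:
  the gap between the two sides grows in \<open>t\<close> at the rate
  \<open>t (g' - g)^2 / (2 g)\<close>, where \<open>g\<close> and \<open>g'\<close> are the two
  slopes.\<close>

lemma action_tangent:
  assumes L: "L > 0" "L' > 0" and a: "0 \<le> a" "a \<le> height L" "a \<le> height L'"
  shows "action L' a \<le> action L a + (L'\<^sup>2 - L\<^sup>2) / 2 * mass L a"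
proof -
  define \<Delta> where "\<Delta> = (\<lambda>t. action L t + (L'\<^sup>2 - L\<^sup>2) / 2 * mass L t - action L' t)"
  have "\<Delta> 0 \<le> \<Delta> a"
  proof (rule DERIV_nonneg_imp_increasing_open[OF a(1)])
    fix t assume "0 < t" "t < a"
    then have t: "0 < t" "t < height L" "t < height L'" using a by auto
    let ?g = "slope L t" and ?g' = "slope L' t"
    have g: "0 < ?g" using slope_pos L t by simp
    have sq: "L'\<^sup>2 - L\<^sup>2 = ?g'\<^sup>2 - ?g\<^sup>2" using slope_sq[of L t] slope_sq[of L' t] L t by simp
    have "(\<Delta> has_real_derivative t * ?g + (L'\<^sup>2 - L\<^sup>2) / 2 * (t / ?g) - t * ?g') (at t)"
      unfolding \<Delta>_def
      by (intro DERIV_diff DERIV_add DERIV_cmult profile_derivatives L t)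
    moreover have "t * ?g + (L'\<^sup>2 - L\<^sup>2) / 2 * (t / ?g) - t * ?g' = t * (?g' - ?g)\<^sup>2 / (2 * ?g)"
      unfolding sq using g by (simp add: field_simps power2_eq_square)
    moreover have "0 \<le> t * (?g' - ?g)\<^sup>2 / (2 * ?g)" using g t by simp
    ultimately show "\<exists>d. (\<Delta> has_real_derivative d) (at t) \<and> 0 \<le> d" by auto
  next
    show "continuous_on {0..a} \<Delta>"
      unfolding \<Delta>_def using a
      by (intro continuous_intros continuous_on_subset[OF profile_continuous_on(1)[OF L(1)]]
         continuous_on_subset[OF profile_continuous_on(2)[OF L(1)]] continuous_on_subset[OF profile_continuous_on(2)[OF L(2)]]) auto
  qed
  then show ?thesis using L by (simp add: \<Delta>_def)
qed

text \<open>This is where \<open>p < 6\<close> enters: the action of a full soliton is a convex function of \<open>L\<^sup>2\<close>.\<close>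

lemma folded_action_tangent:
  assumes "L > 0" "L' > 0" "0 \<le> a" "a \<le> height L" "a \<le> height L'"
  shows "2 * action L (height L) - action L a + (L'\<^sup>2 - L\<^sup>2) / 2 * (2 * mass L (height L) - mass L a)
    \<le> 2 * action L' (height L') - action L' a"
proof -
  have "(L'\<^sup>2 - L\<^sup>2) / 2 * (2 * mass L (height L) - mass L a)
    = 2 * ((L'\<^sup>2 - L\<^sup>2) / 2 * mass L (height L)) - (L'\<^sup>2 - L\<^sup>2) / 2 * mass L a"
    by (simp add: right_diff_distrib)
  then show ?thesis
    using action_height_tangent[OF assms(1,2)] action_tangent[OF assms] by linarith
qed

end

section \<open>Solitons of prescribed mass\<close>

locale soliton_family = subcritical_exponent +
  fixes \<mu> :: real
  assumes \<mu>: "\<mu> > 0"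
begin

text \<open>The arc with parameter \<open>s = \<phi>'(0) / (L \<phi>(0))\<close> and mass \<open>\<mu>\<close> has frequency \<open>freq s\<close>, squared
  initial value \<open>start s\<close> and energy \<open>level s\<close> without the boundary term. It contains the peak of the
  soliton iff \<open>s \<ge> 0\<close>, and \<open>s = 1\<close> is the full soliton.\<close>

definition J :: "real \<Rightarrow> real" where "J s = tail b (- s)"
definition c :: real where "c = 1 / (2 * b + 1)"
definition freq :: "real \<Rightarrow> real" where "freq s = (\<mu> / A) powr c * J s powr (- c)"
definition start :: "real \<Rightarrow> real" where
  "start s = A * freq s powr (2 * b + 2) * (1 - s\<^sup>2) powr (b + 1) / (b + 1)"
definition level :: "real \<Rightarrow> real" where
  "level s = A * freq s powr (2 * b + 3) * tail2 b (- s) - (freq s)\<^sup>2 * \<mu> / 2"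

lemma c_pos: "c > 0" and c_times: "c * (2 * b + 1) = 1"
  using b_gt by (auto simp: c_def)

lemma J_pos: "-1 < s \<Longrightarrow> s \<le> 1 \<Longrightarrow> 0 < J s"
  unfolding J_def using tail_pos[OF b_gt, of "-s"] by simp

lemma J_continuous_on: "continuous_on {-1..1} J"
  unfolding J_def
  by (rule continuous_on_compose2[OF tail_continuous_on[OF b_gt]]) (auto intro!: continuous_intros)

lemma J_has_real_derivative:
  assumes "\<bar>s\<bar> < 1"
  shows "(J has_real_derivative wt b s) (at s)"
proof -
  have "(J has_real_derivative - wt b (- s) * - 1) (at s)"
    unfolding J_def[abs_def] using assms
    by (intro DERIV_chain2[OF tail_has_real_derivative[OF b_gt]]) (auto intro!: derivative_eq_intros)
  then show ?thesis by (simp add: wt_minus)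
qed

lemma freq_pos: "-1 < s \<Longrightarrow> s \<le> 1 \<Longrightarrow> 0 < freq s"
  using \<mu> A_pos J_pos[of s] by (simp add: freq_def)

lemma freq_eq: "-1 < s \<Longrightarrow> s \<le> 1 \<Longrightarrow> freq s = (\<mu> / (A * J s)) powr c"
  using \<mu> A_pos J_pos[of s] by (simp add: freq_def powr_divide powr_mult powr_minus divide_simps)

lemma freq_mass:
  assumes "-1 < s" "s \<le> 1"
  shows "A * freq s powr (2 * b + 1) * J s = \<mu>"
proof -
  have "freq s powr (2 * b + 1) = \<mu> / (A * J s)"
    using \<mu> A_pos J_pos[OF assms] c_times by (simp add: freq_eq[OF assms] powr_powr)
  then show ?thesis using A_pos J_pos[OF assms] by simp
qed

text \<open>The mass constraint removes the noninteger powers of \<open>freq\<close>, which leaves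
  \<open>start\<close> and \<open>level\<close> in a form that is convenient to
  differentiate.\<close>

lemma freq_powr:
  assumes "-1 < s" "s \<le> 1"
  shows "A * freq s powr (2 * b + 1) = \<mu> / J s"
    "A * freq s powr (2 * b + 2) = \<mu> * freq s / J s"
    "A * freq s powr (2 * b + 3) = \<mu> * (freq s)\<^sup>2 / J s"
proof -
  have L: "freq s > 0" using freq_pos assms .
  show 1: "A * freq s powr (2 * b + 1) = \<mu> / J s"
    using freq_mass[OF assms] J_pos[OF assms] by (simp add: field_simps)
  have "freq s powr (2 * b + 2) = freq s powr (2 * b + 1) * freq s"
    using L powr_add[of "freq s" "2 * b + 1" 1] by (simp add: algebra_simps)
  then show "A * freq s powr (2 * b + 2) = \<mu> * freq s / J s"
    using 1 by (metis mult.assoc times_divide_eq_left)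
  have "freq s powr (2 * b + 3) = freq s powr (2 * b + 1) * (freq s)\<^sup>2"
    using L powr_add[of "freq s" "2 * b + 1" 2] by (simp add: algebra_simps)
  then show "A * freq s powr (2 * b + 3) = \<mu> * (freq s)\<^sup>2 / J s"
    using 1 by (metis mult.assoc times_divide_eq_left)
qed

lemma freq_continuous_on: "continuous_on {-1<..1} freq"
  unfolding freq_def
proof -
  have "J s \<noteq> 0" if "s \<in> {-1<..1}" for s using J_pos[of s] that by auto
  then show "continuous_on {-1<..1} (\<lambda>s. (\<mu> / A) powr c * J s powr (- c))"
    by (intro continuous_intros continuous_on_subset[OF J_continuous_on]) auto
qed

lemma freq_nonzero: "s \<in> {-1<..1} \<Longrightarrow> freq s \<noteq> 0"
  using freq_pos[of s] by auto

lemma start_eq: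
  assumes "-1 < s" "s \<le> 1"
  shows "start s = \<mu> * freq s * (1 - s\<^sup>2) powr (b + 1) / ((b + 1) * J s)"
  unfolding start_def freq_powr(2)[OF assms] by (simp add: mult.commute)

lemma level_eq:
  assumes "-1 < s" "s \<le> 1"
  shows "level s = \<mu> * (freq s)\<^sup>2 * (1 - s * (1 - s\<^sup>2) powr (b + 1) / J s) / (2 * b + 3) - (freq s)\<^sup>2 * \<mu> / 2"
  using J_pos[OF assms] unfolding level_def freq_powr(3)[OF assms] tail2_def J_def[symmetric]
  by (simp add: divide_simps right_diff_distrib)

lemma start_1 [simp]: "start 1 = 0"
  by (simp add: start_def)

lemma start_pos: "\<bar>s\<bar> < 1 \<Longrightarrow> 0 < start s"
  using \<mu> b_gt freq_pos[of s] J_pos[of s] one_minus_square_pos[of s] by (simp add: start_eq)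

lemma start_continuous_on: "continuous_on {-1<..1} start"
proof -
  have "(1 - s\<^sup>2) \<ge> 0" if "s \<in> {-1<..1}" for s :: real using that by (simp add: abs_square_le_1 abs_le_iff)
  then show ?thesis
    unfolding start_def using b_gt freq_nonzero
    by (intro continuous_intros freq_continuous_on continuous_on_powr') auto
qed

lemma level_continuous_on: "continuous_on {-1<..1} level"
  unfolding level_def using freq_nonzero
  by (intro continuous_intros freq_continuous_on
       continuous_on_compose2[OF tail2_continuous_on[OF b_gt], of "{-1<..1}" uminus]) auto

lemma freq_has_real_derivative:
  assumes "\<bar>s\<bar> < 1"
  shows "(freq has_real_derivative - c * freq s * wt b s / J s) (at s)"
proof -
  have J: "J s > 0" using J_pos[of s] assms by simp
  have "((\<lambda>s. J s powr (- c)) has_real_derivative (- c) * J s powr (- c - 1) * wt b s) (at s)"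
    using J by (auto intro!: derivative_eq_intros J_has_real_derivative[OF assms])
  from DERIV_cmult[OF this, of "(\<mu> / A) powr c"] show ?thesis
    unfolding freq_def[abs_def]
    by (rule DERIV_cong) (use J in \<open>simp add: powr_diff\<close>)
qed

lemma bump_has_real_derivative:
  assumes "\<bar>s\<bar> < 1"
  shows "((\<lambda>s. (1 - s\<^sup>2) powr (b + 1)) has_real_derivative - (2 * (b + 1) * s * wt b s)) (at s)"
  using one_minus_square_pos[OF assms] by (auto intro!: derivative_eq_intros simp: wt_def)

text \<open>Factored so that the sign depends on the last bracket alone.\<close>

definition start' :: "real \<Rightarrow> real" where
  "start' s = - (2 * \<mu> * freq s * wt b s / J s * (c * (1 - s\<^sup>2) powr (b + 1) / J s + s))"

lemma start_has_real_derivative: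
  assumes s: "\<bar>s\<bar> < 1"
  shows "(start has_real_derivative start' s) (at s)"
proof -
  define Y L w j where "Y = (1 - s\<^sup>2) powr (b + 1)" and "L = freq s" and "w = wt b s" and "j = J s"
  have j: "j > 0" using J_pos[of s] s by (simp add: j_def)
  have b1: "b + 1 > 0" using b_gt by simp
  have cb: "1 + c = 2 * (b + 1) * c" using c_times by (simp add: algebra_simps)
  have "((\<lambda>s. \<mu> * freq s * (1 - s\<^sup>2) powr (b + 1) / ((b + 1) * J s)) has_real_derivative
     ((\<mu> * (- c * L * w / j) * Y + - (2 * (b + 1) * s * w) * (\<mu> * L)) * ((b + 1) * j) - \<mu> * L * Y * ((b + 1) * w))
       / (((b + 1) * j) * ((b + 1) * j))) (at s)"
    unfolding Y_def L_def w_def j_def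
    by (intro DERIV_divide DERIV_mult DERIV_cmult freq_has_real_derivative bump_has_real_derivative
          J_has_real_derivative s) (use j b1 in \<open>auto simp: j_def\<close>)
  moreover have "((\<mu> * (- c * L * w / j) * Y + - (2 * (b + 1) * s * w) * (\<mu> * L)) * ((b + 1) * j) - \<mu> * L * Y * ((b + 1) * w))
       / (((b + 1) * j) * ((b + 1) * j)) = start' s"
  proof -
    have "((\<mu> * (- c * L * w / j) * Y + - (2 * (b + 1) * s * w) * (\<mu> * L)) * ((b + 1) * j) - \<mu> * L * Y * ((b + 1) * w))
      = - (b + 1) * (\<mu> * L * w) * ((1 + c) * Y + 2 * (b + 1) * s * j)"
      using j by (simp add: field_simps)
    also have "\<dots> = - (2 * \<mu> * L * w / j * (c * Y / j + s)) * (((b + 1) * j) * ((b + 1) * j))"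
      unfolding cb using j by (simp add: field_simps)
    finally show ?thesis using j b1 unfolding start'_def Y_def L_def w_def j_def by simp
  qed
  ultimately have d: "((\<lambda>s. \<mu> * freq s * (1 - s\<^sup>2) powr (b + 1) / ((b + 1) * J s)) has_real_derivative start' s) (at s)"
    by simp
  have "eventually (\<lambda>t. t \<in> {-1<..<1}) (nhds s)"
    using s by (intro eventually_nhds_in_open) auto
  then have "eventually (\<lambda>t. start t = \<mu> * freq t * (1 - t\<^sup>2) powr (b + 1) / ((b + 1) * J t)) (nhds s)"
    by eventually_elim (rule start_eq, auto)
  from DERIV_cong_ev[OF refl this refl] d show ?thesis by blast
qed

text \<open>First variation: at fixed mass the multiplier term drops out and only the boundary term
  \<open>- \<phi>'(0) d\<phi>(0)\<close> survives, which is
  \<open>- (s L / 2) d(\<phi>(0)^2)\<close>. The proof checks this on the closed forms.\<close>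

lemma level_has_real_derivative:
  assumes s: "\<bar>s\<bar> < 1"
  shows "(level has_real_derivative - (s * freq s / 2) * start' s) (at s)"
proof -
  define Y L w j B where "Y = (1 - s\<^sup>2) powr (b + 1)" and "L = freq s" and "w = wt b s" and "j = J s"
    and "B = 2 * b + 3"
  have j: "j > 0" using J_pos[of s] s by (simp add: j_def)
  have B: "B > 0" using b_gt by (simp add: B_def)
  have wY: "w * (1 - s\<^sup>2) = Y" using one_minus_square_pos[OF s] by (simp add: w_def Y_def wt_def powr_add)
  have DB: "(1 + 2 * c) = c * B" using c_times by (simp add: B_def algebra_simps)
  have cB: "c * (B - 2) = 1" using c_times by (simp add: B_def algebra_simps)
  have d1: "((\<lambda>s. (freq s)\<^sup>2) has_real_derivative 2 * L * (- c * L * w / j)) (at s)"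
    unfolding L_def w_def j_def
    by (rule DERIV_cong[OF DERIV_power[OF freq_has_real_derivative[OF s]]]) simp
  have d2: "((\<lambda>s. s * (1 - s\<^sup>2) powr (b + 1) / J s) has_real_derivative
     ((1 * Y + - (2 * (b + 1) * s * w) * s) * j - s * Y * w) / (j * j)) (at s)"
    unfolding Y_def w_def j_def
    by (intro DERIV_divide DERIV_mult DERIV_ident bump_has_real_derivative J_has_real_derivative s)
      (use j in \<open>auto simp: j_def\<close>)
  have "((\<lambda>s. \<mu> * (freq s)\<^sup>2 * (1 - s * (1 - s\<^sup>2) powr (b + 1) / J s) / (2 * b + 3) - (freq s)\<^sup>2 * \<mu> / 2)
     has_real_derivative
     (\<mu> * (2 * L * (- c * L * w / j)) * (1 - s * Y / j) +
       (0 - ((1 * Y + - (2 * (b + 1) * s * w) * s) * j - s * Y * w) / (j * j)) * (\<mu> * L\<^sup>2)) / (2 * b + 3)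
      - 2 * L * (- c * L * w / j) * \<mu> / 2) (at s)"
    by (rule DERIV_cong[OF DERIV_diff[OF DERIV_cdivide[OF DERIV_mult[OF DERIV_cmult[OF d1, of \<mu>]
          DERIV_diff[OF DERIV_const[of 1] d2]], of "2 * b + 3"] DERIV_cdivide[OF DERIV_cmult_right[OF d1, of \<mu>], of 2]]])
       (simp add: Y_def L_def w_def j_def)
  moreover have "(\<mu> * (2 * L * (- c * L * w / j)) * (1 - s * Y / j) +
       (0 - ((1 * Y + - (2 * (b + 1) * s * w) * s) * j - s * Y * w) / (j * j)) * (\<mu> * L\<^sup>2)) / (2 * b + 3)
      - 2 * L * (- c * L * w / j) * \<mu> / 2 = - (s * freq s / 2) * start' s"
  proof -
    have bB: "2 * (b + 1) = B - 1" by (simp add: B_def)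
    have "(\<mu> * (2 * L * (- c * L * w / j)) * (1 - s * Y / j) +
       (0 - ((1 * Y + - (2 * (b + 1) * s * w) * s) * j - s * Y * w) / (j * j)) * (\<mu> * L\<^sup>2))
      = \<mu> * L\<^sup>2 * w / j * (- 2 * c + (1 + 2 * c) * (s * Y / j) - (1 - s\<^sup>2) + (B - 1) * s\<^sup>2)"
      unfolding bB wY[symmetric] using j by (simp add: field_simps power2_eq_square)
    also have "\<dots> = \<mu> * L\<^sup>2 * w / j * (B * (c * s * Y / j + s\<^sup>2 - c))"
    proof -
      have "2 * c + 1 = c * B" using DB by simp
      then have "- 2 * c + (1 + 2 * c) * (s * Y / j) - (1 - s\<^sup>2) + (B - 1) * s\<^sup>2 = B * (c * s * Y / j + s\<^sup>2 - c)"
        unfolding DB by (simp add: algebra_simps)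
      then show ?thesis by simp
    qed
    finally have "(\<mu> * (2 * L * (- c * L * w / j)) * (1 - s * Y / j) +
       (0 - ((1 * Y + - (2 * (b + 1) * s * w) * s) * j - s * Y * w) / (j * j)) * (\<mu> * L\<^sup>2)) / (2 * b + 3)
       = \<mu> * L\<^sup>2 * w / j * (c * s * Y / j + s\<^sup>2 - c)"
      using B by (simp add: B_def)
    moreover have "\<mu> * L\<^sup>2 * w / j * (c * s * Y / j + s\<^sup>2 - c) - 2 * L * (- c * L * w / j) * \<mu> / 2
       = s * L * (\<mu> * L * w / j * (c * Y / j + s))"
      using j by (simp add: field_simps power2_eq_square)
    ultimately show ?thesis
      unfolding start'_def Y_def[symmetric] L_def[symmetric] w_def[symmetric] j_def[symmetric] by simp
  qed
  ultimately have d: "((\<lambda>s. \<mu> * (freq s)\<^sup>2 * (1 - s * (1 - s\<^sup>2) powr (b + 1) / J s) / (2 * b + 3) - (freq s)\<^sup>2 * \<mu> / 2)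
     has_real_derivative - (s * freq s / 2) * start' s) (at s)"
    by simp
  have "eventually (\<lambda>t. t \<in> {-1<..<1}) (nhds s)"
    using s by (intro eventually_nhds_in_open) auto
  then have "eventually (\<lambda>t. level t = \<mu> * (freq t)\<^sup>2 * (1 - t * (1 - t\<^sup>2) powr (b + 1) / J t) / (2 * b + 3) - (freq t)\<^sup>2 * \<mu> / 2) (nhds s)"
    by eventually_elim (rule level_eq, auto)
  from DERIV_cong_ev[OF refl this refl] d show ?thesis by blast
qed

lemma J_lower_bound:
  assumes "-1 < s" "s \<le> 0"
  shows "- s * J s \<le> (1 - s\<^sup>2) powr (b + 1) / (2 * (b + 1))"
  using tail_lower_bound[OF b_gt, of "-s"] assms by (simp add: J_def)

text \<open>Only \<open>s < 0\<close> is delicate: there \<open>- s J s\<close> is at most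
  \<open>(1 - s^2)^(b + 1) / (2 b + 2)\<close>, and the competing term has the smaller denominator
  \<open>2 b + 1\<close>.\<close>

lemma start'_neg:
  assumes s: "\<bar>s\<bar> < 1"
  shows "start' s < 0"
proof -
  define Y where "Y = (1 - s\<^sup>2) powr (b + 1)"
  have Y: "Y > 0" using one_minus_square_pos[OF s] by (simp add: Y_def)
  have J: "J s > 0" using J_pos[of s] s by simp
  have "c * Y / J s + s > 0"
  proof (cases "s \<ge> 0")
    case True
    then show ?thesis using c_pos Y J by (simp add: add_pos_nonneg)
  next
    case False
    then have "- s * J s \<le> Y / (2 * (b + 1))" using J_lower_bound[of s] s by (simp add: Y_def)
    also have "\<dots> < Y / (2 * b + 1)" using Y b_gt by (intro divide_strict_left_mono) auto
    also have "\<dots> = c * Y" by (simp add: c_def)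
    finally show ?thesis using J by (simp add: field_simps)
  qed
  then have "2 * \<mu> * freq s * wt b s / J s * (c * Y / J s + s) > 0"
    using \<mu> freq_pos[of s] wt_pos[OF s] J s by simp
  then show ?thesis by (simp add: start'_def Y_def)
qed

text \<open>As \<open>s\<close> tends to \<open>-1\<close> the normalised mass \<open>J s\<close>
  vanishes, so keeping the mass \<open>\<mu>\<close> forces the frequency to infinity. The bound
  \<open>- 1 / 2\<close> keeps \<open>s\<close> away from \<open>0\<close> in the
  applications.\<close>

lemma freq_unbounded: "\<exists>s0. -1 < s0 \<and> s0 < -1 / 2 \<and> (\<forall>s. -1 < s \<and> s \<le> s0 \<longrightarrow> K < freq s)"
proof -
  define K' where "K' = max K 1"
  \<comment> \<open>The value of \<open>J\<close> at which the frequency would be exactly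
    \<open>K'\<close>.\<close>
  define \<eta> where "\<eta> = \<mu> / (A * K' powr (2 * b + 1))"
  have \<eta>: "\<eta> > 0" using \<mu> A_pos by (simp add: \<eta>_def K'_def)
  have "J (-1) = 0" by (simp add: J_def)
  moreover have "\<exists>d>0. \<forall>s\<in>{-1..1}. dist s (-1) < d \<longrightarrow> dist (J s) (J (-1)) < \<eta>"
    by (rule J_continuous_on[unfolded continuous_on_iff, rule_format, OF _ \<eta>]) simp
  ultimately obtain d where d: "d > 0" "\<forall>s\<in>{-1..1}. dist s (-1) < d \<longrightarrow> dist (J s) 0 < \<eta>"
    by auto
  define s0 where "s0 = -1 + min (d / 2) (1 / 4)"
  show ?thesis
  proof (intro exI[of _ s0] conjI allI impI)
    fix s assume s: "-1 < s \<and> s \<le> s0"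
    then have s1: "-1 < s" "s \<le> 1" "s \<in> {-1..1}" "dist s (-1) < d" using d by (auto simp: s0_def dist_real_def)
    have "J s < \<eta>" using d(2)[rule_format, OF s1(3,4)] by (simp add: dist_real_def)
    then have "A * J s < \<mu> / K' powr (2 * b + 1)"
      using A_pos by (simp add: \<eta>_def field_simps K'_def)
    then have "K' powr (2 * b + 1) < \<mu> / (A * J s)"
      using A_pos J_pos[OF s1(1,2)] by (simp add: field_simps K'_def)
    then have "(K' powr (2 * b + 1)) powr c < freq s"
      unfolding freq_eq[OF s1(1,2)] by (intro powr_less_mono2 c_pos) auto
    moreover have "(K' powr (2 * b + 1)) powr c = K'"
      unfolding powr_powr mult.commute[of _ c] c_times by (simp add: K'_def)
    ultimately show "K < freq s" by (simp add: K'_def)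
  qed (use d in \<open>auto simp: s0_def\<close>)
qed

text \<open>Supplies an arc with the same boundary value as a given competitor. The function
  \<open>start\<close> vanishes at \<open>1\<close> and is at least \<open>\<mu> freq s0\<close> at
  a suitable \<open>s0\<close> near \<open>-1\<close>, so the intermediate value theorem
  applies.\<close>

lemma start_surj:
  assumes "0 \<le> y"
  shows "\<exists>s. -1 < s \<and> s \<le> 1 \<and> start s = y"
proof -
  obtain s0 where s0: "-1 < s0" "s0 < -1 / 2" "\<And>s. -1 < s \<and> s \<le> s0 \<Longrightarrow> y / \<mu> < freq s"
    using freq_unbounded by metis
  define Y where "Y = (1 - s0\<^sup>2) powr (b + 1)"
  have J: "J s0 > 0" using J_pos s0 by simp
  have L: "y / \<mu> < freq s0" using s0(1) s0(3)[of s0] by simp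
  then have yL: "y \<le> \<mu> * freq s0" using \<mu> by (simp add: field_simps)
  have "J s0 \<le> - 2 * s0 * J s0" using s0 J mult_right_mono[of 1 "- 2 * s0" "J s0"] by simp
  also have "\<dots> \<le> Y / (b + 1)" using J_lower_bound[of s0] s0 b_gt by (simp add: Y_def field_simps)
  finally have "(b + 1) * J s0 \<le> Y" using b_gt by (simp add: field_simps)
  moreover have "0 < (b + 1) * J s0" using J b_gt by simp
  ultimately have "1 \<le> Y / ((b + 1) * J s0)" by simp
  then have "\<mu> * freq s0 * 1 \<le> \<mu> * freq s0 * (Y / ((b + 1) * J s0))"
    using \<mu> freq_pos[of s0] s0 by (intro mult_left_mono) auto
  also have "\<dots> = start s0" using s0 by (simp add: start_eq Y_def)
  finally have "y \<le> start s0" using yL by simp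
  moreover have "continuous_on {s0..1} start"
    by (rule continuous_on_subset[OF start_continuous_on]) (use s0 in auto)
  ultimately have "\<exists>s\<ge>s0. s \<le> 1 \<and> start s = y"
    using assms s0 by (intro IVT2') auto
  then obtain s where "s0 \<le> s" "s \<le> 1" "start s = y" by blast
  then show ?thesis using s0(1) by (intro exI[of _ s]) auto
qed

end

context soliton_family
begin

definition curve :: "real \<Rightarrow> real \<Rightarrow> real" where
  "curve \<alpha> s = level s + \<alpha> / 2 * start s"

lemma curve_1 [simp]: "curve \<alpha> 1 = level 1"
  by (simp add: curve_def)

lemma curve_continuous_on: "continuous_on {-1<..1} (curve \<alpha>)"
  unfolding curve_def by (intro continuous_intros level_continuous_on start_continuous_on)

text \<open>As \<open>s freq s\<close> is \<open>\<phi>'(0) / \<phi>(0)\<close>, the critical arcs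
  are those with \<open>\<phi>'(0) = \<alpha> \<phi>(0)\<close>, the natural boundary condition of
  the energy.\<close>

lemma curve_has_real_derivative:
  assumes "\<bar>s\<bar> < 1"
  shows "(curve \<alpha> has_real_derivative (\<alpha> - s * freq s) / 2 * start' s) (at s)"
  unfolding curve_def[abs_def]
  by (rule DERIV_cong[OF DERIV_add[OF level_has_real_derivative[OF assms] DERIV_cmult[OF start_has_real_derivative[OF assms]]]])
     (simp add: field_simps)

lemma curve_decreasing:
  assumes "-1 < x" "x < y" "y \<le> 1" and lt: "\<And>t. x < t \<Longrightarrow> t < y \<Longrightarrow> t * freq t < \<alpha>"
  shows "curve \<alpha> y < curve \<alpha> x"
proof (rule DERIV_neg_imp_decreasing_open[of x y "curve \<alpha>"])
  fix t assume t: "x < t" "t < y"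
  then have t1: "\<bar>t\<bar> < 1" using assms by auto
  have "(\<alpha> - t * freq t) / 2 * start' t < 0"
    using lt[OF t] start'_neg[OF t1] by (intro mult_pos_neg) auto
  then show "\<exists>d. (curve \<alpha> has_real_derivative d) (at t) \<and> d < 0"
    using curve_has_real_derivative[OF t1] by blast
qed (use assms in \<open>auto intro: continuous_on_subset[OF curve_continuous_on]\<close>)

lemma curve_increasing:
  assumes "-1 < x" "x < y" "y \<le> 1" and lt: "\<And>t. x < t \<Longrightarrow> t < y \<Longrightarrow> \<alpha> < t * freq t"
  shows "curve \<alpha> x < curve \<alpha> y"
proof (rule DERIV_pos_imp_increasing_open[of x y "curve \<alpha>"])
  fix t assume t: "x < t" "t < y"
  then have t1: "\<bar>t\<bar> < 1" using assms by auto
  have "(\<alpha> - t * freq t) / 2 * start' t > 0"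
    using lt[OF t] start'_neg[OF t1] by (intro mult_neg_neg) auto
  then show "\<exists>d. (curve \<alpha> has_real_derivative d) (at t) \<and> 0 < d"
    using curve_has_real_derivative[OF t1] by blast
qed (use assms in \<open>auto intro: continuous_on_subset[OF curve_continuous_on]\<close>)

lemma tail_mean_value:
  assumes "-1 \<le> x" "x < y" "y \<le> 1"
  shows "\<exists>z. x < z \<and> z < y \<and> tail b x - tail b y = (y - x) * wt b z"
proof -
  have "continuous_on {x..y} (tail b)"
    by (rule continuous_on_subset[OF tail_continuous_on[OF b_gt]]) (use assms in auto)
  moreover have D: "(tail b has_real_derivative - wt b t) (at t)" if "x < t" "t < y" for t
    using that assms by (intro tail_has_real_derivative[OF b_gt]) auto
  moreover have "tail b differentiable (at t)" if "x < t" "t < y" for t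
    using D[OF that] by (auto simp: real_differentiable_def)
  ultimately obtain l z where z: "x < z" "z < y" "(tail b has_real_derivative l) (at z)" "tail b y - tail b x = (y - x) * l"
    using MVT[OF assms(2)] by blast
  have "l = - wt b z" using DERIV_unique[OF z(3) D[OF z(1,2)]] .
  then show ?thesis using z by (intro exI[of _ z]) (auto simp: algebra_simps)
qed

lemma J_eq: "s \<in> {-1..1} \<Longrightarrow> J s = 2 * tail b 0 - tail b s"
  unfolding J_def by (rule tail_minus[OF b_gt])

lemma J_1: "J 1 = 2 * tail b 0"
  by (simp add: J_eq)

lemma scaled_freq:
  assumes "0 < s" "s \<le> 1"
  shows "(\<mu> / (A * (s * J 1))) powr c = s powr (- c) * freq 1"
  using assms \<mu> A_pos J_pos[of 1] by (simp add: freq_def powr_divide powr_mult powr_minus divide_simps)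

lemma times_freq_less:
  assumes b: "b \<ge> 0" and s: "\<bar>s\<bar> < 1"
  shows "s * freq s < freq 1"
proof (cases "s \<le> 0")
  case True
  then have "s * freq s \<le> 0" using freq_pos[of s] s by (simp add: mult_nonpos_nonneg)
  then show ?thesis using freq_pos[of 1] by simp
next
  case False
  then have s: "0 < s" "s < 1" using s by auto
  obtain z where z: "s < z" "z < 1" "tail b s = (1 - s) * wt b z"
    using tail_mean_value[of s 1] s by auto
  obtain z' where z': "0 < z'" "z' < s" "tail b 0 - tail b s = s * wt b z'"
    using tail_mean_value[of 0 s] s by auto
  \<comment> \<open>For \<open>b \<ge> 0\<close> the weight decreases on \<open>[0, 1]\<close>, so
    its mean over \<open>[s, 1]\<close> is at most its mean over \<open>[0, s]\<close>. This leads
    to \<open>s J 1 < J s\<close>.\<close>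
  have "wt b z \<le> wt b z'"
    unfolding wt_def using z z' s b by (intro powr_mono2) (auto simp: abs_square_le_1 power_mono)
  then have "(1 - s) * (s * wt b z) \<le> (1 - s) * (s * wt b z')" using s by (intro mult_left_mono) auto
  then have "s * tail b s \<le> (1 - s) * (tail b 0 - tail b s)" using z(3) z'(3) by (simp add: mult_ac)
  then have "tail b s \<le> (1 - s) * tail b 0" by (simp add: algebra_simps)
  also have "\<dots> < (1 - s) * (2 * tail b 0)" using s tail_pos[OF b_gt, of 0] by simp
  finally have "s * J 1 < J s" using s J_1 by (simp add: J_eq algebra_simps)
  then have "\<mu> / (A * J s) < \<mu> / (A * (s * J 1))"
    using \<mu> A_pos s J_pos[of 1] J_pos[of s] by (intro divide_strict_left_mono) auto
  then have "freq s < s powr (- c) * freq 1"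
    unfolding freq_eq[of s, OF order.strict_trans[OF _ s(1)] less_imp_le[OF s(2)], simplified] scaled_freq[OF s(1) less_imp_le[OF s(2)], symmetric]
    using \<mu> A_pos J_pos[of s] s by (intro powr_less_mono2 c_pos) auto
  then have "s * freq s < s * (s powr (- c) * freq 1)" using s by simp
  also have "s * (s powr (- c) * freq 1) = s powr (1 - c) * freq 1"
    using s powr_add[of s 1 "- c"] by simp
  also have "\<dots> \<le> 1 * freq 1"
  proof (rule mult_right_mono)
    have "c \<le> 1" using b by (simp add: c_def)
    then show "s powr (1 - c) \<le> 1" using s powr_le1[of "1 - c" s] by simp
  qed (use freq_pos[of 1] in simp)
  finally show ?thesis by simp
qed

lemma times_freq_greater:
  assumes b: "b < 0"
  shows "\<exists>s0. 0 \<le> s0 \<and> s0 < 1 \<and> (\<forall>s. s0 < s \<and> s < 1 \<longrightarrow> freq 1 < s * freq s)"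
proof -
  \<comment> \<open>Since \<open>b < 0\<close>, the weight exceeds
    \<open>\<eta> powr b = J 1\<close> wherever \<open>1 - z^2 < \<eta>\<close>. The halving in
    \<open>s0\<close> comes from \<open>1 - z^2 < 2 (1 - z)\<close>. The outcome is
    \<open>J s < s J 1\<close>, opposite to the case \<open>b \<ge> 0\<close>.\<close>
  define \<eta> where "\<eta> = J 1 powr (1 / b)"
  have \<eta>: "\<eta> > 0" using J_pos[of 1] by (simp add: \<eta>_def)
  define s0 where "s0 = max 0 (1 - \<eta> / 2)"
  have "freq 1 < s * freq s" if s: "s0 < s" "s < 1" for s
  proof -
    have s01: "0 < s" using s by (simp add: s0_def)
    obtain z where z: "s < z" "z < 1" "tail b s = (1 - s) * wt b z"
      using tail_mean_value[of s 1] s s01 by auto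
    have "1 - z\<^sup>2 = (1 - z) * (1 + z)" by (simp add: power2_eq_square algebra_simps)
    also have "\<dots> < (1 - z) * 2" using z by (intro mult_strict_left_mono) auto
    also have "\<dots> < \<eta>" using s z by (simp add: s0_def)
    finally have "1 - z\<^sup>2 < \<eta>" .
    moreover have "0 < 1 - z\<^sup>2" using z s01 one_minus_square_pos[of z] by simp
    ultimately have "\<eta> powr b < wt b z"
      unfolding wt_def using b by (intro powr_less_mono2_neg) auto
    moreover have "\<eta> powr b = J 1" using b J_pos[of 1] by (simp add: \<eta>_def powr_powr)
    ultimately have "(1 - s) * J 1 < tail b s" using z(3) s by simp
    then have "J s < s * J 1" using s s01 J_1 by (simp add: J_eq algebra_simps)
    then have "\<mu> / (A * (s * J 1)) < \<mu> / (A * J s)"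
      using \<mu> A_pos s s01 J_pos[of 1] J_pos[of s] by (intro divide_strict_left_mono) auto
    then have "(\<mu> / (A * (s * J 1))) powr c < (\<mu> / (A * J s)) powr c"
      using \<mu> A_pos J_pos[of 1] s01 by (intro powr_less_mono2 c_pos) auto
    then have "s powr (- c) * freq 1 < freq s"
      using scaled_freq[of s] freq_eq[of s] s s01 by simp
    then have "s * (s powr (- c) * freq 1) < s * freq s" using s01 by simp
    moreover have "s * (s powr (- c) * freq 1) = s powr (1 - c) * freq 1"
      using s01 powr_add[of s 1 "- c"] by simp
    moreover have "1 * freq 1 \<le> s powr (1 - c) * freq 1"
    proof (rule mult_right_mono)
      have "1 \<le> c" using b b_gt by (simp add: c_def)
      then show "1 \<le> s powr (1 - c)" using s s01 powr_mono'[of "1 - c" 0 s] by simp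
    qed (use freq_pos[of 1] in simp)
    ultimately show ?thesis by simp
  qed
  then show ?thesis using \<eta> by (intro exI[of _ s0]) (auto simp: s0_def)
qed

lemma times_freq_near_1:
  assumes "\<epsilon> > 0"
  shows "\<exists>s0. 0 \<le> s0 \<and> s0 < 1 \<and> (\<forall>s. s0 < s \<and> s < 1 \<longrightarrow> \<bar>s * freq s - freq 1\<bar> < \<epsilon>)"
proof -
  have C: "continuous_on {-1<..1} (\<lambda>s. s * freq s)"
    by (intro continuous_intros freq_continuous_on)
  have "\<exists>d>0. \<forall>s\<in>{-1<..1}. dist s 1 < d \<longrightarrow> dist (s * freq s) (1 * freq 1) < \<epsilon>"
    by (rule C[unfolded continuous_on_iff, rule_format, OF _ assms]) simp
  then obtain d where d: "d > 0" "\<forall>s\<in>{-1<..1}. dist s 1 < d \<longrightarrow> dist (s * freq s) (1 * freq 1) < \<epsilon>"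
    by blast
  show ?thesis
  proof (intro exI[of _ "max 0 (1 - d)"] conjI allI impI)
    fix s assume "max 0 (1 - d) < s \<and> s < 1"
    then have "s \<in> {-1<..1}" "dist s 1 < d" by (auto simp: dist_real_def)
    with d(2) show "\<bar>s * freq s - freq 1\<bar> < \<epsilon>" by (auto simp: dist_real_def)
  qed (use d in auto)
qed

text \<open>For \<open>\<alpha> \<ge> freq 1\<close> the curve decreases all the way to its end,
  hence stays above it; for smaller \<open>\<alpha>\<close> it increases just before the
  end.\<close>

lemma curve_below_end_iff_le_4:
  assumes "p \<le> 4"
  shows "(\<exists>s. \<bar>s\<bar> < 1 \<and> curve \<alpha> s \<le> level 1) \<longleftrightarrow> \<alpha> < freq 1"
proof
  have b: "b \<ge> 0" using assms p by (simp add: b_def)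
  assume "\<exists>s. \<bar>s\<bar> < 1 \<and> curve \<alpha> s \<le> level 1"
  then obtain s where s: "\<bar>s\<bar> < 1" "curve \<alpha> s \<le> level 1" by blast
  show "\<alpha> < freq 1"
  proof (rule ccontr)
    assume "\<not> \<alpha> < freq 1"
    have "curve \<alpha> 1 < curve \<alpha> s"
    proof (rule curve_decreasing)
      fix t assume "s < t" "t < 1"
      then have "t * freq t < freq 1" using s by (intro times_freq_less[OF b]) auto
      then show "t * freq t < \<alpha>" using \<open>\<not> \<alpha> < freq 1\<close> by simp
    qed (use s in auto)
    then show False using s by simp
  qed
next
  assume "\<alpha> < freq 1"
  then obtain s0 where s0: "0 \<le> s0" "s0 < 1" "\<And>s. s0 < s \<and> s < 1 \<Longrightarrow> \<bar>s * freq s - freq 1\<bar> < freq 1 - \<alpha>"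
    using times_freq_near_1[of "freq 1 - \<alpha>"] by auto
  have "curve \<alpha> s0 < curve \<alpha> 1"
  proof (rule curve_increasing)
    fix t assume "s0 < t" "t < 1"
    then show "\<alpha> < t * freq t" using s0(3)[of t] by auto
  qed (use s0 in auto)
  then show "\<exists>s. \<bar>s\<bar> < 1 \<and> curve \<alpha> s \<le> level 1" using s0 by (intro exI[of _ s0]) auto
qed

lemma curve_below_end_iff_gt_4:
  assumes "p > 4"
  shows "\<exists>h>freq 1. \<forall>\<alpha>. (\<exists>s. \<bar>s\<bar> < 1 \<and> curve \<alpha> s \<le> level 1) \<longleftrightarrow> \<alpha> \<le> h"
proof -
  have b: "b < 0" using assms by (simp add: b_def divide_neg_pos)
  \<comment> \<open>The largest \<open>\<alpha>\<close> for which the arc \<open>s\<close> does not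
    exceed the end. The threshold is the maximum of \<open>R\<close>, and the work is to show that
    it is attained inside \<open>(-1, 1)\<close>; attainment is what makes the final inequality
    non-strict.\<close>
  define R where "R = (\<lambda>s. 2 * (level 1 - level s) / start s)"
  have R: "curve \<alpha> s \<le> level 1 \<longleftrightarrow> \<alpha> \<le> R s" if "\<bar>s\<bar> < 1" for \<alpha> s
    using start_pos[OF that] by (simp add: R_def curve_def field_simps)
  obtain s1 where s1: "0 \<le> s1" "s1 < 1" "\<And>s. s1 < s \<and> s < 1 \<Longrightarrow> freq 1 < s * freq s"
    using times_freq_greater[OF b] by auto
  have "curve (freq 1) s1 < curve (freq 1) 1"
    by (rule curve_increasing) (use s1 in auto)
  have R1: "freq 1 < R s1"
    using start_pos[of s1] s1 \<open>curve (freq 1) s1 < curve (freq 1) 1\<close> by (simp add: R_def curve_def field_simps)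
  \<comment> \<open>Strictly between: above \<open>freq 1\<close>, so the curve for
    \<open>\<alpha>'\<close> decreases near \<open>1\<close> and \<open>R < \<alpha>'\<close> there;
    below \<open>R s1\<close>, so the maximum is not lost by discarding that region.\<close>
  define \<alpha>' where "\<alpha>' = (freq 1 + R s1) / 2"
  have \<alpha>': "freq 1 < \<alpha>'" "\<alpha>' < R s1" using R1 by (auto simp: \<alpha>'_def)
  obtain s2 where s2: "0 \<le> s2" "s2 < 1" "\<And>s. s2 < s \<and> s < 1 \<Longrightarrow> \<bar>s * freq s - freq 1\<bar> < \<alpha>' - freq 1"
    using times_freq_near_1[of "\<alpha>' - freq 1"] \<alpha>' by auto
  have right: "R s < \<alpha>'" if "s2 < s" "s < 1" for s
  proof -
    have "curve \<alpha>' 1 < curve \<alpha>' s"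
    proof (rule curve_decreasing)
      fix t assume "s < t" "t < 1"
      then show "t * freq t < \<alpha>'" using s2(3)[of t] that by auto
    qed (use that s2 in auto)
    then show ?thesis using R[of s \<alpha>'] that s2 by auto
  qed
  \<comment> \<open>Left of \<open>0\<close> the numerator of \<open>R\<close> is smaller and the
    denominator larger than at \<open>0\<close>; the \<open>max\<close> accounts for a nonpositive
    numerator.\<close>
  have left: "R s \<le> max 0 (R 0)" if "-1 < s" "s < 0" for s
  proof -
    have "curve 0 0 < curve 0 s"
    proof (rule curve_decreasing)
      fix t assume "s < t" "t < 0"
      then show "t * freq t < 0" using freq_pos[of t] that by (simp add: mult_neg_pos)
    qed (use that in auto)
    then have lev: "level 0 < level s" by (simp add: curve_def)
    have st: "start 0 \<le> start s"
    proof (rule DERIV_nonpos_imp_decreasing_open[of s 0 start])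
      fix t assume "s < t" "t < 0"
      then have "\<bar>t\<bar> < 1" using that by auto
      then show "\<exists>d. (start has_real_derivative d) (at t) \<and> d \<le> 0"
        using start_has_real_derivative[of t] start'_neg[of t] by (intro exI[of _ "start' t"]) auto
    qed (use that in \<open>auto intro: continuous_on_subset[OF start_continuous_on]\<close>)
    show ?thesis
    proof (cases "level 1 - level s \<le> 0")
      case True
      then have "R s \<le> 0" using start_pos[of s] that by (simp add: R_def divide_nonpos_pos)
      then show ?thesis by simp
    next
      case False
      then have "R s \<le> R 0"
        unfolding R_def using st lev start_pos[of 0] by (intro frac_le) auto
      then show ?thesis by simp
    qed
  qed
  have "continuous_on {0..s2} R"
  proof -
    have "start s \<noteq> 0" if "s \<in> {0..s2}" for s using start_pos[of s] that s2 by auto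
    then show ?thesis
      unfolding R_def using s2
      by (intro continuous_intros continuous_on_subset[OF start_continuous_on] continuous_on_subset[OF level_continuous_on]) auto
  qed
  then have "\<exists>m\<in>{0..s2}. \<forall>s\<in>{0..s2}. R s \<le> R m"
    using s2 by (intro continuous_attains_sup) auto
  then obtain m where m: "m \<in> {0..s2}" "\<forall>s\<in>{0..s2}. R s \<le> R m" by blast
  have s12: "s1 \<le> s2"
  proof (rule ccontr)
    assume "\<not> s1 \<le> s2"
    then show False using right[of s1] s1 \<alpha>' by auto
  qed
  then have hm: "R s1 \<le> R m" using m(2) s1 by auto
  have all: "R s \<le> R m" if s: "\<bar>s\<bar> < 1" for s
  proof -
    consider "s < 0" | "s \<in> {0..s2}" | "s2 < s" by force
    then show ?thesis
    proof cases
      case 1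
      have "R 0 \<le> R m" using m(2) s2 by auto
      moreover have "0 \<le> R m" using hm R1 freq_pos[of 1] by simp
      ultimately show ?thesis using left[of s] 1 s by auto
    next
      case 2 then show ?thesis using m(2) by blast
    next
      case 3
      then have "R s < \<alpha>'" using right[of s] s by auto
      then show ?thesis using hm \<alpha>' by linarith
    qed
  qed
  have "(\<exists>s. \<bar>s\<bar> < 1 \<and> curve \<alpha> s \<le> level 1) \<longleftrightarrow> \<alpha> \<le> R m" for \<alpha>
  proof
    assume "\<exists>s. \<bar>s\<bar> < 1 \<and> curve \<alpha> s \<le> level 1"
    then obtain s where s: "\<bar>s\<bar> < 1" "curve \<alpha> s \<le> level 1" by blast
    then have "\<alpha> \<le> R s" using R by blast
    then show "\<alpha> \<le> R m" using all[OF s(1)] by simp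
  next
    assume "\<alpha> \<le> R m"
    moreover have "\<bar>m\<bar> < 1" using m s2 by auto
    ultimately show "\<exists>s. \<bar>s\<bar> < 1 \<and> curve \<alpha> s \<le> level 1" using R by blast
  qed
  then show ?thesis using hm R1 by (intro exI[of _ "R m"]) auto
qed

text \<open>Near \<open>-1\<close> the quantity \<open>s freq s\<close> drops below
  \<open>\<alpha>\<close>, so the curve decreases there and the search reduces to a compact
  interval. The minimum may still sit at the end \<open>1\<close>.\<close>

lemma curve_attains_min: "\<exists>s\<in>{-1<..1}. \<forall>t\<in>{-1<..1}. curve \<alpha> s \<le> curve \<alpha> t"
proof -
  obtain s0 where s0: "-1 < s0" "s0 < -1 / 2" "\<forall>s. -1 < s \<and> s \<le> s0 \<longrightarrow> 2 * \<bar>\<alpha>\<bar> < freq s"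
    using freq_unbounded by blast
  have neg: "t * freq t < \<alpha>" if "-1 < t" "t < s0" for t
  proof -
    have "2 * \<bar>\<alpha>\<bar> < freq t" using s0(3) that by auto
    moreover have "t * freq t \<le> -1 / 2 * freq t"
      using that s0 freq_pos[of t] by (intro mult_right_mono) auto
    ultimately show ?thesis by linarith
  qed
  have "continuous_on {s0..1} (curve \<alpha>)"
    by (rule continuous_on_subset[OF curve_continuous_on]) (use s0 in auto)
  then have "\<exists>s\<in>{s0..1}. \<forall>t\<in>{s0..1}. curve \<alpha> s \<le> curve \<alpha> t"
    using s0 by (intro continuous_attains_inf) auto
  then obtain s where s: "s \<in> {s0..1}" "\<forall>t\<in>{s0..1}. curve \<alpha> s \<le> curve \<alpha> t" by blast
  have "curve \<alpha> s \<le> curve \<alpha> t" if t: "t \<in> {-1<..1}" for t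
  proof (cases "t < s0")
    case True
    have "curve \<alpha> s0 < curve \<alpha> t"
      using t s0 True neg by (intro curve_decreasing) auto
    moreover have "curve \<alpha> s \<le> curve \<alpha> s0" using s(2) s0 by auto
    ultimately show ?thesis by simp
  next
    case False
    then show ?thesis using s(2) t by auto
  qed
  then show ?thesis using s(1) s0 by (intro bexI[of _ s]) auto
qed

text \<open>Here \<open>J 1\<close> is twice the integral in \<open>gamma_p\<close> by evenness of
  the weight; the exponents are \<open>c = (p - 2) / (6 - p)\<close> and
  \<open>(b + 1) c = 2 / (6 - p)\<close>.\<close>

lemma freq_1_eq_gamma: "freq 1 = gamma_p p * \<mu> powr ((p - 2) / (6 - p))"
proof -
  define I where "I = (LINT s|lebesgue_on {0..1}. (1 - s\<^sup>2) powr ((4 - p) / (p - 2)))"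
  have J1: "J 1 = 2 * I"
    using tail_at_minus_1_eq_LINT[OF b_gt] by (simp add: J_def I_def b_def)
  have I: "I > 0" using J_pos[of 1] J1 by simp
  have c: "c = (p - 2) / (6 - p)" using p by (simp add: c_def b_def field_simps)
  have bc: "(b + 1) * c = 2 / (6 - p)" 
  proof -
    have "2 / q * (q / r) = 2 / r" if "q \<noteq> 0" for q r :: real using that by simp
    then show ?thesis unfolding b_plus_1 c using p by (metis diff_gt_0_iff_gt less_irrefl)
  qed
  have "\<mu> / (A * J 1) = (p - 2) / (4 * I) * (2 / p) powr (b + 1) * \<mu>"
  proof -
    define X where "X = (p / 2) powr (b + 1)"
    have X: "X > 0" "(2 / p) powr (b + 1) = 1 / X" using p by (auto simp: X_def powr_divide)
    have gen: "\<mu> / (2 / q * X * (2 * I)) = q / (4 * I) * (1 / X) * \<mu>" if "q > 0" for q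
      using X(1) I that by (simp add: field_simps)
    have A: "A = 2 / (p - 2) * X" unfolding A_def X_def by (simp only: b_plus_1)
    show ?thesis unfolding A J1 X(2) by (rule gen) (use p in simp)
  qed
  then have "freq 1 = ((p - 2) / (4 * I) * (2 / p) powr (b + 1) * \<mu>) powr c"
    by (simp add: freq_eq)
  also have "\<dots> = ((p - 2) / (4 * I)) powr c * (2 / p) powr (2 / (6 - p)) * \<mu> powr c"
  proof -
    have gen: "(x * y * z) powr c = x powr c * y powr c * z powr c" if "0 < x" "0 < y" "0 < z" for x y z :: real
      using that by (simp add: powr_mult)
    show ?thesis using gen[of "(p - 2) / (4 * I)" "(2 / p) powr (b + 1)" \<mu>] p I \<mu>
      by (simp add: powr_powr bc)
  qed
  finally show ?thesis
    unfolding gamma_p_def I_def[symmetric] c by (simp add: mult_ac)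
qed

end

section \<open>Realisation by soliton arcs\<close>

lemma has_weak_derivative_C1:
  assumes D: "\<And>x. (U has_real_derivative U' x) (at x)" and c: "continuous_on UNIV U'"
  shows "has_weak_derivative U U'"
  unfolding has_weak_derivative_def
proof
  fix \<phi> assume "\<phi> \<in> test_functions"
  then have C1: "\<phi> C1_differentiable_on UNIV" and cpt: "compact (closure {x. \<phi> x \<noteq> 0})"
    and sub: "closure {x. \<phi> x \<noteq> 0} \<subseteq> {0<..}"
    by (auto simp: test_functions_def)
  let ?S = "closure {x. \<phi> x \<noteq> 0}"
  obtain D\<phi> where "\<forall>x. (\<phi> has_vector_derivative D\<phi> x) (at x)" and c\<phi>': "continuous_on UNIV D\<phi>"
    using C1 by (auto simp: C1_differentiable_on_def)
  then have D\<phi>: "(\<phi> has_real_derivative D\<phi> x) (at x)" for x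
    by (simp add: has_real_derivative_iff_has_vector_derivative)
  have deriv: "deriv \<phi> = D\<phi>" using DERIV_imp_deriv[OF D\<phi>] by blast
  have cU: "continuous_on S U" for S
    by (rule DERIV_continuous_on) (rule has_field_derivative_at_within[OF D])
  have c\<phi>: "continuous_on S \<phi>" for S
    by (rule DERIV_continuous_on) (rule has_field_derivative_at_within[OF D\<phi>])
  \<comment> \<open>The support lies strictly inside, so the boundary terms of the integration by
    parts vanish.\<close>
  obtain l u where lu: "0 < l" "l \<le> u" "?S \<subseteq> {l<..<u}"
  proof (cases "?S = {}")
    case True
    then show ?thesis using that[of 1 1] by simp
  next
    case False
    obtain m where m: "m \<in> ?S" "\<forall>x\<in>?S. m \<le> x" using compact_attains_inf[OF cpt False] by blast
    obtain k where k: "k \<in> ?S" "\<forall>x\<in>?S. x \<le> k" using compact_attains_sup[OF cpt False] by blast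
    have "0 < m" "m \<le> k" using m k sub by auto
    then have "0 < m / 2" "m / 2 \<le> k + 1" by auto
    moreover have "?S \<subseteq> {m / 2<..<k + 1}"
    proof
      fix x assume "x \<in> ?S"
      then have "m \<le> x" "x \<le> k" using m k by auto
      then show "x \<in> {m / 2<..<k + 1}" using \<open>0 < m\<close> by simp
    qed
    ultimately show ?thesis by (rule that)
  qed
  have out: "\<phi> x = 0" if "x \<notin> {l<..<u}" for x
  proof -
    have "x \<notin> ?S" using lu(3) that by blast
    then show ?thesis using closure_subset[of "{x. \<phi> x \<noteq> 0}"] by blast
  qed
  have out': "D\<phi> x = 0" if "x \<notin> {l..u}" for x
  proof (rule derivative_eq_0_outside[OF _ D\<phi> that])
    show "\<phi> z = 0" if "z \<notin> {l..u}" for z using out[of z] that by auto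
  qed
  have ai: "(\<lambda>x. U x * D\<phi> x) absolutely_integrable_on {l..u}" "(\<lambda>x. U' x * \<phi> x) absolutely_integrable_on {l..u}"
    by (intro absolutely_integrable_continuous_real continuous_on_mult cU c\<phi> continuous_on_subset[OF c\<phi>'] continuous_on_subset[OF c]; simp)+
  have "((\<lambda>x. U' x * \<phi> x + D\<phi> x * U x) has_integral U u * \<phi> u - U l * \<phi> l) {l..u}"
    using lu(2) DERIV_mult[OF D D\<phi>]
    by (intro fundamental_theorem_of_calculus)
      (auto simp: has_real_derivative_iff_has_vector_derivative[symmetric] intro: has_field_derivative_at_within)
  then have "integral {l..u} (\<lambda>x. U' x * \<phi> x + U x * D\<phi> x) = 0"
    using out[of u] out[of l] by (simp add: mult.commute integral_unique)
  then have "integral {l..u} (\<lambda>x. U' x * \<phi> x) + integral {l..u} (\<lambda>x. U x * D\<phi> x) = 0"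
    using Henstock_Kurzweil_Integration.integral_add[OF set_lebesgue_integral_eq_integral(1)[OF ai(2)] set_lebesgue_integral_eq_integral(1)[OF ai(1)]] by simp
  moreover have "(LINT x|halfline. U x * D\<phi> x) = integral {l..u} (\<lambda>x. U x * D\<phi> x)"
    by (intro LINT_halfline_compact_support ai lu) (use out' in auto)
  moreover have "(LINT x|halfline. U' x * \<phi> x) = integral {l..u} (\<lambda>x. U' x * \<phi> x)"
    by (intro LINT_halfline_compact_support ai lu) (use out in auto)
  ultimately show "(LINT x|halfline. U x * deriv \<phi> x) = - (LINT x|halfline. U' x * \<phi> x)"
    unfolding deriv by simp
qed

text \<open>For a nonnegative integrand the fundamental theorem delivers integrability together with
  the value; the result is then carried over to the completed measure.\<close>

lemma has_bochner_integral_halfline_FTC: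
  fixes f F :: "real \<Rightarrow> real"
  assumes c: "continuous_on UNIV f" and D: "\<And>x. (F has_real_derivative f x) (at x)"
    and nn: "\<And>x. 0 \<le> f x" and lim: "(F \<longlongrightarrow> T) at_top"
  shows "has_bochner_integral halfline f (T - F 0)"
proof -
  have fb: "f \<in> borel_measurable borel"
    using c by (rule borel_measurable_continuous_onI)
  have mono: "F 0 \<le> F x" if "0 \<le> x" for x
    by (rule DERIV_nonneg_imp_nondecreasing[OF that]) (use D nn in blast)
  have T: "F 0 \<le> T"
    by (rule tendsto_lowerbound[OF lim]) (use mono in \<open>auto simp: eventually_at_top_linorder\<close>)
  have "(\<integral>\<^sup>+x. ennreal (f x) * indicator {0..} x \<partial>lborel) = T - F 0"
    by (rule nn_integral_FTC_atLeast[OF fb D nn lim])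
  moreover have "(\<integral>\<^sup>+x. ennreal (f x) * indicator {0..} x \<partial>lborel) = (\<integral>\<^sup>+x. ennreal (indicator {0<..} x *\<^sub>R f x) \<partial>lborel)"
  proof (rule nn_integral_cong_AE)
    have "AE x in lborel. x \<noteq> (0::real)" by (rule AE_lborel_singleton)
    then show "AE x in lborel. ennreal (f x) * indicator {0..} x = ennreal (indicator {0<..} x *\<^sub>R f x)"
      by eventually_elim (auto simp: indicator_def)
  qed
  ultimately have "(\<integral>\<^sup>+x. ennreal (indicator {0<..} x *\<^sub>R f x) \<partial>lborel) = ennreal (T - F 0)" by simp
  then have "has_bochner_integral lborel (\<lambda>x. indicator {0<..} x *\<^sub>R f x) (T - F 0)"
    using T nn fb by (intro has_bochner_integral_nn_integral) (auto simp: indicator_def)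
  then have "has_bochner_integral lebesgue (\<lambda>x. indicator {0<..} x *\<^sub>R f x) (T - F 0)"
    by (auto simp: has_bochner_integral_iff integrable_completion integral_completion fb)
  then show ?thesis by (subst has_bochner_integral_restrict_space) auto
qed

lemma tanh_real_surj:
  assumes "\<bar>s\<bar> < 1"
  shows "\<exists>x::real. tanh x = s"
proof -
  have "tanh (ln ((1 + s) / (1 - s)) / 2) = s"
    using assms unfolding tanh_real_altdef by (simp add: exp_minus field_simps)
  then show ?thesis ..
qed

context soliton_family
begin

text \<open>The explicit soliton is a power of a hyperbolic secant, written as
  \<open>(1 - tanh^2)^(1 / (p - 2))\<close> so that \<open>r\<close> is its natural variable and
  \<open>tail\<close>, \<open>tail2\<close> composed with \<open>r\<close> give the
  primitives.\<close>

lemma soliton_realises_curve: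
  assumes s: "\<bar>s\<bar> < 1"
  shows "\<exists>U\<in>H1_mass \<mu>. energy p \<alpha> U = curve \<alpha> s"
proof -
  \<comment> \<open>The translation that gives \<open>r 0 = - s\<close>, that is, logarithmic
    derivative \<open>L s\<close> at the origin.\<close>
  obtain \<xi> where \<xi>: "tanh \<xi> = s" using tanh_real_surj[OF s] by blast
  define L where "L = freq s"
  have s': "-1 < s" "s \<le> 1" using s by auto
  have L: "L > 0" using freq_pos[OF s'] by (simp add: L_def)
  have b1: "b + 1 > 0" using b_gt by simp
  \<comment> \<open>The scale for which \<open>U' = - L r U\<close>.\<close>
  define \<kappa> where "\<kappa> = L / (b + 1)"
  have \<kappa>: "\<kappa> > 0" using L b1 by (simp add: \<kappa>_def)
  define r where "r = (\<lambda>x. tanh (\<kappa> * x - \<xi>))"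
  have r: "\<bar>r x\<bar> < 1" for x
    using tanh_real_lt_1[of "\<kappa> * x - \<xi>"] tanh_real_gt_neg1[of "\<kappa> * x - \<xi>"] by (simp add: r_def abs_less_iff)
  have y: "1 - (r x)\<^sup>2 > 0" for x using one_minus_square_pos[OF r] .
  have r0: "r 0 = - s" using \<xi> by (simp add: r_def)
  have Dr: "(r has_real_derivative \<kappa> * (1 - (r x)\<^sup>2)) (at x)" for x
    unfolding r_def by (auto intro!: derivative_eq_intros)
  have limr: "(r \<longlongrightarrow> 1) at_top"
  proof -
    have "filterlim (\<lambda>x. \<kappa> * x - \<xi>) at_top at_top"
      using filterlim_tendsto_add_at_top[OF tendsto_const[of "-\<xi>"] filterlim_tendsto_pos_mult_at_top[OF tendsto_const[of \<kappa>] \<kappa> filterlim_ident]]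
      by simp
    then show ?thesis
      unfolding r_def by (rule filterlim_compose[OF tanh_real_at_top])
  qed
  define H where "H = height L"
  have H: "H > 0" "(b + 1) * H\<^sup>2 = A * L powr (2 * b + 2)" "H powr (p - 2) = p / 2 * L\<^sup>2"
    using height_pos[OF L] height_sq[OF L] height_powr[OF L] by (auto simp: H_def)
  define U where "U = (\<lambda>x. H * (1 - (r x)\<^sup>2) powr ((b + 1) / 2))"
  define U' where "U' = (\<lambda>x. - L * r x * U x)"
  have U_pos: "U x > 0" for x using H y[of x] by (simp add: U_def)
  have Usq: "(U x)\<^sup>2 = H\<^sup>2 * (1 - (r x)\<^sup>2) powr (b + 1)" for x
    by (simp add: U_def power_mult_distrib power2_eq_square flip: powr_add)
  have DU: "(U has_real_derivative U' x) (at x)" for x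
  proof -
    have D1: "((\<lambda>x. H * (1 - (r x)\<^sup>2) powr ((b + 1) / 2)) has_real_derivative
        H * ((b + 1) / 2 * (1 - (r x)\<^sup>2) powr ((b + 1) / 2 - 1) * (- (2 * r x * (\<kappa> * (1 - (r x)\<^sup>2)))))) (at x)"
      using y[of x] by (auto intro!: derivative_eq_intros Dr)
    have eq2: "H * ((b + 1) / 2 * (1 - (r x)\<^sup>2) powr ((b + 1) / 2 - 1) * (- (2 * r x * (\<kappa> * (1 - (r x)\<^sup>2))))) =
        - ((b + 1) * \<kappa>) * r x * (H * (1 - (r x)\<^sup>2) powr ((b + 1) / 2))"
    proof -
      have pw: "q powr (e - 1) * q = q powr e" if "q > 0" for q e :: real
        using that by (simp add: powr_diff)
      have "H * ((b + 1) / 2 * e * (- (2 * \<rho> * (\<kappa> * q)))) = - ((b + 1) * \<kappa>) * \<rho> * (H * (e * q))" for e q \<rho>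
        by simp
      then show ?thesis unfolding pw[OF y] by (simp only: pw[OF y])
    qed
    have eq3: "(b + 1) * \<kappa> = L" using b1 by (simp add: \<kappa>_def)
    show ?thesis
      unfolding U_def U'_def by (rule DERIV_cong[OF D1 eq2[unfolded eq3]])
  qed
  have cr: "continuous_on UNIV r"
    by (rule DERIV_continuous_on) (rule has_field_derivative_at_within[OF Dr])
  have cU: "continuous_on S U" for S
    by (rule DERIV_continuous_on) (rule has_field_derivative_at_within[OF DU])
  have cU': "continuous_on UNIV U'"
    unfolding U'_def by (intro continuous_intros cr cU)
  have rng: "eventually (\<lambda>x. r x \<in> {-1..1}) at_top"
    using r by (intro always_eventually) (auto simp: abs_less_iff less_imp_le)
  have wty: "wt b (r x) * (1 - (r x)\<^sup>2) = (1 - (r x)\<^sup>2) powr (b + 1)" for x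
    using y[of x] by (simp add: wt_def powr_add)
  have AH: "A * L powr (2 * b + 1) * \<kappa> = H\<^sup>2"
  proof -
    have "L powr (2 * b + 2) = L powr (2 * b + 1) * L"
      using L powr_add[of L "2 * b + 1" 1] by (simp add: algebra_simps)
    then show ?thesis using H(2) b1 unfolding \<kappa>_def by (simp add: field_simps)
  qed
  have L3: "L powr (2 * b + 3) = L powr (2 * b + 1) * L\<^sup>2"
    using L powr_add[of L "2 * b + 1" 2] by (simp add: algebra_simps)
  have int_sq: "has_bochner_integral halfline (\<lambda>x. (U x)\<^sup>2) \<mu>"
  proof -
    define F where "F = (\<lambda>x. - (A * L powr (2 * b + 1)) * tail b (r x))"
    have "(F has_real_derivative (U x)\<^sup>2) (at x)" for x
      unfolding F_def
    proof (rule DERIV_cong[OF DERIV_cmult[OF DERIV_chain2[OF tail_has_real_derivative[OF b_gt r] Dr]]])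
      have "- (A * L powr (2 * b + 1)) * (- wt b (r x) * (\<kappa> * (1 - (r x)\<^sup>2)))
        = (A * L powr (2 * b + 1) * \<kappa>) * (wt b (r x) * (1 - (r x)\<^sup>2))" by simp
      then show "- (A * L powr (2 * b + 1)) * (- wt b (r x) * (\<kappa> * (1 - (r x)\<^sup>2))) = (U x)\<^sup>2"
        unfolding AH wty Usq by simp
    qed
    moreover have "((\<lambda>x. tail b (r x)) \<longlongrightarrow> tail b 1) at_top"
      using rng by (intro continuous_on_tendsto_compose[OF tail_continuous_on[OF b_gt] limr]) auto
    then have "(F \<longlongrightarrow> - (A * L powr (2 * b + 1)) * tail b 1) at_top"
      unfolding F_def by (intro tendsto_intros)
    ultimately have "has_bochner_integral halfline (\<lambda>x. (U x)\<^sup>2) (- (A * L powr (2 * b + 1)) * tail b 1 - F 0)"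
      by (intro has_bochner_integral_halfline_FTC continuous_intros cU) auto
    moreover have "- (A * L powr (2 * b + 1)) * tail b 1 - F 0 = \<mu>"
      using freq_mass[OF s'] by (simp add: F_def r0 J_def L_def)
    ultimately show ?thesis by simp
  qed
  define S where "S = A * L powr (2 * b + 3) * tail2 b (- s)"
  have int_dsq: "has_bochner_integral halfline (\<lambda>x. (U' x)\<^sup>2) S"
  proof -
    define F where "F = (\<lambda>x. - (A * L powr (2 * b + 3)) * tail2 b (r x))"
    have "(F has_real_derivative (U' x)\<^sup>2) (at x)" for x
      unfolding F_def
    proof (rule DERIV_cong[OF DERIV_cmult[OF DERIV_chain2[OF tail2_has_real_derivative[OF b_gt r] Dr]]])
      have "- (A * L powr (2 * b + 3)) * (- ((r x)\<^sup>2 * wt b (r x)) * (\<kappa> * (1 - (r x)\<^sup>2)))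
        = L\<^sup>2 * (r x)\<^sup>2 * ((A * L powr (2 * b + 1) * \<kappa>) * (wt b (r x) * (1 - (r x)\<^sup>2)))" unfolding L3 by simp
      then show "- (A * L powr (2 * b + 3)) * (- ((r x)\<^sup>2 * wt b (r x)) * (\<kappa> * (1 - (r x)\<^sup>2))) = (U' x)\<^sup>2"
        unfolding AH wty U'_def power_mult_distrib Usq by simp
    qed
    moreover have "((\<lambda>x. tail2 b (r x)) \<longlongrightarrow> tail2 b 1) at_top"
      using rng by (intro continuous_on_tendsto_compose[OF tail2_continuous_on[OF b_gt] limr]) auto
    then have "(F \<longlongrightarrow> - (A * L powr (2 * b + 3)) * tail2 b 1) at_top"
      unfolding F_def by (intro tendsto_intros)
    ultimately have "has_bochner_integral halfline (\<lambda>x. (U' x)\<^sup>2) (- (A * L powr (2 * b + 3)) * tail2 b 1 - F 0)"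
      by (intro has_bochner_integral_halfline_FTC continuous_intros cU') auto
    then show ?thesis by (simp add: F_def r0 S_def)
  qed
  \<comment> \<open>First integral of the soliton equation; the nonlinear term then needs no
    integral beyond those of \<open>U^2\<close> and \<open>U'^2\<close>.\<close>
  have Up: "\<bar>U x\<bar> powr p = p / 2 * (L\<^sup>2 * (U x)\<^sup>2 - (U' x)\<^sup>2)" for x
  proof -
    have "U x powr p = U x powr (p - 2) * (U x)\<^sup>2"
      using U_pos[of x] powr_add[of "U x" "p - 2" 2] by simp
    also have "U x powr (p - 2) = H powr (p - 2) * (1 - (r x)\<^sup>2) powr ((b + 1) * (p - 2) / 2)"
      using H y[of x] by (simp add: U_def powr_mult powr_powr)
    also have "\<dots> = p / 2 * L\<^sup>2 * (1 - (r x)\<^sup>2)"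
      unfolding b_times H(3) using y[of x] by simp
    finally show ?thesis using U_pos[of x] by (simp add: U'_def power_mult_distrib algebra_simps)
  qed
  have int_p: "has_bochner_integral halfline (\<lambda>x. \<bar>U x\<bar> powr p) (p / 2 * (L\<^sup>2 * \<mu> - S))"
    unfolding Up
    by (intro has_bochner_integral_mult_right has_bochner_integral_diff int_sq int_dsq)
  have meas: "f \<in> borel_measurable halfline" if "continuous_on UNIV f" for f :: "real \<Rightarrow> real"
    by (rule continuous_imp_measurable_on_sets_lebesgue) (auto intro: continuous_on_subset[OF that])
  have L2: "U \<in> L2_halfline" "U' \<in> L2_halfline"
    unfolding L2_halfline_def using meas cU cU' int_sq int_dsq by (auto simp: has_bochner_integral_iff)
  have weak: "has_weak_derivative U U'" by (rule has_weak_derivative_C1[OF DU cU'])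
  have H1: "U \<in> H1_halfline" unfolding H1_halfline_def using L2 weak by auto
  then have mass: "U \<in> H1_mass \<mu>"
    unfolding H1_mass_def using int_sq by (auto simp: has_bochner_integral_iff)
  have "(LINT x|halfline. \<bar>weak_deriv U x\<bar>\<^sup>2) = (LINT x|halfline. (U' x)\<^sup>2)"
  proof (rule integral_cong_AE)
    note wd = weak_deriv_H1[OF H1]
    show "(\<lambda>x. \<bar>weak_deriv U x\<bar>\<^sup>2) \<in> borel_measurable halfline"
    proof -
      have "weak_deriv U \<in> borel_measurable halfline" using wd(2) by (simp add: L2_halfline_def)
      then show ?thesis by (intro borel_measurable_power borel_measurable_abs)
    qed
    show "(\<lambda>x. (U' x)\<^sup>2) \<in> borel_measurable halfline"
      using meas[OF cU'] by (rule borel_measurable_power)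
    show "AE x in halfline. \<bar>weak_deriv U x\<bar>\<^sup>2 = (U' x)\<^sup>2"
      using weak_derivative_unique_ae[OF wd(3) weak wd(1) wd(2) L2(2)] by eventually_elim simp
  qed
  then have K: "(LINT x|halfline. \<bar>weak_deriv U x\<bar>\<^sup>2) = S"
    using int_dsq by (simp add: has_bochner_integral_iff)
  have "value_at_0 U = U 0" by (rule value_at_0_eqI[OF cU]) simp
  moreover have "start s = H\<^sup>2 * (1 - s\<^sup>2) powr (b + 1)"
    unfolding start_def L_def[symmetric] H(2)[symmetric] using b1 by simp
  ultimately have v0: "\<bar>value_at_0 U\<bar>\<^sup>2 = start s"
    by (simp add: Usq r0)
  have "energy p \<alpha> U = curve \<alpha> s"
    unfolding energy_def K v0 has_bochner_integral_integral_eq[OF int_p] curve_def level_def L_def[symmetric] S_def[symmetric]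
    using p by (simp add: field_simps)
  then show ?thesis using mass by blast
qed

end

section \<open>Comparison with soliton arcs\<close>

context H1_representative
begin

text \<open>A Gronwall argument by steps of length \<open>1 / (2 L)\<close>: on each step the
  maximum of \<open>|w|\<close> is at most half of itself.\<close>

lemma eq_0_of_derivative_bound:
  assumes L: "L > 0" and ae: "AE x in halfline. \<bar>v x\<bar> \<le> L * \<bar>w x\<bar>" and w0: "w 0 = 0"
  shows "0 \<le> x \<Longrightarrow> w x = 0"
proof -
  define \<delta> where "\<delta> = 1 / (2 * L)"
  have \<delta>: "\<delta> > 0" using L by (simp add: \<delta>_def)
  obtain N where N: "negligible N" "\<forall>x>0. x \<notin> N \<longrightarrow> \<bar>v x\<bar> \<le> L * \<bar>w x\<bar>"
    using ae unfolding AE_halfline_iff by blast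
  have step: "w z = 0" if a: "0 \<le> a" "w a = 0" and z: "a \<le> z" "z \<le> a + \<delta>" for a z
  proof -
    have cw: "continuous_on {a..y} (\<lambda>z. \<bar>w z\<bar>)" for y
      by (intro continuous_on_rabs continuous_on_subset[OF w_cont]) (use a in auto)
    then have "\<exists>m\<in>{a..a + \<delta>}. \<forall>t\<in>{a..a + \<delta>}. \<bar>w t\<bar> \<le> \<bar>w m\<bar>"
      using \<delta> by (intro continuous_attains_sup) auto
    then obtain m where m: "m \<in> {a..a + \<delta>}" "\<forall>t\<in>{a..a + \<delta>}. \<bar>w t\<bar> \<le> \<bar>w m\<bar>" by blast
    have vi: "(\<lambda>x. \<bar>v x\<bar>) integrable_on {a..m}"
      by (intro absolutely_integrable_imp_abs_integrable L2_halfline_absolutely_integrable[OF weak_deriv_H1(2)[OF u] a(1)])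
    have neg: "negligible (insert 0 N)" using N(1) by simp
    \<comment> \<open>The integral comparison is pointwise, so the exceptional points are zeroed,
      among them \<open>0\<close>, where the almost-everywhere bound says nothing.\<close>
    define V where "V = (\<lambda>x. if x \<in> insert 0 N then 0 else \<bar>v x\<bar>)"
    have "\<bar>w m\<bar> \<le> integral {a..m} (\<lambda>x. \<bar>v x\<bar>)"
      using abs_w_increment[of a m] a m by simp
    also have "\<dots> = integral {a..m} V"
      by (rule integral_spike[OF neg]) (auto simp: V_def)
    also have "\<dots> \<le> integral {a..m} (\<lambda>x. L * \<bar>w m\<bar>)"
    proof (rule integral_le)
      show "V integrable_on {a..m}"
        by (rule integrable_spike[OF vi neg]) (auto simp: V_def)
      fix x assume x: "x \<in> {a..m}"
      then have "\<bar>w x\<bar> \<le> \<bar>w m\<bar>" using m by auto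
      then have "L * \<bar>w x\<bar> \<le> L * \<bar>w m\<bar>" using L by (intro mult_left_mono) auto
      moreover have "V x \<le> L * \<bar>w x\<bar>"
        using N(2)[rule_format, of x] x a L by (auto simp: V_def)
      ultimately show "V x \<le> L * \<bar>w m\<bar>" by (rule order_trans[rotated])
    qed auto
    also have "\<dots> = L * (m - a) * \<bar>w m\<bar>" using m by simp
    also have "\<dots> \<le> L * \<delta> * \<bar>w m\<bar>"
      using m L by (intro mult_right_mono mult_left_mono) auto
    also have "L * \<delta> = 1 / 2" using L by (simp add: \<delta>_def)
    finally have "\<bar>w m\<bar> \<le> 0" by simp
    moreover have "\<bar>w z\<bar> \<le> \<bar>w m\<bar>" using m(2) z by auto
    ultimately show ?thesis by simp
  qed
  have "\<forall>z. 0 \<le> z \<and> z \<le> real n * \<delta> \<longrightarrow> w z = 0" for n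
  proof (induction n)
    case 0
    then show ?case using w0 by auto
  next
    case (Suc n)
    show ?case
    proof (intro allI impI)
      fix z assume z: "0 \<le> z \<and> z \<le> real (Suc n) * \<delta>"
      show "w z = 0"
      proof (cases "z \<le> real n * \<delta>")
        case True
        then show ?thesis using Suc z by auto
      next
        case False
        then show ?thesis
          using step[of "real n * \<delta>" z] Suc z \<delta> by (simp add: algebra_simps)
      qed
    qed
  qed
  moreover obtain n :: nat where "x / \<delta> < real n" using reals_Archimedean2 by blast
  then have "x \<le> real n * \<delta>" using \<delta> by (simp add: field_simps)
  ultimately show "0 \<le> x \<Longrightarrow> w x = 0" by blast
qed

end

locale soliton_comparison = soliton_family p \<mu> + H1_representative u w for p \<mu> u w +
  assumes u_mass: "u \<in> H1_mass \<mu>"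
begin

definition free_energy :: real where
  "free_energy = 1 / 2 * (LINT x|halfline. (v x)\<^sup>2) - 1 / p * (LINT x|halfline. \<bar>w x\<bar> powr p)"

text \<open>The square that the calibration leaves over; it supplies strictness when the boundary
  value is \<open>0\<close>.\<close>

definition defect :: "real \<Rightarrow> real" where
  "defect L = 1 / 2 * (LINT x|halfline. (\<bar>v x\<bar> - \<bar>w x\<bar> * slope L \<bar>w x\<bar>)\<^sup>2)"

lemma w_mass: "(LINT x|halfline. (w x)\<^sup>2) = \<mu>"
proof -
  have "(LINT x|halfline. (w x)\<^sup>2) = (LINT x|halfline. \<bar>u x\<bar>\<^sup>2)"
    by (rule integral_cong_AE) (use w_ae in auto)
  then show ?thesis using u_mass by (simp add: H1_mass_def)
qed

lemma energy_eq: "energy p \<alpha> u = free_energy + \<alpha> / 2 * (w 0)\<^sup>2"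
proof -
  have "(LINT x|halfline. \<bar>u x\<bar> powr p) = (LINT x|halfline. \<bar>w x\<bar> powr p)"
    by (rule integral_cong_AE) (use w_ae in auto)
  then show ?thesis by (simp add: energy_def free_energy_def w_0)
qed

lemma slope_w_measurable: "(\<lambda>x. \<bar>w x\<bar> * slope L \<bar>w x\<bar>) \<in> borel_measurable halfline"
  unfolding slope_def by measurable

lemma calibrated_bound:
  assumes L: "L > 0" and m: "\<And>z. 0 \<le> z \<Longrightarrow> \<bar>w z\<bar> \<le> m" "m \<le> height L" and x: "0 \<le> x"
  shows "2 * action L \<bar>w x\<bar> - action L \<bar>w 0\<bar> - L\<^sup>2 * \<mu> / 2 + defect L \<le> free_energy"
proof -
  define g where "g = (\<lambda>t. t * slope L t)"
  have AE_pos: "AE x in halfline. x \<in> {0<..}" using AE_space[of halfline] by simp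
  have le: "\<bar>w z\<bar> \<le> height L" if "0 \<le> z" for z using m(1)[OF that] m(2) by simp
  have gm: "(\<lambda>x. g \<bar>w x\<bar>) \<in> borel_measurable halfline"
    unfolding g_def by (rule slope_w_measurable)
  have g2: "(g \<bar>w z\<bar>)\<^sup>2 = L\<^sup>2 * (w z)\<^sup>2 - 2 / p * \<bar>w z\<bar> powr p" if "0 \<le> z" for z
  proof (cases "w z = 0")
    case False
    have "\<bar>w z\<bar> powr p = \<bar>w z\<bar> powr (p - 2) * (w z)\<^sup>2"
      using False powr_add[of "\<bar>w z\<bar>" "p - 2" 2] by simp
    then show ?thesis
      using slope_sq[OF L _ le[OF that]] by (simp add: g_def power_mult_distrib right_diff_distrib)
  qed (simp add: g_def)
  \<comment> \<open>Staying below the soliton height also gives integrability of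
    \<open>|w|^p\<close> from that of \<open>w^2\<close>, so no Sobolev embedding is
    required.\<close>
  have p_le: "\<bar>w z\<bar> powr p \<le> p / 2 * L\<^sup>2 * (w z)\<^sup>2" if "0 \<le> z" for z
  proof -
    have "2 / p * \<bar>w z\<bar> powr p \<le> L\<^sup>2 * (w z)\<^sup>2"
      using g2[OF that] zero_le_power2[of "g \<bar>w z\<bar>"] by linarith
    then show ?thesis using p by (simp add: field_simps)
  qed
  have g2_le: "(g \<bar>w z\<bar>)\<^sup>2 \<le> L\<^sup>2 * (w z)\<^sup>2" if "0 \<le> z" for z
  proof -
    have "0 \<le> 2 / p * \<bar>w z\<bar> powr p" using p by simp
    then show ?thesis using g2[OF that] by linarith
  qed
  have ip: "integrable halfline (\<lambda>x. \<bar>w x\<bar> powr p)"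
  proof (rule Bochner_Integration.integrable_bound)
    show "integrable halfline (\<lambda>x. p / 2 * L\<^sup>2 * (w x)\<^sup>2)" using w2_integrable by simp
    show "AE x in halfline. norm (\<bar>w x\<bar> powr p) \<le> norm (p / 2 * L\<^sup>2 * (w x)\<^sup>2)"
      using AE_pos by eventually_elim (use p_le p in \<open>auto simp: abs_mult\<close>)
  qed measurable
  have ig: "integrable halfline (\<lambda>x. (g \<bar>w x\<bar>)\<^sup>2)"
  proof (rule Bochner_Integration.integrable_bound)
    show "integrable halfline (\<lambda>x. L\<^sup>2 * (w x)\<^sup>2)" using w2_integrable by simp
    show "AE x in halfline. norm ((g \<bar>w x\<bar>)\<^sup>2) \<le> norm (L\<^sup>2 * (w x)\<^sup>2)"
      using AE_pos by eventually_elim (use g2_le in simp)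
  qed (use gm in measurable)
  have ivg: "integrable halfline (\<lambda>x. \<bar>v x\<bar> * g \<bar>w x\<bar>)"
  proof (rule Bochner_Integration.integrable_bound)
    show "integrable halfline (\<lambda>x. (v x)\<^sup>2 + (g \<bar>w x\<bar>)\<^sup>2)"
      by (intro Bochner_Integration.integrable_add v2_integrable ig)
    have "\<bar>a * c\<bar> \<le> a\<^sup>2 + c\<^sup>2" for a c :: real
    proof -
      have "2 * \<bar>a\<bar> * \<bar>c\<bar> \<le> a\<^sup>2 + c\<^sup>2" "0 \<le> \<bar>a\<bar> * \<bar>c\<bar>"
        using sum_squares_bound[of "\<bar>a\<bar>" "\<bar>c\<bar>"] by simp_all
      then show ?thesis unfolding abs_mult by linarith
    qed
    then have "\<bar>\<bar>v x\<bar> * g \<bar>w x\<bar>\<bar> \<le> \<bar>v x\<bar>\<^sup>2 + (g \<bar>w x\<bar>)\<^sup>2" for x by blast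
    then show "AE x in halfline. norm (\<bar>v x\<bar> * g \<bar>w x\<bar>) \<le> norm ((v x)\<^sup>2 + (g \<bar>w x\<bar>)\<^sup>2)"
      by simp
  qed (use gm in measurable)
  have "(LINT x|halfline. (g \<bar>w x\<bar>)\<^sup>2) = (LINT x|halfline. L\<^sup>2 * (w x)\<^sup>2 - 2 / p * \<bar>w x\<bar> powr p)"
    by (rule Bochner_Integration.integral_cong) (use g2 in auto)
  also have "\<dots> = L\<^sup>2 * \<mu> - 2 / p * (LINT x|halfline. \<bar>w x\<bar> powr p)"
    using w2_integrable ip by (simp add: w_mass)
  finally have G: "(LINT x|halfline. (g \<bar>w x\<bar>)\<^sup>2) = L\<^sup>2 * \<mu> - 2 / p * (LINT x|halfline. \<bar>w x\<bar> powr p)" .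
  have "(LINT x|halfline. (\<bar>v x\<bar> - g \<bar>w x\<bar>)\<^sup>2) = (LINT x|halfline. (v x)\<^sup>2 + (g \<bar>w x\<bar>)\<^sup>2 - 2 * (\<bar>v x\<bar> * g \<bar>w x\<bar>))"
    by (rule Bochner_Integration.integral_cong) (auto simp: power2_diff)
  also have "\<dots> = (LINT x|halfline. (v x)\<^sup>2) + (LINT x|halfline. (g \<bar>w x\<bar>)\<^sup>2) - 2 * (LINT x|halfline. \<bar>v x\<bar> * g \<bar>w x\<bar>)"
    using v2_integrable ig ivg by simp
  finally have X: "(LINT x|halfline. (\<bar>v x\<bar> - g \<bar>w x\<bar>)\<^sup>2) =
      (LINT x|halfline. (v x)\<^sup>2) + (LINT x|halfline. (g \<bar>w x\<bar>)\<^sup>2) - 2 * (LINT x|halfline. \<bar>v x\<bar> * g \<bar>w x\<bar>)" .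
  have "defect L = 1 / 2 * (LINT x|halfline. (\<bar>v x\<bar> - g \<bar>w x\<bar>)\<^sup>2)"
    by (simp add: defect_def g_def)
  moreover have "2 / p * (LINT x|halfline. \<bar>w x\<bar> powr p) = 2 * (1 / p * (LINT x|halfline. \<bar>w x\<bar> powr p))"
    by simp
  ultimately have "free_energy = defect L - L\<^sup>2 * \<mu> / 2 + (LINT x|halfline. \<bar>v x\<bar> * g \<bar>w x\<bar>)"
    using X G unfolding free_energy_def by linarith
  moreover have "2 * action L \<bar>w x\<bar> - action L \<bar>w 0\<bar> \<le> (LINT z|halfline. \<bar>v z\<bar> * g \<bar>w z\<bar>)"
  proof (rule calibration[OF m(1)])
    show "continuous_on {0..m} (action L)"
      using profile_continuous_on(2)[OF L] by (rule continuous_on_subset) (use m in auto)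
    show "(action L has_real_derivative g t) (at t)" if "0 < t" "t < m" for t
      using profile_derivatives(2)[OF L that(1)] that m by (simp add: g_def)
    show "continuous_on {0..m} g"
      unfolding g_def by (intro continuous_intros continuous_on_subset[OF slope_continuous_on]) auto
    show "0 \<le> g t" if "t \<in> {0..m}" for t
      using slope_nonneg[OF L, of t] that m by (simp add: g_def)
  qed (use L ivg x in auto)
  ultimately show ?thesis by simp
qed

lemma defect_nonneg: "0 \<le> defect L"
  by (simp add: defect_def)

text \<open>The arc is selected by the boundary value \<open>a\<close> alone and has frequency
  \<open>L\<close>; the calibration uses the frequency \<open>L'\<close> whose soliton peaks exactly
  at the maximum \<open>m\<close>.\<close>

lemma energy_above_curve:
  "\<exists>s. -1 < s \<and> s \<le> 1 \<and> curve \<alpha> s \<le> energy p \<alpha> u \<and> (s = 1 \<longrightarrow> level 1 < energy p \<alpha> u)"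
proof -
  obtain x1 where x1: "0 \<le> x1" "\<forall>x\<ge>0. \<bar>w x\<bar> \<le> \<bar>w x1\<bar>" using abs_w_attains_max by blast
  define a m where "a = \<bar>w 0\<bar>" and "m = \<bar>w x1\<bar>"
  have am: "0 \<le> a" "a \<le> m" and wm: "\<And>z. 0 \<le> z \<Longrightarrow> \<bar>w z\<bar> \<le> m" using x1 by (auto simp: a_def m_def)
  have w_nz: "\<not> (\<forall>x\<ge>0. w x = 0)"
  proof
    assume *: "\<forall>x\<ge>0. w x = 0"
    have "(LINT x|halfline. (w x)\<^sup>2) = (LINT x|halfline. 0)"
      by (rule Bochner_Integration.integral_cong) (use * in auto)
    then show False using w_mass \<mu> by simp
  qed
  have m: "m > 0"
  proof (rule ccontr)
    assume "\<not> m > 0"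
    then have "w z = 0" if "0 \<le> z" for z using wm[OF that] by simp
    then show False using w_nz by blast
  qed
  obtain s where s: "-1 < s" "s \<le> 1" "start s = a\<^sup>2" using start_surj[of "a\<^sup>2"] by auto
  define L L' where "L = freq s" and "L' = sqrt (2 / p * m powr (p - 2))"
  have L: "L > 0" using freq_pos s by (simp add: L_def)
  have L': "L' > 0" using m p by (simp add: L'_def)
  have hL': "height L' = m"
  proof -
    have "p / 2 * L'\<^sup>2 = m powr (p - 2)" using p by (simp add: L'_def)
    then have "height L' = m powr ((p - 2) * ((b + 1) / 2))" by (simp add: height_def powr_powr)
    also have "(p - 2) * ((b + 1) / 2) = 1" using b_times by (simp add: mult.commute)
    finally show ?thesis using m by simp
  qed
  have st: "(b + 1) * a\<^sup>2 = A * L powr (2 * b + 2) * (1 - s\<^sup>2) powr (b + 1)"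
    using s(3) b_gt by (simp add: start_def L_def field_simps)
  have s2: "s\<^sup>2 \<le> 1" using s by (simp add: abs_square_le_1 abs_le_iff)
  have aH: "a \<le> height L"
  proof -
    have "(1 - s\<^sup>2) powr (b + 1) \<le> 1" using s2 b_gt by (intro powr_le1) auto
    then have "(b + 1) * a\<^sup>2 \<le> (b + 1) * (height L)\<^sup>2"
      unfolding st height_sq[OF L] using A_pos mult_left_mono[of _ 1 "A * L powr (2 * b + 2)"] by simp
    then have "a\<^sup>2 \<le> (height L)\<^sup>2" using b_gt by simp
    then show ?thesis by (rule power2_le_imp_le) (use height_pos[OF L] in simp)
  qed
  \<comment> \<open>The value \<open>a\<close> determines only \<open>|s|\<close>; the sign of
    \<open>s\<close> tells whether the arc passes through the peak, hence the case split
    below.\<close>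
  have sl: "slope L a / L = \<bar>s\<bar>"
  proof -
    have inj: "x = y" if xy: "0 \<le> x" "0 \<le> y" "x powr c = y powr c" "0 < c" for x y c :: real
    proof (rule ccontr)
      assume "x \<noteq> y"
      then consider "x < y" | "y < x" by linarith
      then show False
        using powr_less_mono2[of c x y] powr_less_mono2[of c y x] xy by cases auto
    qed
    define \<rho> where "\<rho> = slope L a / L"
    have \<rho>: "0 \<le> \<rho>" "\<rho> \<le> 1" using slope_ratio[OF L am(1) aH] by (auto simp: \<rho>_def)
    have "A * L powr (2 * b + 2) * (1 - \<rho>\<^sup>2) powr (b + 1) = A * L powr (2 * b + 2) * (1 - s\<^sup>2) powr (b + 1)"
      using one_minus_slope_ratio_powr[OF L am(1) aH] st by (simp add: \<rho>_def)
    then have eq: "(1 - \<rho>\<^sup>2) powr (b + 1) = (1 - s\<^sup>2) powr (b + 1)" using A_pos L by simp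
    have "0 \<le> 1 - \<rho>\<^sup>2" using \<rho> by (simp add: abs_square_le_1)
    moreover have "0 \<le> 1 - s\<^sup>2" "0 < b + 1" using s2 b_gt by auto
    ultimately have "1 - \<rho>\<^sup>2 = 1 - s\<^sup>2"
      using inj[OF _ _ eq] by blast
    then have "\<rho>\<^sup>2 = s\<^sup>2" by simp
    then have "sqrt (\<rho>\<^sup>2) = sqrt (s\<^sup>2)" by (simp only:)
    then have "\<bar>\<rho>\<bar> = \<bar>s\<bar>" unfolding real_sqrt_abs .
    then show ?thesis using \<rho> by (simp add: \<rho>_def)
  qed
  have mass_a: "mass L a = A * L powr (2 * b + 1) * tail b \<bar>s\<bar>"
    and action_a: "action L a = A * L powr (2 * b + 3) * tail2 b \<bar>s\<bar>"
    by (simp_all add: mass_def action_def sl)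
  have J: "A * L powr (2 * b + 1) * J s = \<mu>" using freq_mass[OF s(1,2)] by (simp add: L_def)
  have lev: "level s = A * L powr (2 * b + 3) * tail2 b (- s) - L\<^sup>2 * \<mu> / 2" by (simp add: level_def L_def)
  have pos: "0 < A * L powr c" for c using A_pos L by simp
  have folded: "2 * action L (height L) - action L a + (L'\<^sup>2 - L\<^sup>2) / 2 * (2 * mass L (height L) - mass L a)
      \<le> 2 * action L' m - action L' a"
    using folded_action_tangent[OF L L' am(1) aH] am(2) by (simp add: hL')
  have cal: "2 * action L' m - action L' a - L'\<^sup>2 * \<mu> / 2 + defect L' \<le> free_energy"
    using calibrated_bound[OF L' wm _ x1(1)] by (simp add: hL' a_def m_def)
  have key: "level s \<le> free_energy \<and> (s = 1 \<longrightarrow> level s + defect L' \<le> free_energy)"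
  proof (cases "0 \<le> s")
    case True
    then have si: "s \<in> {-1..1}" using s by auto
    have "2 * mass L (height L) - mass L a = A * L powr (2 * b + 1) * (2 * tail b 0 - tail b s)"
      using True by (simp add: mass_height[OF L] mass_a algebra_simps)
    also have "\<dots> = \<mu>" using J J_eq[OF si] by simp
    \<comment> \<open>The folded mass is exactly \<open>\<mu>\<close>, so the linear term of the
      tangent inequality matches the change of the multiplier term.\<close>
    finally have 1: "2 * mass L (height L) - mass L a = \<mu>" .
    have "2 * action L (height L) - action L a = A * L powr (2 * b + 3) * (2 * tail2 b 0 - tail2 b s)"
      using True by (simp add: action_height[OF L] action_a algebra_simps)
    also have "\<dots> = level s + L\<^sup>2 * \<mu> / 2" using lev tail2_minus[OF b_gt si] by simp
    finally have 2: "2 * action L (height L) - action L a = level s + L\<^sup>2 * \<mu> / 2" .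
    have "level s + L\<^sup>2 * \<mu> / 2 + (L'\<^sup>2 - L\<^sup>2) / 2 * \<mu> \<le> 2 * action L' m - action L' a"
      using folded unfolding 1 2 .
    moreover have "(L'\<^sup>2 - L\<^sup>2) / 2 * \<mu> = L'\<^sup>2 * \<mu> / 2 - L\<^sup>2 * \<mu> / 2" by (simp add: field_simps)
    ultimately show ?thesis using cal defect_nonneg[of L'] by linarith
  next
    case False
    then have abs: "\<bar>s\<bar> = - s" by simp
    have mass\<mu>: "mass L a = \<mu>" using J by (simp add: mass_a abs J_def)
    have act: "action L a = level s + L\<^sup>2 * \<mu> / 2" using lev by (simp add: action_a abs)
    show ?thesis
    \<comment> \<open>For a monotone arc, a low competitor can be calibrated at \<open>L\<close>
      itself with \<open>x = 0\<close>. A high one has \<open>L \<le> L'\<close>, and its folded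
      mass at frequency \<open>L\<close> is at least \<open>\<mu>\<close>, so the surplus enters
      with a favourable sign.\<close>
    proof (cases "m \<le> height L")
      case True
      have "2 * action L a - action L a - L\<^sup>2 * \<mu> / 2 + defect L \<le> free_energy"
        using calibrated_bound[OF L wm True, of 0] by (simp add: a_def)
      then show ?thesis using act defect_nonneg[of L] False by auto
    next
      case mH: False
      have LL': "L \<le> L'"
      proof (rule ccontr)
        assume "\<not> L \<le> L'"
        then show False using height_mono[OF L', of L] mH hL' by simp
      qed
      have "tail b (- s) \<le> tail b 0"
        using tail_strict_antimono[OF b_gt, of 0 "-s"] False s by (intro less_imp_le) auto
      then have "mass L a \<le> mass L (height L)"
        unfolding mass_height[OF L] mass_a abs using pos by (intro mult_left_mono) (auto intro: less_imp_le)
      then have "0 \<le> (L'\<^sup>2 - L\<^sup>2) / 2 * (2 * mass L (height L) - mass L a - \<mu>)"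
        using LL' L mass\<mu> by (intro mult_nonneg_nonneg) (auto simp: power_mono)
      moreover have "(L'\<^sup>2 - L\<^sup>2) / 2 * (2 * mass L (height L) - mass L a - \<mu>)
          = (L'\<^sup>2 - L\<^sup>2) / 2 * (2 * mass L (height L) - mass L a) - L'\<^sup>2 * \<mu> / 2 + L\<^sup>2 * \<mu> / 2"
        by (simp add: field_simps)
      moreover have "tail2 b (- s) \<le> tail2 b 0"
        using False s by (intro tail2_antimono[OF b_gt]) auto
      then have "action L a \<le> action L (height L)"
        unfolding action_height[OF L] action_a abs using pos by (intro mult_left_mono) (auto intro: less_imp_le)
      ultimately show ?thesis using folded cal act defect_nonneg[of L'] False by auto
    qed
  qed
  \<comment> \<open>Equality would annihilate the defect, so \<open>|v|\<close> would be at most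
    \<open>L' |w|\<close> almost everywhere; with \<open>w 0 = 0\<close> this forces
    \<open>w = 0\<close>, against the positive mass.\<close>
  have "level 1 < free_energy" if "s = 1"
  proof (rule ccontr)
    assume "\<not> level 1 < free_energy"
    then have "defect L' = 0" using key defect_nonneg[of L'] that by simp
    then have 0: "(LINT x|halfline. (\<bar>v x\<bar> - \<bar>w x\<bar> * slope L' \<bar>w x\<bar>)\<^sup>2) = 0" by (simp add: defect_def)
    have gm: "(\<lambda>x. \<bar>w x\<bar> * slope L' \<bar>w x\<bar>) \<in> borel_measurable halfline" by (rule slope_w_measurable)
    have sw: "\<bar>w x\<bar> * slope L' \<bar>w x\<bar> \<le> L' * \<bar>w x\<bar>" "0 \<le> \<bar>w x\<bar> * slope L' \<bar>w x\<bar>" if "0 \<le> x" for x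
      using slope_le[OF L', of "\<bar>w x\<bar>"] slope_nonneg[OF L', of "\<bar>w x\<bar>"] wm[OF that] hL'
      by (auto simp: mult.commute[of L'] mult_left_mono)
    have int: "integrable halfline (\<lambda>x. (\<bar>v x\<bar> - \<bar>w x\<bar> * slope L' \<bar>w x\<bar>)\<^sup>2)"
    proof (rule Bochner_Integration.integrable_bound)
      show "integrable halfline (\<lambda>x. (v x)\<^sup>2 + L'\<^sup>2 * (w x)\<^sup>2)"
        using v2_integrable w2_integrable by simp
      show "AE x in halfline. norm ((\<bar>v x\<bar> - \<bar>w x\<bar> * slope L' \<bar>w x\<bar>)\<^sup>2) \<le> norm ((v x)\<^sup>2 + L'\<^sup>2 * (w x)\<^sup>2)"
      proof (rule AE_I2)
        fix x assume "x \<in> space halfline"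
        then have x: "0 \<le> x" by simp
        have "(\<bar>w x\<bar> * slope L' \<bar>w x\<bar>)\<^sup>2 \<le> (L' * \<bar>w x\<bar>)\<^sup>2"
          using sw[OF x] by (intro power_mono) auto
        moreover have "(\<bar>v x\<bar> - \<bar>w x\<bar> * slope L' \<bar>w x\<bar>)\<^sup>2 \<le> \<bar>v x\<bar>\<^sup>2 + (\<bar>w x\<bar> * slope L' \<bar>w x\<bar>)\<^sup>2"
          unfolding power2_diff using sw(2)[OF x] by simp
        ultimately show "norm ((\<bar>v x\<bar> - \<bar>w x\<bar> * slope L' \<bar>w x\<bar>)\<^sup>2) \<le> norm ((v x)\<^sup>2 + L'\<^sup>2 * (w x)\<^sup>2)"
          by (simp add: power_mult_distrib)
      qed
    qed (use gm in measurable)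
    have "AE x in halfline. (\<bar>v x\<bar> - \<bar>w x\<bar> * slope L' \<bar>w x\<bar>)\<^sup>2 = 0"
      using integral_nonneg_eq_0_iff_AE[OF int] 0 by simp
    moreover have "AE x in halfline. x \<in> {0<..}" using AE_space[of halfline] by simp
    ultimately have "AE x in halfline. \<bar>v x\<bar> \<le> L' * \<bar>w x\<bar>"
    proof eventually_elim
      case (elim x)
      then have "0 \<le> x" "\<bar>v x\<bar> = \<bar>w x\<bar> * slope L' \<bar>w x\<bar>" by auto
      then show ?case using sw(1)[of x] by simp
    qed
    moreover have "w 0 = 0" using s(3) that by (simp add: a_def)
    ultimately have "\<forall>x\<ge>0. w x = 0" using eq_0_of_derivative_bound[OF L'] by blast
    then show False using w_nz by blast
  qed
  moreover have "w 0 = 0" if "s = 1" using s(3) that by (simp add: a_def)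
  moreover have "a\<^sup>2 = (w 0)\<^sup>2" by (simp add: a_def)
  ultimately show ?thesis
    using s key by (intro exI[of _ s]) (auto simp: energy_eq curve_def)
qed

end

text \<open>The value \<open>level 1\<close> is approached by arcs but never reached by a competitor
  with boundary value \<open>0\<close>. A ground state therefore corresponds to an arc with
  \<open>s\<close> strictly below \<open>1\<close>.\<close>

lemma (in soliton_family) ground_state_iff:
  "(\<exists>u. ground_state p \<alpha> \<mu> u) \<longleftrightarrow> (\<exists>s. \<bar>s\<bar> < 1 \<and> curve \<alpha> s \<le> level 1)"
proof -
  have lower: "\<exists>s. -1 < s \<and> s \<le> 1 \<and> curve \<alpha> s \<le> energy p \<alpha> u \<and> (s = 1 \<longrightarrow> level 1 < energy p \<alpha> u)"
    if "u \<in> H1_mass \<mu>" for u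
  proof -
    have "u \<in> H1_halfline" using that by (simp add: H1_mass_def)
    then obtain w where "H1_representative u w" using H1_representative_ex by blast
    then interpret H1_representative u w .
    interpret soliton_comparison p \<mu> u w
      by unfold_locales (use that in auto)
    show ?thesis by (rule energy_above_curve)
  qed
  show ?thesis
  proof
    assume "\<exists>u. ground_state p \<alpha> \<mu> u"
    then obtain u where u: "u \<in> H1_mass \<mu>" and e: "ereal (energy p \<alpha> u) = min_energy p \<alpha> \<mu>"
      by (auto simp: ground_state_def)
    have le: "energy p \<alpha> u \<le> energy p \<alpha> U" if "U \<in> H1_mass \<mu>" for U
    proof -
      have "ereal (energy p \<alpha> u) \<le> ereal (energy p \<alpha> U)"
        unfolding e min_energy_def using that by (rule INF_lower)
      then show ?thesis by simp
    qed
    have le_curve: "energy p \<alpha> u \<le> curve \<alpha> s" if "\<bar>s\<bar> < 1" for s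
      using soliton_realises_curve[OF that, of \<alpha>] le by force
    \<comment> \<open>Letting \<open>s\<close> tend to \<open>1\<close> along admissible
      arcs.\<close>
    have le_1: "energy p \<alpha> u \<le> level 1"
    proof (rule ccontr)
      assume "\<not> energy p \<alpha> u \<le> level 1"
      then have gap: "energy p \<alpha> u - level 1 > 0" by simp
      have "\<exists>d>0. \<forall>s\<in>{-1<..1}. dist s 1 < d \<longrightarrow> dist (curve \<alpha> s) (curve \<alpha> 1) < energy p \<alpha> u - level 1"
        by (rule curve_continuous_on[unfolded continuous_on_iff, rule_format, OF _ gap]) simp
      then obtain d where d: "d > 0" "\<forall>s\<in>{-1<..1}. dist s 1 < d \<longrightarrow> dist (curve \<alpha> s) (curve \<alpha> 1) < energy p \<alpha> u - level 1"
        by blast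
      define s where "s = 1 - min (d / 2) (1 / 2)"
      have "\<bar>s\<bar> < 1" "s \<in> {-1<..1}" "dist s 1 < d" using d(1) by (auto simp: s_def dist_real_def)
      then show False using d(2) le_curve[of s] by (fastforce simp: dist_real_def)
    qed
    obtain s where s: "-1 < s" "s \<le> 1" "curve \<alpha> s \<le> energy p \<alpha> u" "s = 1 \<longrightarrow> level 1 < energy p \<alpha> u"
      using lower[OF u] by blast
    have "s \<noteq> 1" using s(4) le_1 by auto
    then show "\<exists>s. \<bar>s\<bar> < 1 \<and> curve \<alpha> s \<le> level 1"
      using s le_1 by (intro exI[of _ s]) auto
  next
    assume "\<exists>s. \<bar>s\<bar> < 1 \<and> curve \<alpha> s \<le> level 1"
    then obtain s0 where s0: "\<bar>s0\<bar> < 1" "curve \<alpha> s0 \<le> level 1" by blast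
    obtain t where t: "t \<in> {-1<..1}" "\<forall>r\<in>{-1<..1}. curve \<alpha> t \<le> curve \<alpha> r"
      using curve_attains_min by blast
    \<comment> \<open>If the minimum of the curve sits at the end, \<open>s0\<close> attains the
      same value and is realised by an actual arc.\<close>
    define s where "s = (if t = 1 then s0 else t)"
    have s: "\<bar>s\<bar> < 1" "\<forall>r\<in>{-1<..1}. curve \<alpha> s \<le> curve \<alpha> r"
      using t s0 by (auto simp: s_def abs_less_iff intro: order_trans)
    obtain U where U: "U \<in> H1_mass \<mu>" "energy p \<alpha> U = curve \<alpha> s"
      using soliton_realises_curve[OF s(1), of \<alpha>] by blast
    have "ereal (energy p \<alpha> U) = min_energy p \<alpha> \<mu>"
    proof (rule antisym)
      show "ereal (energy p \<alpha> U) \<le> min_energy p \<alpha> \<mu>"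
        unfolding min_energy_def
      proof (rule INF_greatest)
        fix u assume "u \<in> H1_mass \<mu>"
        then obtain r where "-1 < r" "r \<le> 1" "curve \<alpha> r \<le> energy p \<alpha> u" using lower by blast
        then show "ereal (energy p \<alpha> U) \<le> ereal (energy p \<alpha> u)"
          using s(2) U(2) by (auto intro: order_trans)
      qed
      show "min_energy p \<alpha> \<mu> \<le> ereal (energy p \<alpha> U)"
        unfolding min_energy_def by (rule INF_lower[OF U(1)])
    qed
    then show "\<exists>u. ground_state p \<alpha> \<mu> u" using U(1) by (auto simp: ground_state_def)
  qed
qed

theorem proposition1p4:
  fixes p \<mu> :: real
  assumes "2 < p" and "p < 6" and "\<mu> > 0"
  shows "(p \<le> 4 \<longrightarrow>
            (\<forall>\<alpha>::real. (\<exists>u. ground_state p \<alpha> \<mu> u) \<longleftrightarrow>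
               \<alpha> < gamma_p p * \<mu> powr ((p - 2) / (6 - p)))) \<and>
         (p > 4 \<longrightarrow>
            (\<exists>h::real. h > gamma_p p * \<mu> powr ((p - 2) / (6 - p)) \<and>
               (\<forall>\<alpha>::real. (\<exists>u. ground_state p \<alpha> \<mu> u) \<longleftrightarrow> \<alpha> \<le> h)))"
proof -
  interpret soliton_family p \<mu>
    by unfold_locales (use assms in auto)
  show ?thesis
    unfolding ground_state_iff freq_1_eq_gamma[symmetric]
    using curve_below_end_iff_le_4 curve_below_end_iff_gt_4 by blast
qed

end
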